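(* Let $n \ge 1$. If $n$ is odd then $d(PB_n) \geq n-1$. If $n$ is even then $d(PB_n) \geq n-2$.
   Context: For a group $G$, $d(G)$ is the smallest $d$ such that there is a faithful (injective) representation $G \hookrightarrow \operatorname{GL}_d(\mathbb{C})$ (with $d(G)=\infty$ if there is none). $PB_n$ is the pure braid group on $n$ strands, i.e. the pure mapping class group of a disk with $n$ marked points (mapping classes fixing the boundary pointwise and fixing each marked point). *)

theory Defs
  imports
    "HOL-Analysis.Analysis"
    "HOL-Algebra.Bij"
    "HOL-Algebra.Coset"
    "HOL-Library.Extended_Nat"
    "Jordan_Normal_Form.Matrix"
begin

definition disk :: "complex set"
  where "disk = cball 0 1"

text \<open>
  Self-maps of the disk are extensional functions (as in \<^const>\<open>Bij\<close>), so that two of them are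
  equal iff they agree on the disk. Fixing the boundary pointwise forces such a homeomorphism to
  preserve orientation, so no orientation condition is imposed.
\<close>

definition disk_homeos :: "complex set \<Rightarrow> (complex \<Rightarrow> complex) set"
  where "disk_homeos P =
    {f \<in> Bij disk. homeomorphic_map (top_of_set disk) (top_of_set disk) f \<and>
       (\<forall>x \<in> sphere 0 1. f x = x) \<and> (\<forall>p \<in> P. f p = p)}"

definition disk_homeo_group :: "complex set \<Rightarrow> (complex \<Rightarrow> complex) monoid"
  where "disk_homeo_group P = BijGroup disk \<lparr>carrier := disk_homeos P\<rparr>"

text \<open>Every stage of an isotopy is a homeomorphism fixing the boundary and the marked points.\<close>

definition disk_isotopic :: "complex set \<Rightarrow> (complex \<Rightarrow> complex) \<Rightarrow> (complex \<Rightarrow> complex) \<Rightarrow> bool"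
  where "disk_isotopic P =
    homotopic_with (\<lambda>h. h \<in> disk_homeos P) (top_of_set disk) (top_of_set disk)"

definition disk_homeos_isotopic_id :: "complex set \<Rightarrow> (complex \<Rightarrow> complex) set"
  where "disk_homeos_isotopic_id P =
    {f \<in> disk_homeos P. disk_isotopic P f \<one>\<^bsub>disk_homeo_group P\<^esub>}"

text \<open>
  The elements of the pure mapping class group are the isotopy classes; see
  \<open>rcoset_eq_iff_disk_isotopic\<close> and \<open>group_pure_disk_mcg\<close> below.
\<close>

definition pure_disk_mcg :: "complex set \<Rightarrow> (complex \<Rightarrow> complex) set monoid"
  where "pure_disk_mcg P = disk_homeo_group P Mod disk_homeos_isotopic_id P"

text \<open>\<open>n\<close> equally spaced points on the open segment from \<open>-1\<close> to \<open>1\<close>.\<close>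

definition marked_points :: "nat \<Rightarrow> complex set"
  where "marked_points n = (\<lambda>k. complex_of_real (2 * real k / real (n + 1) - 1)) ` {1..n}"

definition pure_braid_group :: "nat \<Rightarrow> (complex \<Rightarrow> complex) set monoid"
  where "pure_braid_group n = pure_disk_mcg (marked_points n)"

definition GL_complex :: "nat \<Rightarrow> complex mat monoid"
  where "GL_complex d = units_of (ring_mat TYPE(complex) d ())"

text \<open>The infimum of the empty set in \<^typ>\<open>enat\<close> is \<open>\<infinity>\<close>.\<close>

definition min_faithful_dim :: "('a, 'b) monoid_scheme \<Rightarrow> enat"
  where "min_faithful_dim G = Inf {enat d | d. mon G (GL_complex d) \<noteq> {}}"


lemma group_GL_complex: "group (GL_complex d)"
proof -
  interpret ring "ring_mat TYPE(complex) d ()" by (rule ring_mat)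
  show ?thesis unfolding GL_complex_def by (rule units_group)
qed

lemma marked_points_in_interior: "marked_points n \<subseteq> ball 0 1"
  by (auto simp: marked_points_def dist_norm abs_less_iff field_simps simp flip: of_real_diff
      simp del: of_real_diff of_real_divide)

lemma card_marked_points: "card (marked_points n) = n"
proof -
  have "inj_on (\<lambda>k. complex_of_real (2 * real k / real (n + 1) - 1)) {1..n}"
    unfolding inj_on_def of_real_eq_iff by simp
  then show ?thesis by (simp only: marked_points_def card_image) simp
qed

lemma sphere_in_disk: "x \<in> sphere 0 1 \<Longrightarrow> x \<in> disk"
  by (simp add: disk_def)

lemma disk_homeos_cont:
  "f \<in> disk_homeos P \<Longrightarrow> continuous_map (top_of_set disk) (top_of_set disk) f"
  unfolding disk_homeos_def by (blast intro: homeomorphic_imp_continuous_map)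

lemma disk_homeos_Bij: "f \<in> disk_homeos P \<Longrightarrow> f \<in> Bij disk"
  by (simp add: disk_homeos_def)

lemma disk_homeo_group_simps:
  "carrier (disk_homeo_group P) = disk_homeos P"
  "\<one>\<^bsub>disk_homeo_group P\<^esub> = (\<lambda>x\<in>disk. x)"
  "f \<in> disk_homeos P \<Longrightarrow> g \<in> disk_homeos P \<Longrightarrow> f \<otimes>\<^bsub>disk_homeo_group P\<^esub> g = compose disk f g"
  by (simp_all add: disk_homeo_group_def BijGroup_def disk_homeos_Bij)

lemma id_disk_homeos:
  assumes "P \<subseteq> disk" shows "(\<lambda>x\<in>disk. x) \<in> disk_homeos P"
proof -
  have "homeomorphic_map (top_of_set disk) (top_of_set disk) (\<lambda>x\<in>disk. x)"
    by (rule homeomorphic_map_eq[of _ _ id]) (auto simp: homeomorphic_map_id)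
  then show ?thesis
    using assms by (auto simp: disk_homeos_def id_Bij disk_def)
qed

lemma compose_disk_homeos:
  assumes "P \<subseteq> disk" "f \<in> disk_homeos P" "g \<in> disk_homeos P"
  shows "compose disk f g \<in> disk_homeos P"
proof -
  have "homeomorphic_map (top_of_set disk) (top_of_set disk) (f \<circ> g)"
    using assms by (auto simp: disk_homeos_def intro: homeomorphic_map_compose)
  then have "homeomorphic_map (top_of_set disk) (top_of_set disk) (compose disk f g)"
    by (rule homeomorphic_map_eq) (simp add: compose_eq)
  then show ?thesis
    using assms sphere_in_disk by (auto simp: disk_homeos_def compose_Bij compose_eq subset_iff)
qed

lemma inv_disk_homeos:
  assumes "P \<subseteq> disk" "f \<in> disk_homeos P"
  shows "(\<lambda>x\<in>disk. inv_into disk f x) \<in> disk_homeos P"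
proof -
  have bij: "bij_betw f disk disk"
    using assms by (simp add: disk_homeos_def Bij_def)
  have fp: "inv_into disk f x = x" if "x \<in> disk" "f x = x" for x
    using bij that by (metis bij_betw_inv_into_left)
  obtain g where g: "homeomorphic_maps (top_of_set disk) (top_of_set disk) f g"
    using assms by (auto simp: disk_homeos_def homeomorphic_map_maps)
  then have gh: "homeomorphic_map (top_of_set disk) (top_of_set disk) g"
    using homeomorphic_maps_sym homeomorphic_map_maps by blast
  have eq: "g x = (\<lambda>x\<in>disk. inv_into disk f x) x" if "x \<in> disk" for x
  proof -
    have "g x \<in> disk" "f (g x) = x"
      using g that by (auto simp: homeomorphic_maps_def continuous_map_def)
    then show ?thesis
      using bij_betw_inv_into_left[OF bij, of "g x"] that by simp
  qed
  have "homeomorphic_map (top_of_set disk) (top_of_set disk) (\<lambda>x\<in>disk. inv_into disk f x)"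
    by (rule homeomorphic_map_eq[OF gh]) (simp add: eq)
  then show ?thesis
    using assms sphere_in_disk fp
    by (auto simp: disk_homeos_def restrict_inv_into_Bij subset_iff)
qed

lemma subgroup_disk_homeos:
  assumes "P \<subseteq> disk" shows "subgroup (disk_homeos P) (BijGroup disk)"
proof (rule subgroup.intro)
  show "disk_homeos P \<subseteq> carrier (BijGroup disk)"
    by (auto simp: BijGroup_def disk_homeos_Bij)
  show "f \<otimes>\<^bsub>BijGroup disk\<^esub> g \<in> disk_homeos P"
    if "f \<in> disk_homeos P" "g \<in> disk_homeos P" for f g
    using that compose_disk_homeos[OF assms that] by (simp add: BijGroup_def disk_homeos_Bij)
  show "\<one>\<^bsub>BijGroup disk\<^esub> \<in> disk_homeos P"
    using id_disk_homeos[OF assms] by (simp add: BijGroup_def)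
  show "inv\<^bsub>BijGroup disk\<^esub> f \<in> disk_homeos P" if "f \<in> disk_homeos P" for f
    using inv_disk_homeos[OF assms that] by (simp only: inv_BijGroup[OF disk_homeos_Bij[OF that]])
qed

lemma group_disk_homeo_group: "P \<subseteq> disk \<Longrightarrow> group (disk_homeo_group P)"
  unfolding disk_homeo_group_def
  by (rule subgroup.subgroup_is_group[OF subgroup_disk_homeos group_BijGroup])

lemma disk_isotopic_refl: "f \<in> disk_homeos P \<Longrightarrow> disk_isotopic P f f"
  unfolding disk_isotopic_def homotopic_with_refl by (blast intro: disk_homeos_cont)

lemma disk_isotopic_sym: "disk_isotopic P f g \<Longrightarrow> disk_isotopic P g f"
  by (simp add: disk_isotopic_def homotopic_with_symD)

lemma disk_isotopic_trans: "disk_isotopic P f g \<Longrightarrow> disk_isotopic P g h \<Longrightarrow> disk_isotopic P f h"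
  unfolding disk_isotopic_def by (rule homotopic_with_trans)

lemma disk_isotopic_in:
  "disk_isotopic P f g \<Longrightarrow> f \<in> disk_homeos P" "disk_isotopic P f g \<Longrightarrow> g \<in> disk_homeos P"
  unfolding disk_isotopic_def by (auto dest: homotopic_with_imp_property)

lemma disk_isotopic_compose_right:
  assumes P: "P \<subseteq> disk" and fg: "disk_isotopic P f g" and k: "k \<in> disk_homeos P"
  shows "disk_isotopic P (compose disk f k) (compose disk g k)"
proof -
  let ?T = "top_of_set disk"
  obtain h where h: "continuous_map (prod_topology (top_of_set {0..1::real}) ?T) ?T h"
    "\<And>x. h (0, x) = f x" "\<And>x. h (1, x) = g x"
    "\<And>t. t \<in> {0..1} \<Longrightarrow> (\<lambda>x. h (t, x)) \<in> disk_homeos P"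
    using fg unfolding disk_isotopic_def homotopic_with_def by blast
  define H where "H = (\<lambda>(t::real, x). compose disk (\<lambda>x. h (t, x)) k x)"
  have "continuous_map (prod_topology (top_of_set {0..1::real}) ?T)
      (prod_topology (top_of_set {0..1}) ?T) (\<lambda>(t, x). (t, k x))"
    unfolding continuous_map_prod_top using disk_homeos_cont[OF k] by auto
  then have "continuous_map (prod_topology (top_of_set {0..1}) ?T) ?T (h \<circ> (\<lambda>(t, x). (t, k x)))"
    using h(1) by (rule continuous_map_compose)
  then have "continuous_map (prod_topology (top_of_set {0..1}) ?T) ?T H"
    by (rule continuous_map_eq) (auto simp: H_def compose_eq)
  then show ?thesis
    unfolding disk_isotopic_def homotopic_with_def
    using compose_disk_homeos[OF P h(4) k]
    by (intro exI[of _ H]) (auto simp: H_def h(2,3))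
qed

lemma disk_isotopic_compose_left:
  assumes P: "P \<subseteq> disk" and fg: "disk_isotopic P f g" and k: "k \<in> disk_homeos P"
  shows "disk_isotopic P (compose disk k f) (compose disk k g)"
proof -
  let ?T = "top_of_set disk"
  obtain h where h: "continuous_map (prod_topology (top_of_set {0..1::real}) ?T) ?T h"
    "\<And>x. h (0, x) = f x" "\<And>x. h (1, x) = g x"
    "\<And>t. t \<in> {0..1} \<Longrightarrow> (\<lambda>x. h (t, x)) \<in> disk_homeos P"
    using fg unfolding disk_isotopic_def homotopic_with_def by blast
  define H where "H = (\<lambda>(t::real, x). compose disk k (\<lambda>x. h (t, x)) x)"
  have "continuous_map (prod_topology (top_of_set {0..1}) ?T) ?T (k \<circ> h)"
    using h(1) disk_homeos_cont[OF k] by (rule continuous_map_compose)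
  then have "continuous_map (prod_topology (top_of_set {0..1}) ?T) ?T H"
    by (rule continuous_map_eq) (auto simp: H_def compose_eq)
  then show ?thesis
    unfolding disk_isotopic_def homotopic_with_def
    using compose_disk_homeos[OF P k h(4)]
    by (intro exI[of _ H]) (auto simp: H_def h(2,3))
qed

lemma normal_disk_homeos_isotopic_id:
  assumes P: "P \<subseteq> disk"
  shows "disk_homeos_isotopic_id P \<lhd> disk_homeo_group P"
proof -
  let ?G = "disk_homeo_group P" and ?N = "disk_homeos_isotopic_id P"
  interpret group ?G using P by (rule group_disk_homeo_group)
  note L = disk_isotopic_compose_left[OF P] and R = disk_isotopic_compose_right[OF P]
  have left: "disk_isotopic P (k \<otimes>\<^bsub>?G\<^esub> f) (k \<otimes>\<^bsub>?G\<^esub> g)"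
    and right: "disk_isotopic P (f \<otimes>\<^bsub>?G\<^esub> k) (g \<otimes>\<^bsub>?G\<^esub> k)"
    if "disk_isotopic P f g" "k \<in> carrier ?G" for f g k
    using L[of f g k] R[of f g k] that disk_isotopic_in[OF that(1)]
    by (simp_all add: disk_homeo_group_simps)
  have N: "f \<in> ?N \<longleftrightarrow> f \<in> carrier ?G \<and> disk_isotopic P f \<one>\<^bsub>?G\<^esub>" for f
    by (simp add: disk_homeos_isotopic_id_def disk_homeo_group_simps(1))
  have sub: "subgroup ?N ?G"
  proof (rule subgroupI)
    show "?N \<subseteq> carrier ?G" by (auto simp: N)
    have "\<one>\<^bsub>?G\<^esub> \<in> ?N"
      using disk_isotopic_refl[of "\<one>\<^bsub>?G\<^esub>" P] one_closed
      by (simp add: N disk_homeo_group_simps(1))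
    then show "?N \<noteq> {}" by blast
    show "inv\<^bsub>?G\<^esub> f \<in> ?N" if "f \<in> ?N" for f
      using that left[of f "\<one>\<^bsub>?G\<^esub>" "inv\<^bsub>?G\<^esub> f"] by (simp add: N disk_isotopic_sym)
    show "f \<otimes>\<^bsub>?G\<^esub> g \<in> ?N" if "f \<in> ?N" "g \<in> ?N" for f g
      using that right[of f "\<one>\<^bsub>?G\<^esub>" g] disk_isotopic_trans[of P "f \<otimes>\<^bsub>?G\<^esub> g" g "\<one>\<^bsub>?G\<^esub>"]
      by (simp add: N)
  qed
  show ?thesis
    unfolding normal_inv_iff
  proof (intro conjI ballI sub)
    fix x h assume x: "x \<in> carrier ?G" and h: "h \<in> ?N"
    then have "disk_isotopic P (x \<otimes>\<^bsub>?G\<^esub> h \<otimes>\<^bsub>?G\<^esub> inv\<^bsub>?G\<^esub> x) (x \<otimes>\<^bsub>?G\<^esub> \<one>\<^bsub>?G\<^esub> \<otimes>\<^bsub>?G\<^esub> inv\<^bsub>?G\<^esub> x)"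
      by (intro left right) (auto simp: N)
    then show "x \<otimes>\<^bsub>?G\<^esub> h \<otimes>\<^bsub>?G\<^esub> inv\<^bsub>?G\<^esub> x \<in> ?N"
      using x h by (simp add: N)
  qed
qed

lemma rcoset_eq_iff_disk_isotopic:
  assumes P: "P \<subseteq> disk" and f: "f \<in> disk_homeos P" and g: "g \<in> disk_homeos P"
  shows "disk_homeos_isotopic_id P #>\<^bsub>disk_homeo_group P\<^esub> f =
         disk_homeos_isotopic_id P #>\<^bsub>disk_homeo_group P\<^esub> g \<longleftrightarrow> disk_isotopic P f g"
proof -
  let ?G = "disk_homeo_group P" and ?N = "disk_homeos_isotopic_id P"
  interpret normal ?N ?G using P by (rule normal_disk_homeos_isotopic_id)
  have fg: "f \<in> carrier ?G" "g \<in> carrier ?G"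
    using f g by (simp_all add: disk_homeo_group_simps)
  have right: "disk_isotopic P (a \<otimes>\<^bsub>?G\<^esub> k) (b \<otimes>\<^bsub>?G\<^esub> k)"
    if "disk_isotopic P a b" "k \<in> carrier ?G" for a b k
    using disk_isotopic_compose_right[OF P that(1), of k] that disk_isotopic_in[OF that(1)]
    by (simp add: disk_homeo_group_simps)
  have "?N #>\<^bsub>?G\<^esub> f = ?N #>\<^bsub>?G\<^esub> g \<longleftrightarrow> f \<otimes>\<^bsub>?G\<^esub> inv\<^bsub>?G\<^esub> g \<in> ?N"
    using fg rcos_module[OF is_group fg(2) fg(1)] rcos_self[OF fg(1) subgroup_axioms]
      repr_independence[OF _ fg(2) subgroup_axioms, of f] by metis
  also have "\<dots> \<longleftrightarrow> disk_isotopic P (f \<otimes>\<^bsub>?G\<^esub> inv\<^bsub>?G\<^esub> g) \<one>\<^bsub>?G\<^esub>"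
    using m_closed[OF fg(1) inv_closed[OF fg(2)]]
    by (simp add: disk_homeos_isotopic_id_def disk_homeo_group_simps(1))
  also have "\<dots> \<longleftrightarrow> disk_isotopic P f g"
  proof
    assume "disk_isotopic P (f \<otimes>\<^bsub>?G\<^esub> inv\<^bsub>?G\<^esub> g) \<one>\<^bsub>?G\<^esub>"
    from right[OF this fg(2)] show "disk_isotopic P f g" using fg by (simp add: m_assoc)
  next
    assume "disk_isotopic P f g"
    from right[OF this inv_closed[OF fg(2)]]
    show "disk_isotopic P (f \<otimes>\<^bsub>?G\<^esub> inv\<^bsub>?G\<^esub> g) \<one>\<^bsub>?G\<^esub>" using fg by simp
  qed
  finally show ?thesis .
qed

lemma group_pure_disk_mcg: "P \<subseteq> disk \<Longrightarrow> group (pure_disk_mcg P)"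
  unfolding pure_disk_mcg_def by (intro normal.factorgroup_is_group normal_disk_homeos_isotopic_id)

lemma group_pure_braid_group: "group (pure_braid_group n)"
  unfolding pure_braid_group_def
  using marked_points_in_interior[of n] ball_subset_cball
  by (intro group_pure_disk_mcg) (auto simp: disk_def)

end

theory Submission
  imports
    Defs
    "HOL-Computational_Algebra.Fundamental_Theorem_Algebra"
    "HOL-Algebra.Generated_Groups"
    "HOL-Library.Function_Algebras"
begin

text \<open>
  Let \<open>n \<ge> 2 * m + 1\<close>. The disk with marked points \<open>1, \<dots>, n\<close> contains \<open>m\<close> disjoint
  four-holed spheres: for \<open>1 \<le> i \<le> m\<close>, the region between a circle around the points
  \<open>1, \<dots>, 2 * i - 1\<close> and a circle around the points \<open>1, \<dots>, 2 * i + 1\<close>. In each of them there are two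
  crossing curves, one around the points \<open>1, \<dots>, 2 * i\<close> and one around the points \<open>2 * i\<close> and
  \<open>2 * i + 1\<close>, and the two Dehn twists along these curves generate a group that is not solvable
  (it is free of rank two). Twists belonging to different \<open>i\<close> have disjoint supports and commute.
  So the pure braid group contains \<open>m\<close> pairwise commuting subgroups that are not solvable, and the
  bound follows from a fact of linear algebra: \<open>m\<close> pairwise commuting non-solvable groups of complex
  \<open>d \<times> d\<close> matrices can exist only if \<open>2 * m \<le> d\<close>. The odd case is \<open>n = 2 * m + 1\<close> and the even case
  is \<open>n = 2 * m + 2\<close>.

  The linear algebra is \<open>card_commuting_nonsolvable_le_dim\<close>, proved by induction on the dimension. A
  proper invariant subspace splits the problem, because a group that acts solvably on a
  subspace and on the quotient acts solvably. On an irreducible space one looks at a minimal subspace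
  \<open>E\<close> that is invariant under all groups but one. By Schur's lemma the omitted group moves \<open>E\<close>, which
  doubles the dimension, and the remaining groups still act on \<open>E\<close> without becoming solvable.

  For the topology one has to see that the two twists generate a non-solvable group of isotopy
  classes. The Alexander isotopy turns a homeomorphism \<open>f\<close> of the disk into a motion of three of the
  marked points, from their position back to their position. Their affine ratio
  then traces a loop in the plane without \<open>0\<close> and \<open>1\<close>. Transport along this loop in a covering with
  fibre \<^typ>\<open>nat\<close>, whose monodromy around the two punctures can be prescribed, assigns to
  \<open>f\<close> a permutation of \<^typ>\<open>nat\<close>. This is multiplicative (\<open>monodromy_compose\<close>) and invariant under
  isotopies (\<open>monodromy_isotopy\<close>). The twist along the first curve is sent to the permutation of
  one puncture, the twist along the second to that of the other
  (\<open>monodromy_twist_first_pair\<close>, \<open>monodromy_twist_last_pair\<close>). Choosing two 3-cycles that generate the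
  alternating group on five letters, every derived group of the group generated by the two twists
  still hits both 3-cycles (\<open>derived_power_hits_cycles\<close>), so none of them is trivial.
\<close>

section \<open>Finite-dimensional subspaces of a complex vector space\<close>

locale complex_space = vector_space scale
  for scale :: "complex \<Rightarrow> 'v::ab_group_add \<Rightarrow> 'v"
begin

text \<open>
  The degree \<open>d\<close> of a representation is a variable, whereas a type of vectors has one fixed
  dimension. Hence the spaces considered are finite-dimensional subspaces of a type that is itself
  of arbitrary dimension.
\<close>

definition fin_dim :: "'v set \<Rightarrow> bool"
  where "fin_dim S \<longleftrightarrow> (\<exists>B. finite B \<and> S \<subseteq> span B)"

lemma fin_dim_subset: "fin_dim T \<Longrightarrow> S \<subseteq> T \<Longrightarrow> fin_dim S"
  unfolding fin_dim_def by blast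

lemma independent_card_le:
  assumes "fin_dim W" "independent B" "B \<subseteq> W"
  shows "finite B \<and> card B \<le> dim W"
proof -
  obtain F where F: "finite F" "W \<subseteq> span F" using assms(1) by (auto simp: fin_dim_def)
  obtain C where C: "C \<subseteq> W" "independent C" "W \<subseteq> span C" "card C = dim W"
    using basis_exists by blast
  have "finite C" using independent_span_bound[OF F(1) C(2)] C(1) F(2) by auto
  then show ?thesis using independent_span_bound[OF _ assms(2), of C] C assms(3) by auto
qed

lemma dim_mono_fin_dim:
  assumes "fin_dim W" "U \<subseteq> W" shows "dim U \<le> dim W"
  using assms by (metis basis_exists independent_card_le subset_trans)

lemma subspace_eqI_dim:
  assumes "fin_dim W" "subspace U" "subspace W" "U \<subseteq> W" "dim W \<le> dim U" shows "U = W"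
proof (rule ccontr)
  assume "U \<noteq> W"
  then obtain w where w: "w \<in> W" "w \<notin> U" using assms(4) by blast
  obtain B where B: "B \<subseteq> U" "independent B" "U \<subseteq> span B" "card B = dim U"
    using basis_exists by blast
  have "span B \<subseteq> U" using B(1) assms(2) by (rule span_minimal)
  then have ni: "w \<notin> span B" using w by blast
  then have "independent (insert w B)" using B(2) by (simp add: independent_insert)
  then have "card (insert w B) \<le> dim W \<and> finite B"
    using independent_card_le[OF assms(1), of "insert w B"] B(1) assms(4) w by auto
  moreover have "w \<notin> B" using ni by (auto intro: span_base)
  ultimately show False using B(4) assms(5) by auto
qed

lemma dim_less_fin_dim:
  assumes "fin_dim W" "subspace U" "subspace W" "U \<subset> W" shows "dim U < dim W"
  using assms subspace_eqI_dim[of W U] by (auto simp: psubset_eq not_le[symmetric])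

text \<open>
  A basis \<open>B\<close> of \<open>U\<close> extends to a basis \<open>C\<close> of \<open>E\<close> and to a basis \<open>D\<close> of \<open>F\<close>. Then \<open>C \<union> (D - B)\<close> is
  still independent: a linear relation yields a combination of \<open>D - B\<close> that lies in \<open>E \<inter> F\<close>, hence in
  the span of \<open>B\<close>, so its coefficients vanish because \<open>D\<close> is independent, and the others vanish
  because \<open>C\<close> is.
\<close>

lemma dim_add_dim_le_of_Int:
  assumes fW: "fin_dim W" and sub: "subspace E" "subspace F" "subspace U"
    and "E \<subseteq> W" "F \<subseteq> W" and int: "E \<inter> F = U"
  shows "dim E + dim F \<le> dim W + dim U"
proof -
  obtain B where B: "B \<subseteq> U" "independent B" "U \<subseteq> span B" "card B = dim U"
    using basis_exists by blast
  have BE: "B \<subseteq> E" and BF: "B \<subseteq> F" using B(1) int by auto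
  obtain C where C: "B \<subseteq> C" "C \<subseteq> E" "independent C" "E \<subseteq> span C"
    using maximal_independent_subset_extend[OF BE B(2)] by blast
  obtain D where D: "B \<subseteq> D" "D \<subseteq> F" "independent D" "F \<subseteq> span D"
    using maximal_independent_subset_extend[OF BF B(2)] by blast
  have fin: "finite C" "finite D" "finite B"
    using independent_card_le[OF fW C(3)] independent_card_le[OF fW D(3)] C D assms(5,6)
    by (auto intro: finite_subset)
  have cC: "card C = dim E" and cD: "card D = dim F"
    using basis_card_eq_dim C D by blast+
  have dis: "C \<inter> (D - B) = {}"
  proof (rule ccontr)
    assume "C \<inter> (D - B) \<noteq> {}"
    then obtain x where x: "x \<in> C" "x \<in> D" "x \<notin> B" by blast
    then have "x \<in> U" using C(2) D(2) int by blast
    then have "x \<in> span (D - {x})" using B(3) x(3) D(1) span_mono[of B "D - {x}"] by blast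
    then show False using D(3) x(2) by (auto simp: dependent_def)
  qed
  have "independent (C \<union> (D - B))"
  proof (rule independent_if_scalars_zero)
    show "finite (C \<union> (D - B))" using fin by simp
    fix f x assume s0: "(\<Sum>x\<in>C \<union> (D - B). scale (f x) x) = 0" and x: "x \<in> C \<union> (D - B)"
    define e where "e = (\<Sum>x\<in>C. scale (f x) x)"
    define d where "d = (\<Sum>x\<in>D - B. scale (f x) x)"
    have ed: "e + d = 0" using s0 sum.union_disjoint[of C "D - B" "\<lambda>x. scale (f x) x"] fin dis
      by (simp add: e_def d_def)
    have "e \<in> E" unfolding e_def using C(2) by (intro subspace_sum subspace_scale sub) auto
    moreover have "d \<in> F" unfolding d_def using D(2) by (intro subspace_sum subspace_scale sub) auto
    moreover have de: "d = - e" using ed by (simp add: eq_neg_iff_add_eq_0 add.commute)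
    ultimately have "d \<in> U" using int subspace_neg[OF sub(1)] by blast
    then have "d \<in> span B" using B(3) by blast
    then obtain g where g: "d = (\<Sum>x\<in>B. scale (g x) x)" using span_finite[OF fin(3)] by auto
    define h where "h = (\<lambda>x. if x \<in> B then - g x else f x)"
    have "(\<Sum>x\<in>D. scale (h x) x) = (\<Sum>x\<in>D - B. scale (h x) x) + (\<Sum>x\<in>B. scale (h x) x)"
      by (rule sum.subset_diff[OF D(1) fin(2)])
    also have "\<dots> = d + - d"
      by (subst (2) g) (simp add: h_def d_def sum_negf)
    finally have "(\<Sum>x\<in>D. scale (h x) x) = 0" by simp
    then have h0: "h y = 0" if "y \<in> D" for y
      using D(3) fin(2) that unfolding dependent_finite[OF fin(2)] by blast
    then have f0: "f y = 0" if "y \<in> D - B" for y using that by (force simp: h_def)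
    then have "d = 0" unfolding d_def by (intro sum.neutral) auto
    then have "(\<Sum>x\<in>C. scale (f x) x) = 0" using ed by (simp add: e_def)
    then have "f y = 0" if "y \<in> C" for y
      using C(3) that unfolding dependent_finite[OF fin(1)] by blast
    then show "f x = 0" using f0 x by blast
  qed
  then have "card (C \<union> (D - B)) \<le> dim W"
    using independent_card_le[OF fW] C(2) D(2) assms(5,6) by blast
  moreover have "card (C \<union> (D - B)) = card C + (card D - card B)"
    using fin dis D(1) by (simp add: card_Un_disjoint card_Diff_subset)
  moreover have "card B \<le> card D" using D(1) fin(2) by (simp add: card_mono)
  ultimately show ?thesis using cC cD B(4) by simp
qed

text \<open>
  An eigenvector in the quotient of \<open>W\<close> by \<open>U\<close>. Choose \<open>w\<close> in \<open>W\<close> outside \<open>U\<close> and let \<open>ev p\<close> be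
  \<open>p(T) w\<close>. By finiteness of the dimension some nonzero \<open>p\<close> has \<open>ev p \<in> U\<close>; take one of least degree.
  It is not constant, so it has a root \<open>z\<close>, and for the cofactor \<open>q\<close> of the linear factor the
  vector \<open>ev q\<close> is not in \<open>U\<close> by minimality, while \<open>(T - z) (ev q) = ev p\<close> is.
\<close>

lemma eigenvector_modulo:
  assumes fW: "fin_dim W" and sub: "subspace U" "subspace W" and UW: "U \<subset> W"
    and T: "Vector_Spaces.linear scale scale T" and TW: "\<And>w. w \<in> W \<Longrightarrow> T w \<in> W"
  obtains c w where "w \<in> W" "w \<notin> U" "T w - scale c w \<in> U"
proof -
  interpret T: Vector_Spaces.linear scale scale T by (rule T)
  obtain w where w: "w \<in> W" "w \<notin> U" using UW by blast
  define v where "v i = (T ^^ i) w" for i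
  have v0: "v 0 = w" and vS: "v (Suc i) = T (v i)" for i by (simp_all add: v_def)
  have vW: "v i \<in> W" for i by (induction i) (simp_all add: v0 vS w TW)
  define ev where "ev p = (\<Sum>i\<le>degree p. scale (coeff p i) (v i))" for p
  have ev_eq: "ev p = (\<Sum>i\<le>n. scale (coeff p i) (v i))" if "degree p \<le> n" for p n
    unfolding ev_def using that by (intro sum.mono_neutral_left) (auto simp: coeff_eq_0)
  have ev_W: "ev p \<in> W" for p unfolding ev_def by (intro subspace_sum subspace_scale sub vW)
  have ev_diff: "ev (p - q) = ev p - ev q" for p q
  proof -
    let ?n = "max (degree p) (degree q)"
    show ?thesis
      using degree_diff_le[of p ?n q]
      by (simp add: ev_eq[of _ ?n] scale_left_diff_distrib sum_subtractf)
  qed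
  have ev_shift: "ev (pCons 0 q) = T (ev q)" for q
  proof -
    have "ev (pCons 0 q) = (\<Sum>i\<le>Suc (degree q). scale (coeff (pCons 0 q) i) (v i))"
      by (rule ev_eq) (simp add: degree_pCons_le)
    also have "\<dots> = (\<Sum>i\<le>degree q. scale (coeff q i) (T (v i)))"
      by (subst sum.atMost_Suc_shift) (simp add: vS)
    also have "\<dots> = T (ev q)" by (simp add: ev_def T.sum T.scale)
    finally show ?thesis .
  qed
  have ev_smult: "ev (Polynomial.smult c q) = scale c (ev q)" for c q
    by (simp add: ev_eq[of "Polynomial.smult c q" "degree q"] degree_smult_le) (simp add: ev_def scale_sum_right)
  have ev_factor: "ev ([:-c, 1:] * q) = T (ev q) - scale c (ev q)" for c q
  proof -
    have "[:-c, 1:] * q = pCons 0 q - Polynomial.smult c q" by simp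
    then show ?thesis by (simp only: ev_diff ev_shift ev_smult)
  qed
  have "\<exists>p. p \<noteq> 0 \<and> ev p = 0"
  proof (cases "inj_on v {..dim W}")
    case False
    then obtain i j where "i \<noteq> j" "v i = v j" by (auto simp: inj_on_def)
    moreover have "ev (monom 1 k) = v k" for k
    proof -
      have "ev (monom 1 k) = (\<Sum>i\<le>k. if i = k then v k else 0)"
        unfolding ev_def by (rule sum.cong) (auto simp: degree_monom_eq)
      then show ?thesis by simp
    qed
    ultimately show ?thesis
      by (intro exI[of _ "monom 1 i - monom 1 j"]) (simp add: ev_diff poly_eq_iff, metis one_neq_zero)
  next
    case True
    have "dependent (v ` {..dim W})"
      using independent_card_le[OF fW, of "v ` {..dim W}"] vW True by (force simp: card_image)
    then obtain u x where u: "x \<le> dim W" "u (v x) \<noteq> 0"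
      "(\<Sum>y\<in>v ` {..dim W}. scale (u y) y) = 0"
      by (auto simp: dependent_finite)
    define p where "p = (\<Sum>i\<le>dim W. monom (u (v i)) i)"
    have cp: "coeff p i = (if i \<le> dim W then u (v i) else 0)" for i
      by (simp add: p_def coeff_sum)
    then have "degree p \<le> dim W" by (intro degree_le) simp
    then have "ev p = (\<Sum>i\<le>dim W. scale (u (v i)) (v i))" by (simp add: ev_eq cp)
    also have "\<dots> = 0" using u(3) True by (simp add: sum.reindex)
    finally show ?thesis using cp[of x] u by (metis coeff_0)
  qed
  then have ex: "\<exists>p. p \<noteq> 0 \<and> ev p \<in> U" using subspace_0[OF sub(1)] by force
  then obtain p where p: "p \<noteq> 0" "ev p \<in> U"
    and least: "\<And>q. q \<noteq> 0 \<Longrightarrow> ev q \<in> U \<Longrightarrow> degree p \<le> degree q"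
    using ex_has_least_nat[of "\<lambda>p. p \<noteq> 0 \<and> ev p \<in> U" _ degree] by blast
  have "degree p \<noteq> 0"
  proof
    assume "degree p = 0"
    then obtain c where c: "p = [:c:]" by (rule degree_eq_zeroE)
    then have "scale (inverse c) (ev p) = w" "c \<noteq> 0" using p(1) by (simp_all add: ev_def v0)
    then show False using w(2) subspace_scale[OF sub(1) p(2)] by metis
  qed
  then obtain z where "poly p z = 0"
    using fundamental_theorem_of_algebra[of p] by (auto simp: constant_degree)
  then obtain q where q: "p = [:-z, 1:] * q" by (auto simp: poly_eq_0_iff_dvd)
  then have "q \<noteq> 0" using p(1) by auto
  then have "degree p = Suc (degree q)" unfolding q by (subst degree_mult_eq) auto
  then have "ev q \<notin> U" using least[OF \<open>q \<noteq> 0\<close>] by auto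
  moreover have "T (ev q) - scale z (ev q) \<in> U" using p(2) by (simp only: q ev_factor)
  ultimately show thesis using that ev_W by blast
qed

end

section \<open>Commuting non-solvable groups of linear maps\<close>

lemma (in group) derived_power_antimono:
  assumes "subgroup H G" "k \<le> l" shows "(derived G ^^ l) H \<subseteq> (derived G ^^ k) H"
  using assms(2)
proof (induction rule: dec_induct)
  case (step n)
  then show ?case using derived_incl[OF order_refl exp_of_derived_is_subgroup[OF assms(1)], of n] by auto
qed simp

lemma (in group) derived_power_normal:
  assumes "subgroup H G" shows "(derived G ^^ k) H \<lhd> G\<lparr>carrier := H\<rparr>"
proof (induction k)
  interpret S: group "G\<lparr>carrier := H\<rparr>" using assms by (rule subgroup_imp_group)
  case 0 show ?case using S.normal_self by simp
next
  interpret S: group "G\<lparr>carrier := H\<rparr>" using assms by (rule subgroup_imp_group)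
  case (Suc k)
  have "(derived G ^^ k) H \<subseteq> H" using derived_power_antimono[OF assms, of 0 k] by simp
  then show ?case using S.derived_is_normal[OF Suc] by (simp add: derived_consistent assms)
qed

text \<open>
  The identity of \<open>G\<close> is required to act trivially on \<open>V\<close> only: the matrices considered later act on
  all sequences, but kill the coordinates beyond the first \<open>d\<close>.
\<close>

locale linear_group_action = complex_space scale + group G
  for scale :: "complex \<Rightarrow> 'v::ab_group_add \<Rightarrow> 'v" and G (structure) +
  fixes act :: "'g \<Rightarrow> 'v \<Rightarrow> 'v" and V :: "'v set"
  assumes act_linear: "g \<in> carrier G \<Longrightarrow> Vector_Spaces.linear scale scale (act g)"
    and act_mult: "g \<in> carrier G \<Longrightarrow> h \<in> carrier G \<Longrightarrow> act (g \<otimes> h) v = act g (act h v)"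
    and act_one: "v \<in> V \<Longrightarrow> act \<one> v = v"
    and V: "subspace V" "fin_dim V" and act_V: "g \<in> carrier G \<Longrightarrow> v \<in> V \<Longrightarrow> act g v \<in> V"
begin

definition invariant :: "'g set \<Rightarrow> 'v set \<Rightarrow> bool"
  where "invariant H X \<longleftrightarrow> subspace X \<and> X \<subseteq> V \<and> (\<forall>h\<in>H. \<forall>x\<in>X. act h x \<in> X)"

text \<open>
  A pair \<open>U \<subseteq> W\<close> of invariant subspaces stands for the quotient of \<open>W\<close> by \<open>U\<close>. The next two
  definitions say that an element acts as the identity on this quotient, and that the image of a
  subgroup in the linear group of this quotient is solvable. Working with pairs avoids quotient spaces
  in an induction that passes to subspaces and quotients alike.
\<close>

definition trivial_on :: "'g \<Rightarrow> 'v set \<Rightarrow> 'v set \<Rightarrow> bool"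
  where "trivial_on g U W \<longleftrightarrow> (\<forall>w\<in>W. act g w - w \<in> U)"

definition solvable_on :: "'g set \<Rightarrow> 'v set \<Rightarrow> 'v set \<Rightarrow> bool"
  where "solvable_on H U W \<longleftrightarrow> (\<exists>k. \<forall>h\<in>(derived G ^^ k) H. trivial_on h U W)"

lemma act_diff: "g \<in> carrier G \<Longrightarrow> act g (v - w) = act g v - act g w"
  using act_linear module_hom.diff[of scale scale "act g"] by (simp add: module_hom_iff_linear)

lemma act_add: "g \<in> carrier G \<Longrightarrow> act g (v + w) = act g v + act g w"
  using act_linear module_hom.add[of scale scale "act g"] by (simp add: module_hom_iff_linear)

lemma act_scale: "g \<in> carrier G \<Longrightarrow> act g (scale c v) = scale c (act g v)"
  using act_linear module_hom.scale[of scale scale "act g"] by (simp add: module_hom_iff_linear)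

lemma act_inv:
  assumes "g \<in> carrier G" "v \<in> V"
  shows "act g (act (inv g) v) = v" "act (inv g) (act g v) = v"
  using assms act_mult[of g "inv g" v] act_mult[of "inv g" g v] act_one[of v] by simp_all

lemma commuting_actions:
  assumes "g \<in> carrier G" "h \<in> carrier G" "g \<otimes> h = h \<otimes> g"
  shows "act g (act h v) = act h (act g v)"
  using assms act_mult by metis

lemma invariantD:
  assumes "invariant H X"
  shows "subspace X" "X \<subseteq> V" "\<And>h x. h \<in> H \<Longrightarrow> x \<in> X \<Longrightarrow> act h x \<in> X"
  using assms by (auto simp: invariant_def)

lemma invariant_fin_dim: "invariant H X \<Longrightarrow> fin_dim X"
  using fin_dim_subset[OF V(2)] by (simp add: invariant_def)

lemma subgroup_trivial_on:
  assumes H: "subgroup H G" and U: "invariant H U" and W: "invariant H W"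
  shows "subgroup {h \<in> H. trivial_on h U W} G"
proof (rule subgroupI)
  note Hc = subgroup.mem_carrier[OF H]
  show "{h \<in> H. trivial_on h U W} \<subseteq> carrier G" using Hc by auto
  have "trivial_on \<one> U W"
    using invariantD(2)[OF W] act_one subspace_0[OF invariantD(1)[OF U]] by (auto simp: trivial_on_def)
  then show "{h \<in> H. trivial_on h U W} \<noteq> {}" using subgroup.one_closed[OF H] by blast
  fix g assume g: "g \<in> {h \<in> H. trivial_on h U W}"
  then have gc: "g \<in> carrier G" and gi: "inv g \<in> H" using Hc subgroup.m_inv_closed[OF H] by auto
  have "act (inv g) w - w \<in> U" if w: "w \<in> W" for w
  proof -
    have "act (inv g) (act g w - w) \<in> U"
      using invariantD(3)[OF U gi] g w by (auto simp: trivial_on_def)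
    then have "- (act (inv g) (act g w - w)) \<in> U" by (rule subspace_neg[OF invariantD(1)[OF U]])
    then show ?thesis using gc w act_inv(2)[OF gc, of w] invariantD(2)[OF W] by (auto simp: act_diff)
  qed
  then show "inv g \<in> {h \<in> H. trivial_on h U W}" using gi by (simp add: trivial_on_def)
  fix h assume h: "h \<in> {h \<in> H. trivial_on h U W}"
  then have hc: "h \<in> carrier G" using Hc by auto
  have "act (g \<otimes> h) w - w \<in> U" if w: "w \<in> W" for w
  proof -
    have "act g (act h w - w) \<in> U"
      using invariantD(3)[OF U, of g] g h w by (auto simp: trivial_on_def)
    moreover have "act g w - w \<in> U" using g w by (simp add: trivial_on_def)
    ultimately have "act g (act h w - w) + (act g w - w) \<in> U"
      by (rule subspace_add[OF invariantD(1)[OF U]])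
    then show ?thesis using gc hc by (simp add: act_diff act_mult)
  qed
  then show "g \<otimes> h \<in> {h \<in> H. trivial_on h U W}"
    using g h subgroup.m_closed[OF H] by (simp add: trivial_on_def)
qed

text \<open>
  The elements of \<open>H\<close> that act trivially on the quotient of \<open>W\<close> by \<open>U\<close> form a subgroup, so it suffices
  to look at commutators.
\<close>

lemma derived_trivial_on:
  assumes H: "subgroup H G" and K: "K \<subseteq> H" and U: "invariant H U" and W: "invariant H W"
    and comm: "\<And>g h w. g \<in> K \<Longrightarrow> h \<in> K \<Longrightarrow> w \<in> W \<Longrightarrow> act g (act h w) - act h (act g w) \<in> U"
    and h: "h \<in> derived G K"
  shows "trivial_on h U W"
proof -
  have "derived_set G K \<subseteq> {h \<in> H. trivial_on h U W}"
  proof clarsimp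
    fix a b assume ab: "a \<in> K" "b \<in> K"
    then have abH: "a \<in> H" "b \<in> H" "inv a \<in> H" "inv b \<in> H"
      using K subgroup.m_inv_closed[OF H] by auto
    note abc = abH[THEN subgroup.mem_carrier[OF H]]
    have "act (a \<otimes> b \<otimes> inv a \<otimes> inv b) w - w \<in> U" if w: "w \<in> W" for w
    proof -
      let ?w = "act (inv a) (act (inv b) w)"
      have wV: "w \<in> V" "act (inv b) w \<in> V" using w invariantD(2)[OF W] act_V abc by auto
      have "?w \<in> W" using w invariantD(3)[OF W] abH by blast
      from comm[OF ab this]
      show ?thesis using abc wV act_inv(1) by (simp add: act_mult)
    qed
    then show "a \<otimes> b \<otimes> inv a \<otimes> inv b \<in> H \<and> trivial_on (a \<otimes> b \<otimes> inv a \<otimes> inv b) U W"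
      using abH subgroup.m_closed[OF H] by (simp add: trivial_on_def)
  qed
  then have "derived G K \<subseteq> {h \<in> H. trivial_on h U W}"
    unfolding derived_def by (rule generate_subgroup_incl[OF _ subgroup_trivial_on[OF H U W]])
  then show ?thesis using h by blast
qed

text \<open>
  Far enough in the derived series the elements act as \<open>1 + N\<close> with \<open>N\<close> mapping \<open>W\<close> to \<open>X\<close> and \<open>X\<close>
  to \<open>U\<close>. A product of two such \<open>N\<close> maps \<open>W\<close> to \<open>U\<close>, so these elements commute modulo \<open>U\<close>, and
  the next derived group acts trivially.
\<close>

lemma solvable_on_extension:
  assumes H: "subgroup H G" and U: "invariant H U" and X: "invariant H X" and W: "invariant H W"
    and "solvable_on H U X" "solvable_on H X W"
  shows "solvable_on H U W"
proof -
  obtain k l where k: "\<And>h. h \<in> (derived G ^^ k) H \<Longrightarrow> trivial_on h U X"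
    and l: "\<And>h. h \<in> (derived G ^^ l) H \<Longrightarrow> trivial_on h X W"
    using assms(5,6) unfolding solvable_on_def by blast
  define K where "K = (derived G ^^ max k l) H"
  have K: "K \<subseteq> H" "\<And>h. h \<in> K \<Longrightarrow> trivial_on h U X" "\<And>h. h \<in> K \<Longrightarrow> trivial_on h X W"
    using derived_power_antimono[OF H, of 0 "max k l"] derived_power_antimono[OF H, of k "max k l"]
      derived_power_antimono[OF H, of l "max k l"] k l by (auto simp: K_def)
  have "trivial_on h U W" if "h \<in> derived G K" for h
  proof (rule derived_trivial_on[OF H K(1) U W _ that])
    fix a b w assume ab: "a \<in> K" "b \<in> K" and w: "w \<in> W"
    have abc: "a \<in> carrier G" "b \<in> carrier G" using ab K(1) subgroup.mem_carrier[OF H] by auto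
    have "act a w - w \<in> X" "act b w - w \<in> X" using K(3) ab w by (auto simp: trivial_on_def)
    then have "act a (act b w - w) - (act b w - w) \<in> U" "act b (act a w - w) - (act a w - w) \<in> U"
      using K(2) ab by (auto simp: trivial_on_def)
    then have "(act a (act b w - w) - (act b w - w)) - (act b (act a w - w) - (act a w - w)) \<in> U"
      by (rule subspace_diff[OF invariantD(1)[OF U]])
    then show "act a (act b w) - act b (act a w) \<in> U" using abc by (simp add: act_diff algebra_simps)
  qed
  then have "\<forall>h\<in>(derived G ^^ Suc (max k l)) H. trivial_on h U W" by (simp add: K_def)
  then show ?thesis unfolding solvable_on_def by blast
qed

lemma image_subspace: "g \<in> carrier G \<Longrightarrow> subspace X \<Longrightarrow> subspace (act g ` X)"
  using act_linear[of g] module_hom.subspace_image[of scale scale "act g"]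
  by (simp add: module_hom_iff_linear)

lemma dim_image_act:
  assumes g: "g \<in> carrier G" and X: "X \<subseteq> V" shows "dim (act g ` X) \<le> dim X"
proof -
  obtain B where B: "B \<subseteq> X" "independent B" "X \<subseteq> span B" "card B = dim X"
    using basis_exists by blast
  have fB: "finite B" using independent_card_le[OF fin_dim_subset[OF V(2) X] B(2,1)] by simp
  have "act g ` X \<subseteq> span (act g ` B)"
    using B(3) act_linear[OF g] module_hom.span_image[of scale scale "act g" B]
    by (auto simp: module_hom_iff_linear)
  then have "dim (act g ` X) \<le> card (act g ` B)" using fB by (intro dim_le_card) auto
  then show ?thesis using card_image_le[OF fB, of "act g"] B(4) by simp
qed

text \<open>
  Schur's lemma. Modulo \<open>U\<close>, an element of \<open>L\<close> has an eigenvector in \<open>W\<close>; its eigenspace is invariant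
  under \<open>K\<close> because \<open>K\<close> and \<open>L\<close> commute, so it is all of \<open>W\<close>. Thus \<open>L\<close> acts by scalars on the quotient,
  and its image is abelian.
\<close>

lemma solvable_on_of_commuting_irreducible:
  assumes L: "subgroup L G" and K: "K \<subseteq> carrier G"
    and comm: "\<And>g h. g \<in> K \<Longrightarrow> h \<in> L \<Longrightarrow> g \<otimes> h = h \<otimes> g"
    and UL: "invariant L U" and UK: "invariant K U" and WL: "invariant L W" and WK: "invariant K W"
    and UW: "U \<subset> W"
    and irred: "\<And>X. invariant K X \<Longrightarrow> U \<subset> X \<Longrightarrow> X \<subseteq> W \<Longrightarrow> X = W"
  shows "solvable_on L U W"
proof -
  note sU = invariantD(1)[OF UL] and sW = invariantD(1)[OF WL]
  have scalar: "\<exists>c. \<forall>w\<in>W. act h w - scale c w \<in> U" if h: "h \<in> L" for h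
  proof -
    have hc: "h \<in> carrier G" using h by (rule subgroup.mem_carrier[OF L])
    obtain c w where w: "w \<in> W" "w \<notin> U" "act h w - scale c w \<in> U"
      using eigenvector_modulo[OF invariant_fin_dim[OF WL] sU sW UW act_linear[OF hc]]
        invariantD(3)[OF WL h] by blast
    define X where "X = {w \<in> W. act h w - scale c w \<in> U}"
    have "invariant K X"
      unfolding invariant_def
    proof (intro conjI ballI)
      show "X \<subseteq> V" using invariantD(2)[OF WL] by (auto simp: X_def)
      show "subspace X"
      proof (rule subspaceI)
        show "0 \<in> X"
          using subspace_0[OF sW] subspace_0[OF sU] act_scale[OF hc, of 0 0] by (simp add: X_def)
        fix x y assume "x \<in> X" "y \<in> X"
        then have "x + y \<in> W" "(act h x - scale c x) + (act h y - scale c y) \<in> U"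
          by (auto simp: X_def intro: subspace_add sU sW)
        then show "x + y \<in> X" by (simp add: X_def act_add[OF hc] scale_right_distrib algebra_simps)
      next
        fix a x assume "x \<in> X"
        then have "scale a x \<in> W" "scale a (act h x - scale c x) \<in> U"
          by (auto simp: X_def intro: subspace_scale sU sW)
        then show "scale a x \<in> X"
          by (simp add: X_def act_scale[OF hc] scale_right_diff_distrib scale_left_commute mult.commute)
      qed
      fix g x assume g: "g \<in> K" and x: "x \<in> X"
      have gc: "g \<in> carrier G" using g K by blast
      have "act g (act h x - scale c x) \<in> U" using invariantD(3)[OF UK g] x by (simp add: X_def)
      then have "act h (act g x) - scale c (act g x) \<in> U"
        using commuting_actions[OF gc hc comm[OF g h]] by (simp add: act_diff act_scale gc)
      then show "act g x \<in> X" using invariantD(3)[OF WK g] x by (simp add: X_def)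
    qed
    moreover have "U \<subset> X"
    proof
      show "U \<subseteq> X"
        using UW invariantD(3)[OF UL h] by (auto simp: X_def intro!: subspace_diff subspace_scale sU)
      show "U \<noteq> X" using w by (auto simp: X_def)
    qed
    ultimately have "X = W" using irred by (simp add: X_def)
    then show ?thesis by (auto simp: X_def)
  qed
  have "trivial_on h U W" if "h \<in> derived G L" for h
  proof (rule derived_trivial_on[OF L order_refl UL WL _ that])
    fix a b w assume a: "a \<in> L" and b: "b \<in> L" and w: "w \<in> W"
    note ac = subgroup.mem_carrier[OF L a] and bc = subgroup.mem_carrier[OF L b]
    obtain c d where c: "act a w - scale c w \<in> U" and d: "act b w - scale d w \<in> U"
      using scalar[OF a] scalar[OF b] w by blast
    have "act a (act b w - scale d w) + scale d (act a w - scale c w)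
        - (act b (act a w - scale c w) + scale c (act b w - scale d w)) \<in> U"
      by (rule subspace_diff[OF sU subspace_add[OF sU invariantD(3)[OF UL a d] subspace_scale[OF sU c]]
            subspace_add[OF sU invariantD(3)[OF UL b c] subspace_scale[OF sU d]]])
    then show "act a (act b w) - act b (act a w) \<in> U"
      by (simp add: act_diff act_scale ac bc scale_right_diff_distrib scale_left_commute algebra_simps)
  qed
  then have "\<forall>h\<in>(derived G ^^ Suc 0) L. trivial_on h U W" by simp
  then show ?thesis unfolding solvable_on_def by blast
qed

text \<open>
  Induction on \<open>dim W - dim U\<close>. If an invariant \<open>X\<close> lies strictly between \<open>U\<close> and \<open>W\<close>, then every
  \<open>H i\<close> is non-solvable on one of the two quotients, and the bounds for both add up.

  Otherwise fix \<open>i\<close>, put \<open>J = I - {i}\<close> and let \<open>E\<close> be minimal above \<open>U\<close> among the subspaces invariant under all \<open>H j\<close> with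
  \<open>j \<in> J\<close>. If \<open>H i\<close> preserved \<open>E\<close>, irreducibility would give \<open>E = W\<close> and Schur's lemma would
  make \<open>H i\<close> solvable. So some translate \<open>F\<close> of \<open>E\<close> under \<open>H i\<close> differs from \<open>E\<close>. It is invariant under the same
  groups, whence \<open>E \<inter> F = U\<close> by minimality and \<open>dim W - dim U \<ge> 2 * (dim E - dim U)\<close>.

  The induction hypothesis applies to \<open>E\<close> over \<open>U\<close>: if a derived group of \<open>H j\<close> acted trivially there,
  the vectors of \<open>W\<close> that it fixes modulo \<open>U\<close> would form a subspace invariant under all groups
  (under \<open>H j\<close> itself because the derived group is normal in it), which would be all of \<open>W\<close>.
\<close>

theorem card_commuting_nonsolvable_le_dim:
  assumes "finite I" and H: "\<And>i. i \<in> I \<Longrightarrow> subgroup (H i) G"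
    and comm: "\<And>i j g h. i \<in> I \<Longrightarrow> j \<in> I \<Longrightarrow> i \<noteq> j \<Longrightarrow> g \<in> H i \<Longrightarrow> h \<in> H j \<Longrightarrow> g \<otimes> h = h \<otimes> g"
    and U: "invariant (\<Union>(H ` I)) U" and W: "invariant (\<Union>(H ` I)) W" and UW: "U \<subseteq> W"
    and ns: "\<And>i. i \<in> I \<Longrightarrow> \<not> solvable_on (H i) U W"
  shows "2 * card I + dim U \<le> dim W"
  using assms
proof (induction "dim W - dim U" arbitrary: I U W rule: less_induct)
  case less
  note H = less.prems(2) and comm = less.prems(3) and U = less.prems(4) and W = less.prems(5)
    and UW = less.prems(6) and ns = less.prems(7)
  note fW = invariant_fin_dim[OF W] and sU = invariantD(1)[OF U] and sW = invariantD(1)[OF W]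
  have inv_sub: "invariant (\<Union>(H ` J)) X" if "invariant (\<Union>(H ` I)) X" "J \<subseteq> I" for J X
    using that by (auto simp: invariant_def)
  have inv_i: "invariant (H i) X" if "invariant (\<Union>(H ` I)) X" "i \<in> I" for i X
    using that by (auto simp: invariant_def)
  have Hc: "g \<in> carrier G" if "i \<in> I" "g \<in> H i" for i g
    by (rule subgroup.mem_carrier[OF H[OF that(1)] that(2)])
  show ?case
  proof (cases "I = {}")
    case True
    then show ?thesis using dim_mono_fin_dim[OF fW UW] by simp
  next
    case False
    then obtain i where i: "i \<in> I" by blast
    have "U \<noteq> W"
    proof
      assume "U = W"
      then have "\<forall>h\<in>(derived G ^^ 0) (H i). trivial_on h U W"
        using invariantD(3)[OF inv_i[OF W i]] by (auto simp: trivial_on_def intro: subspace_diff sW)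
      then show False using ns[OF i] unfolding solvable_on_def by blast
    qed
    then have UW': "U \<subset> W" using UW by blast
    show ?thesis
    proof (cases "\<exists>X. invariant (\<Union>(H ` I)) X \<and> U \<subset> X \<and> X \<subset> W")
      case True
      then obtain X where X: "invariant (\<Union>(H ` I)) X" "U \<subset> X" "X \<subset> W" by blast
      note sX = invariantD(1)[OF X(1)]
      have d: "dim U < dim X" "dim X < dim W"
        using dim_less_fin_dim[OF invariant_fin_dim[OF X(1)] sU sX X(2)]
          dim_less_fin_dim[OF fW sX sW X(3)] by auto
      define I1 where "I1 = {i \<in> I. \<not> solvable_on (H i) U X}"
      define I2 where "I2 = {i \<in> I. \<not> solvable_on (H i) X W}"
      have sub: "I1 \<subseteq> I" "I2 \<subseteq> I" by (auto simp: I1_def I2_def)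
      have "I \<subseteq> I1 \<union> I2"
        using solvable_on_extension[OF H inv_i[OF U] inv_i[OF X(1)] inv_i[OF W]] ns
        by (auto simp: I1_def I2_def)
      then have "card I \<le> card I1 + card I2"
        using card_mono[of "I1 \<union> I2" I] card_Un_le[of I1 I2] sub less.prems(1)
        by (meson finite_UnI finite_subset le_trans)
      moreover have "2 * card I1 + dim U \<le> dim X"
      proof (rule less.hyps)
        show "dim X - dim U < dim W - dim U" using d by simp
        show "finite I1" using sub less.prems(1) by (meson finite_subset)
        show "U \<subseteq> X" using X by blast
        show "g \<otimes> h = h \<otimes> g" if "i \<in> I1" "j \<in> I1" "i \<noteq> j" "g \<in> H i" "h \<in> H j" for i j g h
          using comm[of i j g h] that sub by blast
      qed (use H sub inv_sub[OF U] inv_sub[OF X(1)] in \<open>auto simp: I1_def\<close>)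
      moreover have "2 * card I2 + dim X \<le> dim W"
      proof (rule less.hyps)
        show "dim W - dim X < dim W - dim U" using d by simp
        show "finite I2" using sub less.prems(1) by (meson finite_subset)
        show "X \<subseteq> W" using X by blast
        show "g \<otimes> h = h \<otimes> g" if "i \<in> I2" "j \<in> I2" "i \<noteq> j" "g \<in> H i" "h \<in> H j" for i j g h
          using comm[of i j g h] that sub by blast
      qed (use H sub inv_sub[OF W] inv_sub[OF X(1)] in \<open>auto simp: I2_def\<close>)
      ultimately show ?thesis by simp
    next
      case False
      then have irred: "X = W" if "invariant (\<Union>(H ` I)) X" "U \<subset> X" "X \<subseteq> W" for X
        using that by blast
      define J where "J = I - {i}"
      define K where "K = \<Union>(H ` J)"
      have J: "J \<subseteq> I" "finite J" "i \<notin> J" "I = insert i J" "card I = Suc (card J)"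
        using i less.prems(1) card_Suc_Diff1[OF less.prems(1) i] by (auto simp: J_def)
      have Kc: "K \<subseteq> carrier G" using Hc J(1) by (auto simp: K_def)
      have Ki: "g \<otimes> h = h \<otimes> g" if "g \<in> K" "h \<in> H i" for g h
        using comm[of _ i g h] that J i by (auto simp: K_def)
      have UK: "invariant K U" and WK: "invariant K W"
        using inv_sub[OF U J(1)] inv_sub[OF W J(1)] by (auto simp: K_def)
      obtain E where E: "invariant K E" "U \<subset> E" "E \<subseteq> W"
        and least: "\<And>X. invariant K X \<Longrightarrow> U \<subset> X \<Longrightarrow> X \<subseteq> W \<Longrightarrow> dim E \<le> dim X"
        using ex_has_least_nat[of "\<lambda>E. invariant K E \<and> U \<subset> E \<and> E \<subseteq> W" W dim] UW' WK by blast
      note sE = invariantD(1)[OF E(1)] and fE = invariant_fin_dim[OF E(1)]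
      obtain g where g: "g \<in> H i" "\<not> act g ` E \<subseteq> E"
      proof (cases "\<forall>g\<in>H i. act g ` E \<subseteq> E")
        case False
        then show thesis using that by blast
      next
        case True
        then have "invariant (\<Union>(H ` I)) E"
          using E(1) unfolding J(4) by (auto simp: invariant_def K_def)
        then have EW: "E = W" using irred E by blast
        have "solvable_on (H i) U W"
        proof (rule solvable_on_of_commuting_irreducible[OF H[OF i] Kc Ki inv_i[OF U i] UK inv_i[OF W i] WK UW'])
          fix X assume X: "invariant K X" "U \<subset> X" "X \<subseteq> W"
          then show "X = W"
            using subspace_eqI_dim[OF fW invariantD(1)[OF X(1)] sW X(3)] least EW by blast
        qed
        then show thesis using ns[OF i] by blast
      qed
      define F where "F = act g ` E"
      have gc: "g \<in> carrier G" using Hc[OF i g(1)] .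
      have gi: "inv g \<in> H i" using subgroup.m_inv_closed[OF H[OF i] g(1)] .
      have EV: "E \<subseteq> V" using invariantD(2)[OF E(1)] .
      have F: "invariant K F"
        unfolding invariant_def
      proof (intro conjI ballI)
        show "subspace F" unfolding F_def by (rule image_subspace[OF gc sE])
        show "F \<subseteq> V" using EV act_V[OF gc] by (auto simp: F_def)
        fix h x assume h: "h \<in> K" and "x \<in> F"
        then obtain y where y: "y \<in> E" "x = act g y" by (auto simp: F_def)
        then have "act h x = act g (act h y)"
          using commuting_actions[OF _ gc Ki[OF h g(1)]] h Kc by auto
        then show "act h x \<in> F" using y invariantD(3)[OF E(1) h] by (auto simp: F_def)
      qed
      have FW: "F \<subseteq> W" using E(3) invariantD(3)[OF inv_i[OF W i] g(1)] by (auto simp: F_def)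
      have UF: "U \<subseteq> F"
      proof
        fix u assume u: "u \<in> U"
        then have "act (inv g) u \<in> E" using invariantD(3)[OF inv_i[OF U i] gi] E(2) by blast
        moreover have "u = act g (act (inv g) u)"
          using act_inv(1)[OF gc, of u] u invariantD(2)[OF U] by auto
        ultimately show "u \<in> F" unfolding F_def by blast
      qed
      have "dim E \<le> dim (act (inv g) ` F)"
      proof -
        have "act (inv g) ` F = E"
          unfolding F_def image_image using act_inv(2)[OF gc] EV by (force simp: subset_iff)
        then show ?thesis by simp
      qed
      then have EF: "dim E \<le> dim F"
        using dim_image_act[OF inv_closed[OF gc] invariantD(2)[OF F]] by simp
      have FE: "dim F \<le> dim E" unfolding F_def by (rule dim_image_act[OF gc EV])
      have int: "E \<inter> F = U"
      proof (rule ccontr)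
        assume ne: "E \<inter> F \<noteq> U"
        have iEF: "invariant K (E \<inter> F)"
          using E(1) F by (auto simp: invariant_def intro: subspace_inter)
        have "E \<inter> F \<subset> E"
        proof -
          have "E \<noteq> E \<inter> F"
          proof
            assume "E = E \<inter> F"
            then have "E = F"
              using subspace_eqI_dim[OF invariant_fin_dim[OF F] sE invariantD(1)[OF F] _ FE] by blast
            then show False using g(2) by (simp add: F_def)
          qed
          then show ?thesis by blast
        qed
        then have "dim (E \<inter> F) < dim E"
          by (rule dim_less_fin_dim[OF fE invariantD(1)[OF iEF] sE])
        then show False using least[OF iEF] ne E UF by fastforce
      qed
      have two: "dim E + dim E \<le> dim W + dim U"
        using dim_add_dim_le_of_Int[OF fW sE invariantD(1)[OF F] sU E(3) FW int] EF by simp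
      have UE: "dim U < dim E" by (rule dim_less_fin_dim[OF fE sU sE E(2)])
      have "2 * card J + dim U \<le> dim E"
      proof (rule less.hyps)
        show "dim E - dim U < dim W - dim U" using two UE by simp
        show "g \<otimes> h = h \<otimes> g" if "i \<in> J" "j \<in> J" "i \<noteq> j" "g \<in> H i" "h \<in> H j" for i j g h
          using comm[of i j g h] that J(1) by blast
        fix j assume j: "j \<in> J"
        then have jI: "j \<in> I" using J(1) by blast
        show "\<not> solvable_on (H j) U E"
        proof
          assume "solvable_on (H j) U E"
          then obtain k where k: "\<And>h. h \<in> (derived G ^^ k) (H j) \<Longrightarrow> trivial_on h U E"
            by (auto simp: solvable_on_def)
          define D where "D = (derived G ^^ k) (H j)"
          have Dj: "D \<subseteq> H j" using derived_power_antimono[OF H[OF jI], of 0 k] by (simp add: D_def)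
          define X where "X = {w \<in> W. \<forall>h\<in>D. act h w - w \<in> U}"
          have "invariant (\<Union>(H ` I)) X"
            unfolding invariant_def
          proof (intro conjI ballI)
            show "X \<subseteq> V" using invariantD(2)[OF W] by (auto simp: X_def)
            show "subspace X"
            proof (rule subspaceI)
              show "0 \<in> X"
                using subspace_0[OF sW] subspace_0[OF sU] act_scale[of _ 0 0] Hc[OF jI] Dj
                by (auto simp: X_def)
              fix x y assume x: "x \<in> X" and y: "y \<in> X"
              have "act h (x + y) - (x + y) \<in> U" if h: "h \<in> D" for h
              proof -
                have "(act h x - x) + (act h y - y) \<in> U"
                  using x y h by (auto simp: X_def intro: subspace_add sU)
                then show ?thesis using act_add[of h x y] Hc[OF jI, of h] Dj h by (auto simp: algebra_simps)
              qed
              then show "x + y \<in> X" using x y by (auto simp: X_def intro: subspace_add sW)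
            next
              fix a x assume x: "x \<in> X"
              have "act h (scale a x) - scale a x \<in> U" if h: "h \<in> D" for h
              proof -
                have "scale a (act h x - x) \<in> U"
                  using x h by (auto simp: X_def intro: subspace_scale sU)
                then show ?thesis using act_scale[of h a x] Hc[OF jI, of h] Dj h
                  by (auto simp: scale_right_diff_distrib)
              qed
              then show "scale a x \<in> X" using x by (auto simp: X_def intro: subspace_scale sW)
            qed
            fix f x assume f: "f \<in> \<Union>(H ` I)" and x: "x \<in> X"
            then obtain l where l: "l \<in> I" "f \<in> H l" by blast
            have fc: "f \<in> carrier G" using Hc l by blast
            have "act h (act f x) - act f x \<in> U" if h: "h \<in> D" for h
            proof -
              have hc: "h \<in> carrier G" using h Dj Hc[OF jI] by blast
              define h' where "h' = inv f \<otimes> h \<otimes> f"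
              have "h' \<in> D"
              proof (cases "l = j")
                case True
                interpret N: normal D "G\<lparr>carrier := H j\<rparr>"
                  unfolding D_def by (rule derived_power_normal[OF H[OF jI]])
                show ?thesis
                  using N.inv_op_closed1[of f h] h l True m_inv_consistent[OF H[OF jI], of f]
                  by (simp add: h'_def)
              next
                case False
                have "f \<otimes> h = h \<otimes> f" using comm[OF l(1) jI False l(2)] h Dj by blast
                then have "h' = h" using fc hc by (metis h'_def inv_closed l_inv l_one m_assoc)
                then show ?thesis using h by simp
              qed
              then have "act f (act h' x - x) \<in> U"
                using x invariantD(3)[OF U f] by (auto simp: X_def)
              moreover have "act f (act h' x) = act h (act f x)"
              proof -
                have "f \<otimes> h' = h \<otimes> f" using fc hc by (simp add: h'_def m_assoc[symmetric])
                moreover have "h' \<in> carrier G" using fc hc by (simp add: h'_def)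
                ultimately show ?thesis using fc hc act_mult by metis
              qed
              ultimately show ?thesis by (simp add: act_diff fc)
            qed
            then show "act f x \<in> X" using x invariantD(3)[OF W f] by (simp add: X_def)
          qed
          moreover have "E \<subseteq> X" using E(3) k by (auto simp: X_def D_def trivial_on_def)
          ultimately have "X = W" using irred[of X] E(2) by (auto simp: X_def)
          then have "\<forall>h\<in>(derived G ^^ k) (H j). trivial_on h U W"
            by (auto simp: X_def D_def trivial_on_def)
          then show False using ns[OF jI] unfolding solvable_on_def by blast
        qed
      qed (use J H inv_sub[OF U] E in \<open>auto simp: K_def\<close>)
      \<comment> \<open>If \<open>J\<close> is empty, \<open>dim E > dim U\<close> is enough; otherwise doubling \<open>2 * card J\<close> gains at least \<open>2\<close>.\<close>
      moreover have "card J = 0 \<or> 1 \<le> card J" by linarith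
      ultimately show ?thesis using two UE J(5) by linarith
    qed
  qed
qed

end

section \<open>Degree of a linear representation\<close>

definition coord_scale :: "complex \<Rightarrow> (nat \<Rightarrow> complex) \<Rightarrow> nat \<Rightarrow> complex"
  where "coord_scale c f = (\<lambda>i. c * f i)"

text \<open>
  Complex \<open>d\<close>-space, realised inside one type for all \<open>d\<close>.
\<close>

definition coord_space :: "nat \<Rightarrow> (nat \<Rightarrow> complex) set"
  where "coord_space d = {f. \<forall>i\<ge>d. f i = 0}"

definition mat_act :: "nat \<Rightarrow> complex mat \<Rightarrow> (nat \<Rightarrow> complex) \<Rightarrow> nat \<Rightarrow> complex"
  where "mat_act d A f = (\<lambda>i. if i < d then \<Sum>j<d. A $$ (i, j) * f j else 0)"

interpretation coord: complex_space coord_scale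
  by unfold_locales (auto simp: coord_scale_def fun_eq_iff algebra_simps)

lemma coord_space_span:
  "coord_space d \<subseteq> coord.span ((\<lambda>i k. of_bool (k = i)) ` {..<d})"
proof
  fix f assume f: "f \<in> coord_space d"
  have sum_app: "(\<Sum>i\<in>S. g i) k = (\<Sum>i\<in>S. g i k)" for S :: "nat set" and g :: "nat \<Rightarrow> nat \<Rightarrow> complex" and k
    by (induction S rule: infinite_finite_induct) auto
  have "f = (\<Sum>i<d. coord_scale (f i) (\<lambda>k. of_bool (k = i)))"
  proof
    fix k
    have "(\<Sum>i<d. coord_scale (f i) (\<lambda>k. of_bool (k = i))) k = (\<Sum>i<d. if i = k then f k else 0)"
      by (auto simp: sum_app coord_scale_def intro!: sum.cong)
    then show "f k = (\<Sum>i<d. coord_scale (f i) (\<lambda>k. of_bool (k = i))) k"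
      using f by (auto simp: coord_space_def)
  qed
  moreover have "\<dots> \<in> coord.span ((\<lambda>i k. of_bool (k = i)) ` {..<d})"
    by (intro coord.span_sum coord.span_scale coord.span_base) auto
  ultimately show "f \<in> coord.span ((\<lambda>i k. of_bool (k = i)) ` {..<d})" by simp
qed

lemma mat_act_mult:
  assumes "A \<in> carrier_mat d d" "B \<in> carrier_mat d d"
  shows "mat_act d (A * B) f = mat_act d A (mat_act d B f)"
proof
  fix i
  have "(\<Sum>j<d. (\<Sum>k<d. A $$ (i, k) * B $$ (k, j)) * f j)
      = (\<Sum>k<d. A $$ (i, k) * (\<Sum>j<d. B $$ (k, j) * f j))"
    by (simp add: sum_distrib_left sum_distrib_right mult.assoc) (rule sum.swap)
  then show "mat_act d (A * B) f i = mat_act d A (mat_act d B f) i"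
    using assms by (auto simp: mat_act_def scalar_prod_def atLeast0LessThan intro!: sum.cong)
qed

text \<open>
  The last hypothesis says that the image of each \<open>H i\<close> in the matrix group is not solvable.
\<close>

theorem card_commuting_nonsolvable_le_degree:
  assumes "group G" and hom: "\<phi> \<in> hom G (GL_complex d)" and "finite I"
    and H: "\<And>i. i \<in> I \<Longrightarrow> subgroup (H i) G"
    and comm: "\<And>i j g h. i \<in> I \<Longrightarrow> j \<in> I \<Longrightarrow> i \<noteq> j \<Longrightarrow> g \<in> H i \<Longrightarrow> h \<in> H j
        \<Longrightarrow> g \<otimes>\<^bsub>G\<^esub> h = h \<otimes>\<^bsub>G\<^esub> g"
    and ns: "\<And>i k. i \<in> I \<Longrightarrow> \<exists>h\<in>(derived G ^^ k) (H i). \<phi> h \<noteq> \<one>\<^bsub>GL_complex d\<^esub>"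
  shows "2 * card I \<le> d"
proof -
  interpret group G by fact
  let ?V = "coord_space d"
  have one: "\<one>\<^bsub>GL_complex d\<^esub> = 1\<^sub>m d"
    by (simp add: GL_complex_def units_of_def ring_mat_def)
  have car: "\<phi> g \<in> carrier_mat d d" if "g \<in> carrier G" for g
    using hom_in_carrier[OF hom that]
    by (auto simp: GL_complex_def units_of_def Units_def ring_mat_def)
  have mult: "\<phi> (g \<otimes>\<^bsub>G\<^esub> h) = \<phi> g * \<phi> h" if "g \<in> carrier G" "h \<in> carrier G" for g h
    using hom_mult[OF hom that] by (simp add: GL_complex_def units_of_def ring_mat_def)
  have \<phi>1: "\<phi> \<one>\<^bsub>G\<^esub> = 1\<^sub>m d"
    using hom_one[OF hom _ group_GL_complex] one by simp
  have subV: "coord.subspace ?V"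
    by (rule coord.subspaceI) (auto simp: coord_space_def coord_scale_def)
  have finV: "coord.fin_dim ?V"
    using coord_space_span unfolding coord.fin_dim_def by blast
  interpret linear_group_action coord_scale G "\<lambda>g. mat_act d (\<phi> g)" ?V
  proof (intro linear_group_action.intro linear_group_action_axioms.intro)
    show "complex_space coord_scale" by (rule coord.complex_space_axioms)
    show "group G" by fact
  next
    fix g h v assume "g \<in> carrier G" "h \<in> carrier G"
    then show "mat_act d (\<phi> (g \<otimes>\<^bsub>G\<^esub> h)) v = mat_act d (\<phi> g) (mat_act d (\<phi> h) v)"
      by (simp add: mult car mat_act_mult)
  next
    fix g assume "g \<in> carrier G"
    show "Vector_Spaces.linear coord_scale coord_scale (mat_act d (\<phi> g))"
      unfolding Vector_Spaces.linear_iff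
      by (intro conjI coord.vector_space_axioms)
        (auto simp: mat_act_def coord_scale_def fun_eq_iff distrib_left sum.distrib sum_distrib_left
          mult.left_commute)
  next
    fix v assume v: "v \<in> ?V"
    have "mat_act d (1\<^sub>m d) v i = (if i < d then v i else 0)" for i
    proof -
      have "(\<Sum>j<d. 1\<^sub>m d $$ (i, j) * v j) = (\<Sum>j<d. if j = i then v i else 0)" if "i < d"
        using that by (intro sum.cong) auto
      then show ?thesis by (simp add: mat_act_def)
    qed
    then show "mat_act d (\<phi> \<one>\<^bsub>G\<^esub>) v = v"
      using v by (auto simp: \<phi>1 coord_space_def fun_eq_iff)
  qed (use subV finV in \<open>simp_all add: mat_act_def coord_space_def\<close>)
  have "2 * card I + coord.dim {0} \<le> coord.dim ?V"
  proof (rule card_commuting_nonsolvable_le_dim[OF \<open>finite I\<close> H comm])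
    have "mat_act d A 0 = 0" for A by (simp add: mat_act_def fun_eq_iff)
    then show "invariant (\<Union> (H ` I)) {0}"
      unfolding invariant_def by (auto simp: coord_space_def coord.subspace_single_0)
    show "invariant (\<Union> (H ` I)) ?V"
      unfolding invariant_def using subV by (auto simp: mat_act_def coord_space_def)
    show "{0} \<subseteq> ?V" by (simp add: coord_space_def)
    fix i assume i: "i \<in> I"
    show "\<not> solvable_on (H i) {0} ?V"
    proof
      assume "solvable_on (H i) {0} ?V"
      then obtain k where k: "\<And>h v. h \<in> (derived G ^^ k) (H i) \<Longrightarrow> v \<in> ?V \<Longrightarrow> mat_act d (\<phi> h) v = v"
        unfolding solvable_on_def trivial_on_def by auto
      obtain h where h: "h \<in> (derived G ^^ k) (H i)" "\<phi> h \<noteq> 1\<^sub>m d" using ns[OF i] one by auto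
      have "h \<in> carrier G"
        using exp_of_derived_in_carrier[OF subgroup.subset[OF H[OF i]]] h(1) by blast
      then have c: "\<phi> h \<in> carrier_mat d d" by (rule car)
      have "\<phi> h $$ (a, b) = 1\<^sub>m d $$ (a, b)" if ab: "a < d" "b < d" for a b
      proof -
        let ?e = "\<lambda>k. of_bool (k = b) :: complex"
        have "mat_act d (\<phi> h) ?e a = ?e a" using k[OF h(1), of ?e] ab by (simp add: coord_space_def)
        then show ?thesis using ab by (simp add: mat_act_def)
      qed
      then have "\<phi> h = 1\<^sub>m d" using c by (intro eq_matI) auto
      then show False using h(2) by blast
    qed
  qed (use \<open>finite I\<close> in auto)
  moreover have "coord.dim ?V \<le> d"
    using coord.dim_le_card[OF coord_space_span, of d] card_image_le[of "{..<d}" "\<lambda>i k. of_bool (k = i) :: complex"]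
    by simp
  ultimately show ?thesis by simp
qed

section \<open>A covering of the plane without two points\<close>

text \<open>
  The plane without \<open>0\<close> and \<open>1\<close> is the union of two simply connected open sets: the plane cut along the
  vertical rays going down from the two points, and the plane cut along the rays going up. Their
  intersection consists of the three strips \<open>Re z < 0\<close>, \<open>0 < Re z < 1\<close> and \<open>Re z > 1\<close>. Gluing a product
  with fibre \<^typ>\<open>nat\<close> over the first set to one over the second by \<open>\<alpha>\<close>, the identity and \<open>\<beta>\<close> on the three
  strips gives a covering whose monodromy around \<open>0\<close> is \<open>\<alpha>\<close> and whose monodromy around \<open>1\<close> is inverse
  to \<open>\<beta>\<close>. What is needed of this covering are its sections along maps \<open>h\<close> into the punctured plane, and these are
  described directly in the two charts.
\<close>

definition upper_cut :: "complex set"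
  where "upper_cut = {z. Im z > 0 \<or> Re z \<noteq> 0 \<and> Re z \<noteq> 1}"

definition lower_cut :: "complex set"
  where "lower_cut = {z. Im z < 0 \<or> Re z \<noteq> 0 \<and> Re z \<noteq> 1}"

definition glue :: "(nat \<Rightarrow> nat) \<Rightarrow> (nat \<Rightarrow> nat) \<Rightarrow> complex \<Rightarrow> nat \<Rightarrow> nat"
  where "glue \<alpha> \<beta> z = (if Re z < 0 then \<alpha> else if Re z > 1 then \<beta> else id)"

lemma cut_cover: "upper_cut \<union> lower_cut = - {0, 1}"
  by (auto simp: upper_cut_def lower_cut_def complex_eq_iff)

lemma open_cuts: "open upper_cut" "open lower_cut"
proof -
  have *: "{z. Im z > 0 \<or> Re z \<noteq> 0 \<and> Re z \<noteq> 1} = {z. 0 < Im z} \<union> ({z. Re z \<noteq> 0} \<inter> {z. Re z \<noteq> 1})"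
    "{z. Im z < 0 \<or> Re z \<noteq> 0 \<and> Re z \<noteq> 1} = {z. Im z < 0} \<union> ({z. Re z \<noteq> 0} \<inter> {z. Re z \<noteq> 1})"
    by auto
  show "open upper_cut" "open lower_cut"
    unfolding upper_cut_def lower_cut_def *
    by (intro open_Un open_Int open_Collect_less open_Collect_neq continuous_intros)+
qed

lemma cuts_Int: "z \<in> upper_cut \<Longrightarrow> z \<in> lower_cut \<Longrightarrow> Re z \<noteq> 0 \<and> Re z \<noteq> 1"
  by (auto simp: upper_cut_def lower_cut_def)

lemma continuous_on_discrete_iff:
  fixes s :: "'a::topological_space \<Rightarrow> nat"
  shows "continuous_on T s \<longleftrightarrow> (\<forall>t\<in>T. \<exists>N. open N \<and> t \<in> N \<and> (\<forall>x\<in>T \<inter> N. s x = s t))"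
proof
  assume s: "continuous_on T s"
  show "\<forall>t\<in>T. \<exists>N. open N \<and> t \<in> N \<and> (\<forall>x\<in>T \<inter> N. s x = s t)"
  proof
    fix t assume "t \<in> T"
    then obtain N where "open N" "t \<in> N" "\<forall>x\<in>T. x \<in> N \<longrightarrow> s x \<in> {s t}"
      using s open_discrete[of "{s t}"] unfolding continuous_on_topological by blast
    then show "\<exists>N. open N \<and> t \<in> N \<and> (\<forall>x\<in>T \<inter> N. s x = s t)" by blast
  qed
next
  assume s: "\<forall>t\<in>T. \<exists>N. open N \<and> t \<in> N \<and> (\<forall>x\<in>T \<inter> N. s x = s t)"
  show "continuous_on T s"
    unfolding continuous_on_topological
  proof (intro ballI allI impI)
    fix t B assume t: "t \<in> T" "s t \<in> B"
    obtain N where N: "open N" "t \<in> N" "\<forall>x\<in>T \<inter> N. s x = s t" using s t(1) by blast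
    have "s x \<in> B" if "x \<in> T" "x \<in> N" for x using N(3) t(2) that by simp
    then show "\<exists>A. open A \<and> t \<in> A \<and> (\<forall>x\<in>T. x \<in> A \<longrightarrow> s x \<in> B)" using N(1,2) by blast
  qed
qed

lemma connected_agreement:
  assumes "connected T" "t0 \<in> T" "P t0" "t1 \<in> T"
    and loc: "\<And>t. t \<in> T \<Longrightarrow> \<exists>N. open N \<and> t \<in> N \<and> (\<forall>x\<in>T \<inter> N. P x = P t)"
  shows "P t1"
proof (rule connected_induction_simple[where P = P, OF assms(1,2,4,3)])
  fix t assume t: "t \<in> T"
  from loc[OF t] obtain N where N: "open N" "t \<in> N" "\<forall>x\<in>T \<inter> N. P x = P t"
    by (elim exE conjE) (rule that)
  have *: "P y" if "x \<in> T \<inter> N" "y \<in> T \<inter> N" "P x" for x y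
    using bspec[OF N(3) that(1)] bspec[OF N(3) that(2)] that(3) by (simp only:)
  show "\<exists>S. openin (top_of_set T) S \<and> t \<in> S \<and> (\<forall>x\<in>S. \<forall>y\<in>S. P x \<longrightarrow> P y)"
    by (intro exI[of _ "T \<inter> N"] conjI openin_open_Int IntI t N(1,2) ballI impI) (rule *)
qed

lemma continuous_on_discrete_connected:
  fixes s :: "'a::topological_space \<Rightarrow> nat"
  assumes "continuous_on T s" "connected T" "x \<in> T" "y \<in> T"
  shows "s x = s y"
proof -
  have "s y = s x"
  proof (rule connected_agreement[of T x "\<lambda>t. s t = s x" y])
    fix t assume "t \<in> T"
    then obtain N where N: "open N" "t \<in> N" "\<forall>z\<in>T \<inter> N. s z = s t"
      using assms(1) unfolding continuous_on_discrete_iff by blast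
    have "(s z = s x) = (s t = s x)" if "z \<in> T \<inter> N" for z using bspec[OF N(3) that] by simp
    then show "\<exists>N. open N \<and> t \<in> N \<and> (\<forall>z\<in>T \<inter> N. (s z = s x) = (s t = s x))"
      using N(1,2) by blast
  qed (use assms(2-4) in auto)
  then show ?thesis by simp
qed

locale fibre_permutations =
  fixes \<alpha> \<beta> :: "nat \<Rightarrow> nat"
  assumes bij_\<alpha>: "bij \<alpha>" and bij_\<beta>: "bij \<beta>"
begin

lemma bij_glue: "bij (glue \<alpha> \<beta> z)"
  using bij_\<alpha> bij_\<beta> by (simp add: glue_def)

lemma glue_locally_constant:
  assumes h: "continuous_on T h" "t \<in> T" "h t \<in> upper_cut" "h t \<in> lower_cut"
  obtains N where "open N" "t \<in> N" "\<And>x. x \<in> T \<inter> N \<Longrightarrow> glue \<alpha> \<beta> (h x) = glue \<alpha> \<beta> (h t)"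
proof -
  define B where "B = (if Re (h t) < 0 then {z. Re z < 0} else if Re (h t) > 1 then {z. Re z > 1}
    else {z. 0 < Re z} \<inter> {z. Re z < 1})"
  have "open B" unfolding B_def
    by (auto intro!: open_Int open_Collect_less continuous_intros)
  moreover have "h t \<in> B" using cuts_Int[OF h(3,4)] by (auto simp: B_def)
  ultimately obtain A where A: "open A" "t \<in> A" "\<forall>y\<in>T. y \<in> A \<longrightarrow> h y \<in> B"
    using h(1,2) unfolding continuous_on_topological by meson
  have "glue \<alpha> \<beta> z = glue \<alpha> \<beta> (h t)" if "z \<in> B" for z
    using that by (simp add: glue_def B_def split: if_splits)
  then show thesis using that[OF A(1,2)] A(3) by blast
qed

text \<open>
  A section is recorded by its value in the upper chart wherever \<open>h\<close> lies in the upper cut, and by its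
  value in the lower chart elsewhere. The function below is the value in the lower chart.
\<close>

definition lower_value :: "('t \<Rightarrow> complex) \<Rightarrow> ('t \<Rightarrow> nat) \<Rightarrow> 't \<Rightarrow> nat"
  where "lower_value h s t = (if h t \<in> upper_cut then glue \<alpha> \<beta> (h t) (s t) else s t)"

text \<open>
  As \<^typ>\<open>nat\<close> is discrete, continuity means local constancy.
\<close>

definition is_section :: "('t::topological_space \<Rightarrow> complex) \<Rightarrow> 't set \<Rightarrow> ('t \<Rightarrow> nat) \<Rightarrow> bool"
  where "is_section h T s \<longleftrightarrow>
    continuous_on {t \<in> T. h t \<in> upper_cut} s \<and> continuous_on {t \<in> T. h t \<in> lower_cut} (lower_value h s)"

lemma is_section_pullback:
  assumes "is_section h T s" "continuous_on S j" "j ` S \<subseteq> T"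
  shows "is_section (\<lambda>x. h (j x)) S (\<lambda>x. s (j x))"
proof -
  have j: "continuous_on {x \<in> S. h (j x) \<in> C} j" for C
    using assms(2) by (rule continuous_on_subset) blast
  have "continuous_on {x \<in> S. h (j x) \<in> upper_cut} (\<lambda>x. s (j x))"
    by (rule continuous_on_compose2[of "{t \<in> T. h t \<in> upper_cut}" s, OF _ j])
      (use assms(1,3) is_section_def in blast)+
  moreover have "continuous_on {x \<in> S. h (j x) \<in> lower_cut} (\<lambda>x. lower_value h s (j x))"
    by (rule continuous_on_compose2[of "{t \<in> T. h t \<in> lower_cut}" "lower_value h s", OF _ j])
      (use assms(1,3) is_section_def in blast)+
  moreover have "lower_value (\<lambda>x. h (j x)) (\<lambda>x. s (j x)) = (\<lambda>x. lower_value h s (j x))"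
    by (simp add: lower_value_def fun_eq_iff)
  ultimately show ?thesis unfolding is_section_def by metis
qed

lemma is_section_subset: "is_section h T s \<Longrightarrow> S \<subseteq> T \<Longrightarrow> is_section h S s"
  using is_section_pullback[of h T s S "\<lambda>x. x"] continuous_on_id[of S] by auto

text \<open>
  Whether two sections agree at a point does not depend on the chart, since the gluing maps are
  injective; so agreement is locally constant.
\<close>

lemma section_unique:
  assumes T: "connected T" and h: "continuous_on T h" "h ` T \<subseteq> - {0, 1}"
    and s: "is_section h T s" "is_section h T s'" and t01: "t0 \<in> T" "s t0 = s' t0" "t1 \<in> T"
  shows "s t1 = s' t1"
proof (rule connected_agreement[of T t0 "\<lambda>t. s t = s' t"])
  fix t assume t: "t \<in> T"
  have nbhd: "\<exists>N. open N \<and> t \<in> N \<and> (\<forall>x\<in>T \<inter> N. h x \<in> C \<and> r x = r t \<and> r' x = r' t)"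
    if C: "open C" "h t \<in> C" and r: "continuous_on {t \<in> T. h t \<in> C} r" "continuous_on {t \<in> T. h t \<in> C} r'"
    for C and r r' :: "'a \<Rightarrow> nat"
  proof -
    obtain N1 where N1: "open N1" "t \<in> N1" "\<forall>x\<in>T. x \<in> N1 \<longrightarrow> h x \<in> C"
      using h(1) t C unfolding continuous_on_topological by meson
    obtain N2 where N2: "open N2" "t \<in> N2" "\<forall>x\<in>{t \<in> T. h t \<in> C} \<inter> N2. r x = r t"
      using r(1) t C unfolding continuous_on_discrete_iff by blast
    obtain N3 where N3: "open N3" "t \<in> N3" "\<forall>x\<in>{t \<in> T. h t \<in> C} \<inter> N3. r' x = r' t"
      using r(2) t C unfolding continuous_on_discrete_iff by blast
    show ?thesis using N1 N2 N3 by (intro exI[of _ "N1 \<inter> N2 \<inter> N3"]) auto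
  qed
  have low: "lower_value h s x = lower_value h s' x \<longleftrightarrow> s x = s' x" for x
    using bij_is_inj[OF bij_glue, of "h x"] by (auto simp: lower_value_def inj_eq)
  have "h t \<in> upper_cut \<or> h t \<in> lower_cut" using h(2) t cut_cover by blast
  then show "\<exists>N. open N \<and> t \<in> N \<and> (\<forall>x\<in>T \<inter> N. (s x = s' x) = (s t = s' t))"
  proof
    assume "h t \<in> upper_cut"
    from nbhd[OF open_cuts(1) this, of s s'] s
    obtain N where N: "open N" "t \<in> N" "\<forall>x\<in>T \<inter> N. h x \<in> upper_cut \<and> s x = s t \<and> s' x = s' t"
      unfolding is_section_def by blast
    have "(s x = s' x) = (s t = s' t)" if "x \<in> T \<inter> N" for x using bspec[OF N(3) that] by simp
    then show ?thesis using N(1,2) by blast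
  next
    assume "h t \<in> lower_cut"
    from nbhd[OF open_cuts(2) this, of "lower_value h s" "lower_value h s'"] s
    obtain N where N: "open N" "t \<in> N"
      "\<forall>x\<in>T \<inter> N. h x \<in> lower_cut \<and> lower_value h s x = lower_value h s t \<and> lower_value h s' x = lower_value h s' t"
      unfolding is_section_def by blast
    have "(s x = s' x) = (s t = s' t)" if "x \<in> T \<inter> N" for x
      using bspec[OF N(3) that] by (simp flip: low)
    then show ?thesis using N(1,2) by blast
  qed
qed (rule T t01)+

definition has_sections :: "('t::topological_space \<Rightarrow> complex) \<Rightarrow> 't set \<Rightarrow> bool"
  where "has_sections h T \<longleftrightarrow> (\<forall>t\<in>T. \<forall>c. \<exists>s. is_section h T s \<and> s t = c)"

lemma has_sections_upper:
  assumes h: "continuous_on T h" "h ` T \<subseteq> upper_cut"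
  shows "has_sections h T"
  unfolding has_sections_def
proof (intro ballI allI)
  fix t c assume "t \<in> T"
  have "continuous_on {t \<in> T. h t \<in> lower_cut} (lower_value h (\<lambda>_. c))"
    unfolding continuous_on_discrete_iff
  proof
    fix x assume x: "x \<in> {t \<in> T. h t \<in> lower_cut}"
    then obtain N where N: "open N" "x \<in> N" "\<And>y. y \<in> T \<inter> N \<Longrightarrow> glue \<alpha> \<beta> (h y) = glue \<alpha> \<beta> (h x)"
      using glue_locally_constant[OF h(1), of x] h(2) by blast
    have "lower_value h (\<lambda>_. c) y = lower_value h (\<lambda>_. c) x" if "y \<in> {t \<in> T. h t \<in> lower_cut} \<inter> N" for y
      using N(3)[of y] that x h(2) by (simp add: lower_value_def image_subset_iff)
    then show "\<exists>N. open N \<and> x \<in> N \<and> (\<forall>y\<in>{t \<in> T. h t \<in> lower_cut} \<inter> N.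
        lower_value h (\<lambda>_. c) y = lower_value h (\<lambda>_. c) x)"
      using N(1,2) by blast
  qed
  then show "\<exists>s. is_section h T s \<and> s t = c"
    by (intro exI[of _ "\<lambda>_. c"]) (simp add: is_section_def)
qed

lemma has_sections_lower:
  assumes h: "continuous_on T h" "h ` T \<subseteq> lower_cut"
  shows "has_sections h T"
  unfolding has_sections_def
proof (intro ballI allI)
  fix t c assume t: "t \<in> T"
  let ?e = "lower_value h (\<lambda>_. c) t"
  define s where "s x = (if h x \<in> upper_cut then inv_into UNIV (glue \<alpha> \<beta> (h x)) ?e else ?e)" for x
  have low: "lower_value h s x = ?e" for x
    using bij_is_surj[OF bij_glue] by (simp add: lower_value_def s_def surj_f_inv_f)
  have "continuous_on {t \<in> T. h t \<in> upper_cut} s"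
    unfolding continuous_on_discrete_iff
  proof
    fix x assume x: "x \<in> {t \<in> T. h t \<in> upper_cut}"
    then obtain N where N: "open N" "x \<in> N" "\<And>y. y \<in> T \<inter> N \<Longrightarrow> glue \<alpha> \<beta> (h y) = glue \<alpha> \<beta> (h x)"
      using glue_locally_constant[OF h(1), of x] h(2) by blast
    have "s y = s x" if "y \<in> {t \<in> T. h t \<in> upper_cut} \<inter> N" for y
      using N(3)[of y] that x by (simp add: s_def)
    then show "\<exists>N. open N \<and> x \<in> N \<and> (\<forall>y\<in>{t \<in> T. h t \<in> upper_cut} \<inter> N. s y = s x)"
      using N(1,2) by blast
  qed
  moreover have "lower_value h s = (\<lambda>_. ?e)" using low by blast
  moreover have "s t = c"
    using bij_is_inj[OF bij_glue] by (simp add: s_def lower_value_def inv_f_f)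
  ultimately show "\<exists>s. is_section h T s \<and> s t = c"
    by (intro exI[of _ s]) (simp add: is_section_def)
qed

text \<open>
  A section over \<open>A\<close> and a section over \<open>B\<close> that agree at one point of the connected set \<open>A \<inter> B\<close>
  agree on all of it, and continuous functions on two closed sets can be pasted.
\<close>

lemma has_sections_Un:
  assumes cl: "closed A" "closed B" and con: "connected (A \<inter> B)" "A \<inter> B \<noteq> {}"
    and h: "continuous_on (A \<union> B) h" "h ` (A \<union> B) \<subseteq> - {0, 1}"
    and AB: "has_sections h A" "has_sections h B"
  shows "has_sections h (A \<union> B)"
proof -
  have main: "\<exists>s. is_section h (A \<union> B) s \<and> s t = c"
    if cl: "closed A" "closed B" and con: "connected (A \<inter> B)" "A \<inter> B \<noteq> {}"
    and h: "continuous_on (A \<union> B) h" "h ` (A \<union> B) \<subseteq> - {0, 1}"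
    and AB: "has_sections h A" "has_sections h B" and t: "t \<in> A" for A B t c
  proof -
    obtain s where s: "is_section h A s" "s t = c" using AB(1) t by (auto simp: has_sections_def)
    obtain t1 where t1: "t1 \<in> A" "t1 \<in> B" using con by blast
    obtain s' where s': "is_section h B s'" "s' t1 = s t1"
      using AB(2) t1 by (auto simp: has_sections_def)
    have agree: "s x = s' x" if "x \<in> A" "x \<in> B" for x
      using section_unique[OF con(1) _ _ is_section_subset[OF s(1)] is_section_subset[OF s'(1)], of t1 x]
        continuous_on_subset[OF h(1)] h(2) t1 s' that by auto
    define r where "r x = (if x \<in> A then s x else s' x)" for x
    have rA: "r x = s x" if "x \<in> A" for x using that by (simp add: r_def)
    have rB: "r x = s' x" if "x \<in> B" for x using that agree by (simp add: r_def)
    have paste: "continuous_on {x \<in> A \<union> B. h x \<in> C} q"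
      if "continuous_on {x \<in> A. h x \<in> C} p" "continuous_on {x \<in> B. h x \<in> C} p'"
        "\<And>x. x \<in> A \<Longrightarrow> q x = p x" "\<And>x. x \<in> B \<Longrightarrow> q x = p' x"
      for C and p p' q :: "'a \<Rightarrow> nat"
    proof -
      have eq: "{x \<in> A \<union> B. h x \<in> C} = {x \<in> A. h x \<in> C} \<union> {x \<in> B. h x \<in> C}" by blast
      have "{x \<in> A. h x \<in> C} = ({x \<in> A. h x \<in> C} \<union> {x \<in> B. h x \<in> C}) \<inter> A"
        "{x \<in> B. h x \<in> C} = ({x \<in> A. h x \<in> C} \<union> {x \<in> B. h x \<in> C}) \<inter> B" by blast+
      then have "closedin (top_of_set ({x \<in> A. h x \<in> C} \<union> {x \<in> B. h x \<in> C})) {x \<in> A. h x \<in> C}"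
        "closedin (top_of_set ({x \<in> A. h x \<in> C} \<union> {x \<in> B. h x \<in> C})) {x \<in> B. h x \<in> C}"
        using cl unfolding closedin_closed by blast+
      moreover have "continuous_on {x \<in> A. h x \<in> C} q" "continuous_on {x \<in> B. h x \<in> C} q"
        using that by (simp_all cong: continuous_on_cong_simp)
      ultimately show ?thesis unfolding eq by (rule continuous_on_Un_local)
    qed
    have "is_section h (A \<union> B) r"
      using s(1) s'(1) unfolding is_section_def
      by (intro conjI paste[of _ s s' r] paste[of _ "lower_value h s" "lower_value h s'" "lower_value h r"])
        (simp_all add: rA rB lower_value_def)
    then show ?thesis using rA[OF t] s(2) by blast
  qed
  show ?thesis
    unfolding has_sections_def
    using main[OF assms] main[of B A] assms by (auto simp: Un_commute Int_commute)
qed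

text \<open>
  Near every point the map stays in one of the two cuts, where constant sections exist. Bisection
  in the first coordinate yields sections over strips of full width around every height, bisection in
  the second coordinate stacks these strips. Neighbouring rectangles meet in a segment, so they
  can be pasted.
\<close>

theorem has_sections_rectangle:
  fixes h :: "real \<times> real \<Rightarrow> complex"
  assumes h: "continuous_on ({0..1} \<times> {0..1}) h" "h ` ({0..1} \<times> {0..1}) \<subseteq> - {0, 1}"
  shows "has_sections h ({0..1} \<times> {0..1})"
proof -
  have sub: "{a..b} \<times> {c..d} \<subseteq> {0..1} \<times> {0..1}" if "0 \<le> a" "b \<le> 1" "0 \<le> c" "d \<le> 1" for a b c d :: real
    using that by auto
  have hsub: "continuous_on S h" "h ` S \<subseteq> - {0, 1}" if "S \<subseteq> {0..1} \<times> {0..1}" for S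
    using h that by (auto intro: continuous_on_subset)
  have strip: "\<exists>e>0. \<forall>c d. 0 \<le> c \<and> d \<le> 1 \<and> c \<le> y \<and> y \<le> d \<and> d - c < e \<longrightarrow> has_sections h ({0..1} \<times> {c..d})"
    if y: "0 \<le> y" "y \<le> 1" for y
  proof -
    have "0 \<le> (0::real) \<longrightarrow> (1::real) \<le> 1 \<longrightarrow> (\<exists>e>0. \<forall>c d. 0 \<le> c \<and> d \<le> 1 \<and> c \<le> y \<and> y \<le> d \<and> d - c < e
        \<longrightarrow> has_sections h ({0..1} \<times> {c..d}))"
    proof (rule Bolzano[where a = 0 and b = 1 and P = "\<lambda>a b. 0 \<le> a \<longrightarrow> b \<le> 1 \<longrightarrow>
        (\<exists>e>0. \<forall>c d. 0 \<le> c \<and> d \<le> 1 \<and> c \<le> y \<and> y \<le> d \<and> d - c < e \<longrightarrow> has_sections h ({a..b} \<times> {c..d}))"])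
      fix a b b' :: real
      assume P1: "0 \<le> a \<longrightarrow> b \<le> 1 \<longrightarrow>
        (\<exists>e>0. \<forall>c d. 0 \<le> c \<and> d \<le> 1 \<and> c \<le> y \<and> y \<le> d \<and> d - c < e \<longrightarrow> has_sections h ({a..b} \<times> {c..d}))"
        and P2: "0 \<le> b \<longrightarrow> b' \<le> 1 \<longrightarrow>
        (\<exists>e>0. \<forall>c d. 0 \<le> c \<and> d \<le> 1 \<and> c \<le> y \<and> y \<le> d \<and> d - c < e \<longrightarrow> has_sections h ({b..b'} \<times> {c..d}))"
        and ab: "a \<le> b" "b \<le> b'"
      show "0 \<le> a \<longrightarrow> b' \<le> 1 \<longrightarrow>
        (\<exists>e>0. \<forall>c d. 0 \<le> c \<and> d \<le> 1 \<and> c \<le> y \<and> y \<le> d \<and> d - c < e \<longrightarrow> has_sections h ({a..b'} \<times> {c..d}))"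
      proof (intro impI)
        assume ab': "0 \<le> a" "b' \<le> 1"
        then obtain e1 e2 where e: "e1 > 0" "e2 > 0"
          "\<And>c d. 0 \<le> c \<Longrightarrow> d \<le> 1 \<Longrightarrow> c \<le> y \<Longrightarrow> y \<le> d \<Longrightarrow> d - c < e1 \<Longrightarrow> has_sections h ({a..b} \<times> {c..d})"
          "\<And>c d. 0 \<le> c \<Longrightarrow> d \<le> 1 \<Longrightarrow> c \<le> y \<Longrightarrow> y \<le> d \<Longrightarrow> d - c < e2 \<Longrightarrow> has_sections h ({b..b'} \<times> {c..d})"
          using P1 P2 ab by auto
        have "has_sections h ({a..b'} \<times> {c..d})"
          if c: "0 \<le> c" "d \<le> 1" "c \<le> y" "y \<le> d" "d - c < min e1 e2" for c d
        proof -
          have eq: "{a..b'} \<times> {c..d} = {a..b} \<times> {c..d} \<union> {b..b'} \<times> {c..d}" using ab by auto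
          have int: "({a..b} \<times> {c..d}) \<inter> ({b..b'} \<times> {c..d}) = {b} \<times> {c..d}" using ab by auto
          have S: "{a..b} \<times> {c..d} \<union> {b..b'} \<times> {c..d} \<subseteq> {0..1} \<times> {0..1}"
            using ab ab' c by auto
          show ?thesis unfolding eq
          proof (rule has_sections_Un)
            show "connected (({a..b} \<times> {c..d}) \<inter> ({b..b'} \<times> {c..d}))"
              unfolding int by (simp add: connected_Times)
            show "({a..b} \<times> {c..d}) \<inter> ({b..b'} \<times> {c..d}) \<noteq> {}" unfolding int using c by auto
          qed (use e c hsub[OF S] in \<open>auto intro!: closed_Times\<close>)
        qed
        then show "\<exists>e>0. \<forall>c d. 0 \<le> c \<and> d \<le> 1 \<and> c \<le> y \<and> y \<le> d \<and> d - c < e \<longrightarrow> has_sections h ({a..b'} \<times> {c..d})"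
          using e(1,2) by (intro exI[of _ "min e1 e2"]) auto
      qed
    next
      fix x :: real assume x: "0 \<le> x" "x \<le> 1"
      have "\<exists>e>0. \<forall>p\<in>{0..1} \<times> {0..1}. dist p (x, y) < e \<longrightarrow> h p \<in> C" if "open C" "h (x, y) \<in> C" for C
      proof -
        obtain \<epsilon> where \<epsilon>: "\<epsilon> > 0" "ball (h (x, y)) \<epsilon> \<subseteq> C" using \<open>open C\<close> \<open>h (x, y) \<in> C\<close> openE by blast
        have "(x, y) \<in> {0..1} \<times> {0..1}" using x y by simp
        then obtain \<delta> where "\<delta> > 0" "\<forall>p\<in>{0..1} \<times> {0..1}. dist p (x, y) < \<delta> \<longrightarrow> dist (h p) (h (x, y)) < \<epsilon>"
          using h(1) \<epsilon>(1) unfolding continuous_on_iff by blast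
        then show ?thesis using \<epsilon>(2) by (intro exI[of _ \<delta>]) (auto simp: dist_commute subset_iff)
      qed
      moreover
      have "h (x, y) \<in> upper_cut \<or> h (x, y) \<in> lower_cut"
      proof -
        have "h (x, y) \<in> - {0, 1}" using x y by (intro subsetD[OF h(2)] imageI) simp
        then show ?thesis unfolding cut_cover[symmetric] by blast
      qed
      then obtain C where C: "C = upper_cut \<or> C = lower_cut" "h (x, y) \<in> C" by blast
      moreover have "open C" using C(1) open_cuts by blast
      ultimately obtain e where e: "e > 0" "C = upper_cut \<or> C = lower_cut"
        "\<And>p. p \<in> {0..1} \<times> {0..1} \<Longrightarrow> dist p (x, y) < e \<Longrightarrow> h p \<in> C"
        by meson
      show "\<exists>d>0. \<forall>a b. a \<le> x \<and> x \<le> b \<and> b - a < d \<longrightarrow> 0 \<le> a \<longrightarrow> b \<le> 1 \<longrightarrow>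
        (\<exists>e>0. \<forall>c d. 0 \<le> c \<and> d \<le> 1 \<and> c \<le> y \<and> y \<le> d \<and> d - c < e \<longrightarrow> has_sections h ({a..b} \<times> {c..d}))"
      proof (intro exI[of _ "e / 2"] conjI allI impI)
        fix a b c d assume ab: "a \<le> x \<and> x \<le> b \<and> b - a < e / 2" "0 \<le> a" "b \<le> 1"
          and cd: "0 \<le> c \<and> d \<le> 1 \<and> c \<le> y \<and> y \<le> d \<and> d - c < e / 2"
        have S: "{a..b} \<times> {c..d} \<subseteq> {0..1} \<times> {0..1}" using ab cd by auto
        have "h ` ({a..b} \<times> {c..d}) \<subseteq> C"
        proof clarify
          fix u v assume uv: "u \<in> {a..b}" "v \<in> {c..d}"
          have "dist (u, v) (x, y) \<le> \<bar>u - x\<bar> + \<bar>v - y\<bar>"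
            using norm_Pair_le[of "u - x" "v - y"] by (simp add: dist_norm)
          also have "\<dots> < e" using uv ab cd by auto
          finally show "h (u, v) \<in> C" using e(3)[OF subsetD[OF S, of "(u, v)"]] uv by simp
        qed
        then show "has_sections h ({a..b} \<times> {c..d})"
          using has_sections_upper[OF hsub(1)[OF S]] has_sections_lower[OF hsub(1)[OF S]] e(2) by auto
      qed (use e(1) in auto)
    qed simp
    then show ?thesis by simp
  qed
  have "0 \<le> (0::real) \<longrightarrow> (1::real) \<le> 1 \<longrightarrow> has_sections h ({0..1} \<times> {0..1})"
  proof (rule Bolzano[where a = 0 and b = 1 and P = "\<lambda>c d. 0 \<le> c \<longrightarrow> d \<le> 1 \<longrightarrow> has_sections h ({0..1} \<times> {c..d})"])
    fix c d d' :: real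
    assume P: "0 \<le> c \<longrightarrow> d \<le> 1 \<longrightarrow> has_sections h ({0..1} \<times> {c..d})"
      "0 \<le> d \<longrightarrow> d' \<le> 1 \<longrightarrow> has_sections h ({0..1} \<times> {d..d'})" and cd: "c \<le> d" "d \<le> d'"
    show "0 \<le> c \<longrightarrow> d' \<le> 1 \<longrightarrow> has_sections h ({0..1} \<times> {c..d'})"
    proof (intro impI)
      assume c: "0 \<le> c" "d' \<le> 1"
      have eq: "{0..1::real} \<times> {c..d'} = {0..1} \<times> {c..d} \<union> {0..1} \<times> {d..d'}" using cd by auto
      have int: "({0..1::real} \<times> {c..d}) \<inter> ({0..1} \<times> {d..d'}) = {0..1} \<times> {d}" using cd by auto
      have S: "{0..1} \<times> {c..d} \<union> {0..1} \<times> {d..d'} \<subseteq> {0..1} \<times> {0..1::real}" using cd c by auto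
      show "has_sections h ({0..1} \<times> {c..d'})"
        unfolding eq
      proof (rule has_sections_Un)
        show "connected (({0..1::real} \<times> {c..d}) \<inter> ({0..1} \<times> {d..d'}))"
          unfolding int by (simp add: connected_Times)
        show "({0..1::real} \<times> {c..d}) \<inter> ({0..1} \<times> {d..d'}) \<noteq> {}" unfolding int by auto
      qed (use P cd c hsub[OF S] in \<open>auto intro!: closed_Times\<close>)
    qed
  next
    fix y :: real assume "0 \<le> y" "y \<le> 1"
    then show "\<exists>d>0. \<forall>a b. a \<le> y \<and> y \<le> b \<and> b - a < d \<longrightarrow> 0 \<le> a \<longrightarrow> b \<le> 1 \<longrightarrow> has_sections h ({0..1} \<times> {a..b})"
      using strip[of y] by blast
  qed simp
  then show ?thesis by simp
qed

text \<open>
  The description is meaningful for paths in the punctured plane, along which sections exist and are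
  determined by their initial value.
\<close>

definition transport :: "(real \<Rightarrow> complex) \<Rightarrow> nat \<Rightarrow> nat"
  where "transport p c = (THE d. \<exists>s. is_section p {0..1} s \<and> s 0 = c \<and> s 1 = d)"

lemma transport_eqI:
  assumes p: "continuous_on {0..1} p" "p ` {0..1} \<subseteq> - {0, 1}" and s: "is_section p {0..1} s"
  shows "transport p (s 0) = s 1"
  unfolding transport_def
proof (rule the_equality)
  show "\<exists>s'. is_section p {0..1} s' \<and> s' 0 = s 0 \<and> s' 1 = s 1" using s by blast
  fix d assume "\<exists>s'. is_section p {0..1} s' \<and> s' 0 = s 0 \<and> s' 1 = d"
  then obtain s' where "is_section p {0..1} s'" "s' 0 = s 0" "s' 1 = d" by blast
  then show "d = s 1" using section_unique[OF _ p, of s' s 0 1] s by simp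
qed

lemma is_section_cong:
  assumes "\<And>t. t \<in> T \<Longrightarrow> p t = q t"
  shows "is_section p T s \<longleftrightarrow> is_section q T s"
proof -
  have "{t \<in> T. p t \<in> C} = {t \<in> T. q t \<in> C}" for C using assms by auto
  moreover have "continuous_on {t \<in> T. q t \<in> lower_cut} (lower_value p s)
      \<longleftrightarrow> continuous_on {t \<in> T. q t \<in> lower_cut} (lower_value q s)"
    by (rule continuous_on_cong) (simp_all add: lower_value_def assms)
  ultimately show ?thesis by (simp add: is_section_def)
qed

lemma transport_cong: "(\<And>t. t \<in> {0..1} \<Longrightarrow> p t = q t) \<Longrightarrow> transport p = transport q"
proof -
  assume "\<And>t. t \<in> {0..1} \<Longrightarrow> p t = q t"
  then have "is_section p {0..1} = is_section q {0..1}" by (intro ext is_section_cong)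
  then show ?thesis by (simp add: transport_def fun_eq_iff)
qed

lemma transport_const: "z \<notin> {0, 1} \<Longrightarrow> transport (\<lambda>_. z) c = c"
  using transport_eqI[of "\<lambda>_. z" "\<lambda>_. c"]
  by (simp add: is_section_def lower_value_def image_subset_iff)

lemma transport_pullback:
  assumes h: "continuous_on T h" "h ` T \<subseteq> - {0, 1}" and s: "is_section h T s"
    and j: "continuous_on {0..1} j" "j ` {0..1} \<subseteq> T"
  shows "transport (\<lambda>t. h (j t)) (s (j 0)) = s (j 1)"
  using transport_eqI[OF _ _ is_section_pullback[OF s j]] continuous_on_compose2[OF h(1) j] h(2) j(2)
  by (simp add: image_subset_iff)

text \<open>
  Homotopy invariance: all transports involved are read off from one section over the whole square.
\<close>

theorem transport_square:
  assumes h: "continuous_on ({0..1} \<times> {0..1}) h" "h ` ({0..1} \<times> {0..1}) \<subseteq> - {0, 1}"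
  shows "transport (\<lambda>t. h (t, t)) = transport (\<lambda>t. h (t, 1)) \<circ> transport (\<lambda>t. h (0, t))"
    and "transport (\<lambda>t. h (t, t)) = transport (\<lambda>t. h (1, t)) \<circ> transport (\<lambda>t. h (t, 0))"
proof -
  have *: "transport (\<lambda>t. h (t, t)) c = (transport (\<lambda>t. h (t, 1)) \<circ> transport (\<lambda>t. h (0, t))) c \<and>
    transport (\<lambda>t. h (t, t)) c = (transport (\<lambda>t. h (1, t)) \<circ> transport (\<lambda>t. h (t, 0))) c" for c
  proof -
    obtain s where s: "is_section h ({0..1} \<times> {0..1}) s" "s (0, 0) = c"
      using has_sections_rectangle[OF h] unfolding has_sections_def by force
    note T = transport_pullback[OF h s(1)]
    have "transport (\<lambda>t. h (t, t)) c = s (1, 1)"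
      using T[of "\<lambda>t. (t, t)"] s(2) by (force intro!: continuous_intros)
    moreover have "transport (\<lambda>t. h (0, t)) c = s (0, 1)"
      using T[of "\<lambda>t. (0, t)"] s(2) by (force intro!: continuous_intros)
    moreover have "transport (\<lambda>t. h (t, 0)) c = s (1, 0)"
      using T[of "\<lambda>t. (t, 0)"] s(2) by (force intro!: continuous_intros)
    moreover have "transport (\<lambda>t. h (t, 1)) (s (0, 1)) = s (1, 1)"
      using T[of "\<lambda>t. (t, 1)"] by (force intro!: continuous_intros)
    moreover have "transport (\<lambda>t. h (1, t)) (s (1, 0)) = s (1, 1)"
      using T[of "\<lambda>t. (1, t)"] by (force intro!: continuous_intros)
    ultimately show ?thesis by simp
  qed
  show "transport (\<lambda>t. h (t, t)) = transport (\<lambda>t. h (t, 1)) \<circ> transport (\<lambda>t. h (0, t))"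
    "transport (\<lambda>t. h (t, t)) = transport (\<lambda>t. h (1, t)) \<circ> transport (\<lambda>t. h (t, 0))"
    using * by blast+
qed

lemma section_along_path:
  assumes p: "continuous_on {0..1} p" "p ` {0..1} \<subseteq> - {0, 1}"
  obtains s where "is_section p {0..1} s" "s (0 :: real) = c"
proof -
  define h where "h = (\<lambda>x :: real \<times> real. p (fst x))"
  have "continuous_on ({0..1} \<times> {0..1}) h"
    unfolding h_def by (intro continuous_on_compose2[OF p(1)] continuous_intros) auto
  moreover have "h ` ({0..1} \<times> {0..1}) \<subseteq> - {0, 1}"
    using p(2) by (auto simp: h_def)
  ultimately obtain s where s: "is_section h ({0..1} \<times> {0..1}) s" "s (0, 0) = c"
    using has_sections_rectangle unfolding has_sections_def by force
  have "is_section (\<lambda>t. h (t, 0)) {0..1} (\<lambda>t. s (t, 0))"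
    by (rule is_section_pullback[OF s(1)]) (auto intro!: continuous_intros)
  then show thesis using that s(2) by (simp add: h_def)
qed

text \<open>
  The path runs through the upper cut, crosses into the lower cut on the left of \<open>0\<close>, where the charts
  differ by \<open>\<alpha>\<close>, and ends in the middle strip, where they agree.
\<close>

lemma transport_around_0:
  assumes p: "continuous_on {0..1} p"
    and up: "\<And>t. 0 \<le> t \<Longrightarrow> t \<le> 1/2 \<Longrightarrow> p t \<in> upper_cut"
    and low: "\<And>t. 1/2 \<le> t \<Longrightarrow> t \<le> 1 \<Longrightarrow> p t \<in> lower_cut"
    and mid: "Re (p (1/2)) < 0" and last: "0 < Re (p 1)" "Re (p 1) < 1"
  shows "transport p c = \<alpha> c"
proof -
  have X: "p ` {0..1} \<subseteq> - {0, 1}"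
  proof (rule image_subsetI)
    fix t :: real assume "t \<in> {0..1}"
    then have "p t \<in> upper_cut \<union> lower_cut" using up[of t] low[of t] by (cases "t \<le> 1/2") auto
    then show "p t \<in> - {0, 1}" by (simp only: cut_cover)
  qed
  obtain s where s: "is_section p {0..1} s" "s 0 = c" using section_along_path[OF p X] .
  have "continuous_on {0..1/2} s"
    using s(1) up unfolding is_section_def by (auto elim!: continuous_on_subset)
  then have 1: "s (1/2) = c" using continuous_on_discrete_connected[of "{0..1/2}" s "1/2" 0] s(2) by simp
  have "continuous_on {1/2..1} (lower_value p s)"
    using s(1) low unfolding is_section_def by (auto elim!: continuous_on_subset)
  then have 2: "lower_value p s (1/2) = lower_value p s 1"
    using continuous_on_discrete_connected[of "{1/2..1}" "lower_value p s" "1/2" 1] by simp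
  have "lower_value p s (1/2) = \<alpha> c" using up[of "1/2"] mid by (simp add: lower_value_def glue_def 1)
  moreover have "lower_value p s 1 = s 1" using last by (simp add: lower_value_def glue_def)
  ultimately show ?thesis using transport_eqI[OF p X s(1)] s(2) 2 by simp
qed

text \<open>
  Here the path starts in the middle strip, runs through the lower cut and crosses into the
  upper cut on the right of \<open>1\<close>, so the inverse of \<open>\<beta>\<close> is picked up.
\<close>

lemma transport_around_1:
  assumes p: "continuous_on {0..1} p"
    and low: "\<And>t. 0 \<le> t \<Longrightarrow> t \<le> 1/2 \<Longrightarrow> p t \<in> lower_cut"
    and up: "\<And>t. 1/2 \<le> t \<Longrightarrow> t \<le> 1 \<Longrightarrow> p t \<in> upper_cut"
    and mid: "Re (p (1/2)) > 1" and first: "0 < Re (p 0)" "Re (p 0) < 1"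
  shows "\<beta> (transport p c) = c"
proof -
  have X: "p ` {0..1} \<subseteq> - {0, 1}"
  proof (rule image_subsetI)
    fix t :: real assume "t \<in> {0..1}"
    then have "p t \<in> upper_cut \<union> lower_cut" using up[of t] low[of t] by (cases "t \<le> 1/2") auto
    then show "p t \<in> - {0, 1}" by (simp only: cut_cover)
  qed
  obtain s where s: "is_section p {0..1} s" "s 0 = c" using section_along_path[OF p X] .
  have "continuous_on {0..1/2} (lower_value p s)"
    using s(1) low unfolding is_section_def by (auto elim!: continuous_on_subset)
  then have 1: "lower_value p s (1/2) = lower_value p s 0"
    using continuous_on_discrete_connected[of "{0..1/2}" "lower_value p s" "1/2" 0] by simp
  have "continuous_on {1/2..1} s"
    using s(1) up unfolding is_section_def by (auto elim!: continuous_on_subset)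
  then have 2: "s (1/2) = s 1" using continuous_on_discrete_connected[of "{1/2..1}" s "1/2" 1] by simp
  have "lower_value p s (1/2) = \<beta> (s 1)" using up[of "1/2"] mid by (simp add: lower_value_def glue_def 2)
  moreover have "lower_value p s 0 = c" using first s(2) by (simp add: lower_value_def glue_def)
  ultimately show ?thesis using transport_eqI[OF p X s(1)] s(2) 1 by simp
qed

end

section \<open>The Alexander isotopy\<close>

text \<open>
  The homeomorphism \<open>f\<close> conjugated by the scaling with factor \<open>t\<close>, an isotopy from the identity
  at \<open>t = 0\<close> to \<open>f\<close> at \<open>t = 1\<close>. Written in terms of the displacement of \<open>f\<close> the formula also covers
  \<open>t = 0\<close>, where the displacement is multiplied by \<open>0\<close>.
\<close>

definition alexander :: "(complex \<Rightarrow> complex) \<Rightarrow> real \<Rightarrow> complex \<Rightarrow> complex"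
  where "alexander f t z = z + t *\<^sub>R (f (z /\<^sub>R t) - z /\<^sub>R t)"

text \<open>
  What is used of a homeomorphism of the disk that fixes the boundary, once it has been extended to the plane by
  the identity.
\<close>

definition plane_homeo :: "(complex \<Rightarrow> complex) \<Rightarrow> bool"
  where "plane_homeo f \<longleftrightarrow> continuous_on UNIV f \<and> inj f \<and>
    (\<forall>z. norm z \<ge> 1 \<longrightarrow> f z = z) \<and> (\<forall>z. norm z \<le> 1 \<longrightarrow> norm (f z) \<le> 1)"

lemma alexander_0 [simp]: "alexander f 0 z = z"
  by (simp add: alexander_def)

lemma alexander_1 [simp]: "alexander f 1 z = f z"
  by (simp add: alexander_def)

lemma alexander_id [simp]: "alexander (\<lambda>z. z) t z = z"
  by (simp add: alexander_def)

lemma alexander_pos: "t > 0 \<Longrightarrow> alexander f t z = t *\<^sub>R f (z /\<^sub>R t)"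
  by (simp add: alexander_def scaleR_diff_right)

lemma inj_alexander:
  assumes "plane_homeo f" "t \<ge> 0" shows "inj (alexander f t)"
proof (cases "t = 0")
  case False
  have "inj f" using assms(1) by (simp add: plane_homeo_def)
  then show ?thesis using False assms(2) by (intro injI) (simp add: alexander_pos inj_eq)
qed (simp add: inj_def)

lemma alexander_compose: "t \<ge> 0 \<Longrightarrow> alexander (f \<circ> g) t z = alexander f t (alexander g t z)"
  by (cases "t = 0") (auto simp: alexander_pos)

lemma displacement_le:
  assumes "plane_homeo f" shows "norm (f z - z) \<le> 2"
proof (cases "norm z \<le> 1")
  case True
  then have "norm (f z) \<le> 1" using assms unfolding plane_homeo_def by blast
  then show ?thesis using True norm_triangle_ineq4[of "f z" z] by linarith
next
  case False
  then have "f z = z" using assms unfolding plane_homeo_def by (meson linear)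
  then show ?thesis by simp
qed

lemma alexander_near:
  assumes "plane_homeo f" "t \<ge> 0" shows "norm (alexander f t z - z) \<le> 2 * t"
  using mult_left_mono[OF displacement_le[OF assms(1), of "z /\<^sub>R t"] assms(2)] assms(2)
  by (simp add: alexander_def)

text \<open>
  For \<open>t > 0\<close> this is a composition of continuous maps. At \<open>t = 0\<close> it holds because the displacement of
  a homeomorphism of the unit disk is at most \<open>2\<close>, so that of its rescaling is at most \<open>2 * t\<close>.
\<close>

lemma continuous_on_alexander:
  fixes F :: "real \<Rightarrow> complex \<Rightarrow> complex"
  assumes F: "continuous_on ({0..1} \<times> UNIV) (\<lambda>(s, z). F s z)"
    and homeo: "\<And>s. s \<in> {0..1} \<Longrightarrow> plane_homeo (F s)"
  shows "continuous_on ({0..1} \<times> {0..1} \<times> UNIV) (\<lambda>(t, s, z). alexander (F s) t z)"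
    (is "continuous_on ?S ?A")
  unfolding continuous_on_def
proof
  fix x :: "real \<times> real \<times> complex" assume x: "x \<in> ?S"
  obtain t0 s0 z0 where [simp]: "x = (t0, s0, z0)" by (cases x)
  show "(?A \<longlongrightarrow> ?A x) (at x within ?S)"
  proof (cases "t0 = 0")
    case True
    have "((\<lambda>y. ?A y - snd (snd y)) \<longlongrightarrow> 0) (at x within ?S)"
    proof (rule Lim_null_comparison)
      have "norm (?A y - snd (snd y)) \<le> 2 * fst y" if "y \<in> ?S" for y
      proof -
        obtain t s z where y: "y = (t, s, z)" by (cases y)
        have "plane_homeo (F s)" "0 \<le> t" using that homeo by (simp_all add: y)
        then show ?thesis by (simp add: y alexander_near)
      qed
      then show "\<forall>\<^sub>F y in at x within ?S. norm (?A y - snd (snd y)) \<le> 2 * fst y"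
        unfolding eventually_at_filter by (intro always_eventually allI impI)
      have "((\<lambda>y. 2 * fst y) \<longlongrightarrow> 2 * fst x) (at x within ?S)" by (intro tendsto_intros)
      then show "((\<lambda>y. 2 * fst y) \<longlongrightarrow> 0) (at x within ?S)" using True by simp
    qed
    moreover have "((\<lambda>y. snd (snd y)) \<longlongrightarrow> snd (snd x)) (at x within ?S)" by (intro tendsto_intros)
    ultimately have "((\<lambda>y. (?A y - snd (snd y)) + snd (snd y)) \<longlongrightarrow> 0 + snd (snd x)) (at x within ?S)"
      by (rule tendsto_add)
    then show ?thesis using True by simp
  next
    case False
    define T where "T = {0<..1::real} \<times> {0..1::real} \<times> (UNIV :: complex set)"
    have xT: "x \<in> T" using x False by (simp add: T_def)
    have j: "continuous_on T (\<lambda>y. (fst (snd y), snd (snd y) /\<^sub>R fst y))"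
      by (intro continuous_intros) (auto simp: T_def)
    have "continuous_on T (\<lambda>y. (\<lambda>(s, z). F s z) (fst (snd y), snd (snd y) /\<^sub>R fst y))"
      by (rule continuous_on_compose2[OF F j]) (auto simp: T_def)
    then have "continuous_on T (\<lambda>y. snd (snd y) + fst y *\<^sub>R ((\<lambda>(s, z). F s z) (fst (snd y), snd (snd y) /\<^sub>R fst y)
        - snd (snd y) /\<^sub>R fst y))"
      by (intro continuous_intros) (auto simp: T_def)
    then have "continuous_on T ?A" by (rule continuous_on_eq) (auto simp: alexander_def)
    then have "(?A \<longlongrightarrow> ?A x) (at x within T)" using xT by (simp only: continuous_on_def)
    moreover have "at x within T = at x within ?S"
      by (rule at_within_nhd[of x "{0<..} \<times> UNIV"]) (use x False in \<open>auto simp: T_def open_Times\<close>)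
    ultimately show ?thesis by simp
  qed
qed

section \<open>The monodromy of three marked points\<close>

text \<open>
  Three distinct points up to affine maps. The ratio degenerates to \<open>0\<close> when the first two points
  collide and to \<open>1\<close> when the last two do.
\<close>

definition triple_ratio :: "complex \<Rightarrow> complex \<Rightarrow> complex \<Rightarrow> complex"
  where "triple_ratio a b c = (b - a) / (c - a)"

lemma triple_ratio_avoids: "a \<noteq> b \<Longrightarrow> a \<noteq> c \<Longrightarrow> b \<noteq> c \<Longrightarrow> triple_ratio a b c \<notin> {0, 1}"
  by (auto simp: triple_ratio_def)

locale marked_triple = fibre_permutations +
  fixes p1 p2 p3 :: complex
  assumes distinct: "p1 \<noteq> p2" "p1 \<noteq> p3" "p2 \<noteq> p3"
begin

text \<open>
  The transport along the loop that the ratio of the three marked points describes during the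
  Alexander isotopy of \<open>f\<close>.
\<close>

definition monodromy :: "(complex \<Rightarrow> complex) \<Rightarrow> nat \<Rightarrow> nat"
  where "monodromy f = transport (\<lambda>t. triple_ratio (alexander f t p1) (alexander f t p2) (alexander f t p3))"

lemma monodromy_id [simp]: "monodromy (\<lambda>z. z) = id"
  using transport_const[OF triple_ratio_avoids] distinct by (auto simp: monodromy_def)

lemma transport_family_square:
  fixes A :: "real \<Rightarrow> real \<Rightarrow> complex \<Rightarrow> complex"
  assumes cont: "\<And>z. continuous_on ({0..1} \<times> {0..1}) (\<lambda>(t, s). A t s z)"
    and inj: "\<And>t s. t \<in> {0..1} \<Longrightarrow> s \<in> {0..1} \<Longrightarrow> inj (A t s)"
  defines "q t s \<equiv> triple_ratio (A t s p1) (A t s p2) (A t s p3)"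
  shows "transport (\<lambda>t. q t t) = transport (\<lambda>t. q t 1) \<circ> transport (\<lambda>t. q 0 t)"
    and "transport (\<lambda>t. q t t) = transport (\<lambda>t. q 1 t) \<circ> transport (\<lambda>t. q t 0)"
proof -
  have ne: "A t s p1 \<noteq> A t s p2" "A t s p1 \<noteq> A t s p3" "A t s p2 \<noteq> A t s p3"
    if "t \<in> {0..1}" "s \<in> {0..1}" for t s
    using distinct by (simp_all add: inj_eq[OF inj[OF that]])
  define h where "h = (\<lambda>y. q (fst y) (snd y))"
  have A: "continuous_on ({0..1} \<times> {0..1}) (\<lambda>y. A (fst y) (snd y) z)" for z
    using cont[of z] by (simp only: case_prod_unfold)
  have "A (fst y) (snd y) p3 - A (fst y) (snd y) p1 \<noteq> 0" if "y \<in> {0..1} \<times> {0..1}" for y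
    using ne(2)[of "fst y" "snd y"] that by (auto simp: mem_Times_iff)
  then have h: "continuous_on ({0..1} \<times> {0..1}) h"
    unfolding h_def q_def triple_ratio_def by (intro continuous_on_divide continuous_on_diff A ballI)
  have h': "h ` ({0..1} \<times> {0..1}) \<subseteq> - {0, 1}"
  proof (rule image_subsetI)
    fix y :: "real \<times> real" assume "y \<in> {0..1} \<times> {0..1}"
    then show "h y \<in> - {0, 1}"
      using triple_ratio_avoids[OF ne, of "fst y" "snd y"] by (simp add: q_def h_def mem_Times_iff)
  qed
  note sq = transport_square[OF h h', unfolded h_def fst_conv snd_conv]
  show "transport (\<lambda>t. q t t) = transport (\<lambda>t. q t 1) \<circ> transport (\<lambda>t. q 0 t)" by (fact sq(1))
  show "transport (\<lambda>t. q t t) = transport (\<lambda>t. q 1 t) \<circ> transport (\<lambda>t. q t 0)" by (fact sq(2))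
qed

lemma continuous_on_alexander_single:
  assumes "plane_homeo f"
  shows "continuous_on ({0..1} \<times> UNIV) (\<lambda>(t, z). alexander f t z)"
proof -
  have "continuous_on UNIV f" using assms by (simp add: plane_homeo_def)
  then have "continuous_on ({0..1::real} \<times> UNIV) (\<lambda>y. f (snd y))"
    by (rule continuous_on_compose2) (auto intro: continuous_on_snd continuous_on_id)
  then have "continuous_on ({0..1::real} \<times> UNIV) (\<lambda>(s, z). f z)" by (simp only: case_prod_unfold)
  from continuous_on_alexander[OF this] assms
  have *: "continuous_on ({0..1} \<times> {0..1::real} \<times> UNIV) (\<lambda>(t, s, z). alexander f t z)" by blast
  have j: "continuous_on ({0..1::real} \<times> UNIV) (\<lambda>y :: real \<times> complex. (fst y, 0 :: real, snd y))"
    by (intro continuous_intros)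
  have "continuous_on ({0..1} \<times> UNIV) (\<lambda>y :: real \<times> complex. (\<lambda>(t, s, z). alexander f t z) (fst y, 0 :: real, snd y))"
    by (rule continuous_on_compose2[OF * j]) auto
  then show ?thesis by (simp add: case_prod_beta)
qed

text \<open>
  Consider the square of maps \<open>alexander f t \<circ> alexander g s\<close>. Its diagonal is the Alexander isotopy of
  \<open>f \<circ> g\<close>, its side \<open>t = 0\<close> is that of \<open>g\<close>, and its side \<open>s = 1\<close> moves the marked points as
  that of \<open>f\<close> does, because \<open>g\<close> fixes them.
\<close>

theorem monodromy_compose:
  assumes f: "plane_homeo f" and g: "plane_homeo g" and fix_g: "g p1 = p1" "g p2 = p2" "g p3 = p3"
  shows "monodromy (f \<circ> g) = monodromy f \<circ> monodromy g"
proof -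
  have c: "continuous_on ({0..1} \<times> {0..1}) (\<lambda>(t, s). alexander f t (alexander g s z))" for z
  proof -
    have j: "continuous_on ({0..1::real} \<times> {0..1::real}) (\<lambda>y. (snd y, z))" by (intro continuous_intros)
    have "continuous_on ({0..1::real} \<times> {0..1}) (\<lambda>y. (\<lambda>(t, z). alexander g t z) (snd y, z))"
      by (rule continuous_on_compose2[OF continuous_on_alexander_single[OF g] j]) auto
    then have g': "continuous_on ({0..1::real} \<times> {0..1}) (\<lambda>y. (fst y, alexander g (snd y) z))"
      by (intro continuous_on_Pair continuous_on_fst continuous_on_id) simp
    have "continuous_on ({0..1::real} \<times> {0..1}) (\<lambda>y. (\<lambda>(t, z). alexander f t z) (fst y, alexander g (snd y) z))"
      by (rule continuous_on_compose2[OF continuous_on_alexander_single[OF f] g']) auto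
    then show ?thesis by (simp add: case_prod_beta)
  qed
  have i: "inj (\<lambda>z. alexander f t (alexander g s z))" if "t \<in> {0..1}" "s \<in> {0..1}" for t s
    using inj_compose[OF inj_alexander[OF f] inj_alexander[OF g], of t s] that by (simp add: o_def)
  let ?q = "\<lambda>t s. triple_ratio (alexander f t (alexander g s p1)) (alexander f t (alexander g s p2)) (alexander f t (alexander g s p3))"
  have "transport (\<lambda>t. ?q t t) = transport (\<lambda>t. ?q t 1) \<circ> transport (\<lambda>t. ?q 0 t)"
    by (rule transport_family_square(1)[of "\<lambda>t s z. alexander f t (alexander g s z)", OF c i])
  moreover have "monodromy (f \<circ> g) = transport (\<lambda>t. ?q t t)"
    unfolding monodromy_def by (rule transport_cong) (simp add: alexander_compose)
  ultimately show ?thesis using fix_g by (simp add: monodromy_def)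
qed

text \<open>
  Consider the square \<open>alexander (F s) t\<close>. The sides \<open>s = 0\<close> and \<open>s = 1\<close> give the monodromies of \<open>F 0\<close> and
  \<open>F 1\<close>, the side \<open>t = 0\<close> is constant, and the side \<open>t = 1\<close> is the motion of the marked points under
  the family. For a family that fixes the marked points this proves invariance under isotopy; for a family that starts
  at the identity it computes the monodromy of \<open>F 1\<close> from an isotopy more convenient than Alexander's.
\<close>

lemma monodromy_family:
  fixes F :: "real \<Rightarrow> complex \<Rightarrow> complex"
  assumes F: "continuous_on ({0..1} \<times> UNIV) (\<lambda>(s, z). F s z)"
    and homeo: "\<And>s. s \<in> {0..1} \<Longrightarrow> plane_homeo (F s)"
  shows "monodromy (F 1) = transport (\<lambda>s. triple_ratio (F s p1) (F s p2) (F s p3)) \<circ> monodromy (F 0)"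
proof -
  have c: "continuous_on ({0..1} \<times> {0..1}) (\<lambda>(t, s). alexander (F s) t z)" for z
  proof -
    have j: "continuous_on ({0..1::real} \<times> {0..1::real}) (\<lambda>y. (fst y, snd y, z))" by (intro continuous_intros)
    have "continuous_on ({0..1} \<times> {0..1}) (\<lambda>y. (\<lambda>(t, s, z). alexander (F s) t z) (fst y, snd y, z))"
      by (rule continuous_on_compose2[OF continuous_on_alexander[OF F homeo] j]) auto
    then show ?thesis by (simp add: case_prod_beta)
  qed
  have i: "inj (alexander (F s) t)" if "t \<in> {0..1}" "s \<in> {0..1}" for t s
    using inj_alexander homeo that by simp
  have "transport (\<lambda>_. triple_ratio p1 p2 p3) = id"
    using transport_const[OF triple_ratio_avoids] distinct by auto
  then show ?thesis
    using transport_family_square[of "\<lambda>t s. alexander (F s) t", OF c i] by (simp add: monodromy_def)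
qed

corollary monodromy_isotopy:
  fixes F :: "real \<Rightarrow> complex \<Rightarrow> complex"
  assumes "continuous_on ({0..1} \<times> UNIV) (\<lambda>(s, z). F s z)"
    and "\<And>s. s \<in> {0..1} \<Longrightarrow> plane_homeo (F s)"
    and "\<And>s p. s \<in> {0..1} \<Longrightarrow> p \<in> {p1, p2, p3} \<Longrightarrow> F s p = p"
  shows "monodromy (F 1) = monodromy (F 0)"
proof -
  have "transport (\<lambda>s. triple_ratio (F s p1) (F s p2) (F s p3)) = transport (\<lambda>_. triple_ratio p1 p2 p3)"
    by (rule transport_cong) (simp add: assms(3))
  also have "\<dots> = id" using transport_const[OF triple_ratio_avoids] distinct by auto
  finally show ?thesis using monodromy_family[OF assms(1,2)] by simp
qed

end

section \<open>Mapping classes of the disk\<close>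

definition extend_id :: "(complex \<Rightarrow> complex) \<Rightarrow> complex \<Rightarrow> complex"
  where "extend_id f z = (if z \<in> disk then f z else z)"

lemma disk_homeos_continuous_on: "f \<in> disk_homeos P \<Longrightarrow> continuous_on disk f"
  using disk_homeos_cont by auto

lemma disk_homeos_bij_betw: "f \<in> disk_homeos P \<Longrightarrow> bij_betw f disk disk"
  by (simp add: disk_homeos_def Bij_def)

lemma disk_homeos_fixes: "f \<in> disk_homeos P \<Longrightarrow> norm x = 1 \<or> x \<in> P \<Longrightarrow> f x = x"
  by (auto simp: disk_homeos_def)

lemma continuous_on_extend_id:
  assumes h: "continuous_on ({0..1} \<times> disk) h"
    and P: "\<And>s. s \<in> {0..1} \<Longrightarrow> (\<lambda>x. h (s, x)) \<in> disk_homeos P"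
  shows "continuous_on ({0..1::real} \<times> UNIV) (\<lambda>(s, z). extend_id (\<lambda>x. h (s, x)) z)"
proof -
  let ?E = "{z :: complex. 1 \<le> norm z}"
  have U: "{0..1::real} \<times> UNIV = ({0..1} \<times> disk) \<union> ({0..1} \<times> ?E)"
    by (auto simp: disk_def)
  have "continuous_on ({0..1::real} \<times> disk) (\<lambda>(s, z). extend_id (\<lambda>x. h (s, x)) z)"
    by (rule continuous_on_eq[OF h]) (auto simp: extend_id_def)
  moreover have "extend_id (\<lambda>x. h (s, x)) z = z" if "s \<in> {0..1}" "z \<in> ?E" for s z
    using disk_homeos_fixes[OF P[OF that(1)], of z] that(2) by (auto simp: extend_id_def disk_def)
  then have "continuous_on ({0..1::real} \<times> ?E) (\<lambda>(s, z). extend_id (\<lambda>x. h (s, x)) z)"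
    by (intro continuous_on_eq[OF continuous_on_snd[OF continuous_on_id]]) auto
  moreover have "closed ({0..1::real} \<times> disk)" "closed ({0..1::real} \<times> ?E)"
    by (auto intro!: closed_Times closed_Collect_le continuous_intros simp: disk_def)
  ultimately show ?thesis unfolding U by (intro continuous_on_closed_Un)
qed

lemma plane_homeo_extend_id:
  assumes f: "f \<in> disk_homeos P" shows "plane_homeo (extend_id f)"
  unfolding plane_homeo_def
proof (intro conjI allI impI)
  have j: "continuous_on ({0..1::real} \<times> disk) (\<lambda>y. f (snd y))"
    by (rule continuous_on_compose2[OF disk_homeos_continuous_on[OF f] continuous_on_snd[OF continuous_on_id]]) auto
  have "continuous_on ({0..1::real} \<times> UNIV) (\<lambda>(s, z). extend_id (\<lambda>x. f (snd (s, x))) z)"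
    by (rule continuous_on_extend_id[OF j]) (use f in simp)
  then have c: "continuous_on ({0..1::real} \<times> UNIV) (\<lambda>y. extend_id f (snd y))"
    by (simp add: case_prod_unfold)
  have "continuous_on UNIV (\<lambda>z. extend_id f (snd (0 :: real, z)))"
    by (rule continuous_on_compose2[OF c]) (auto intro: continuous_on_Pair continuous_on_const continuous_on_id)
  then show "continuous_on UNIV (extend_id f)" by simp
  show "inj (extend_id f)"
  proof (rule injI)
    fix x y assume "extend_id f x = extend_id f y"
    then show "x = y"
      using disk_homeos_bij_betw[OF f] unfolding extend_id_def bij_betw_def
      by (auto split: if_splits dest: inj_onD)
  qed
  show "extend_id f z = z" if "1 \<le> norm z" for z
    using that disk_homeos_fixes[OF f, of z] by (auto simp: extend_id_def disk_def)
  show "norm (extend_id f z) \<le> 1" if "norm z \<le> 1" for z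
    using that bij_betwE[OF disk_homeos_bij_betw[OF f]] by (simp add: extend_id_def disk_def)
qed

lemma extend_id_compose:
  assumes "g \<in> disk_homeos P" shows "extend_id (compose disk f g) = extend_id f \<circ> extend_id g"
  using bij_betwE[OF disk_homeos_bij_betw[OF assms]]
  by (auto simp: extend_id_def compose_def fun_eq_iff)

lemma extend_id_id: "extend_id (\<lambda>x\<in>disk. x) = (\<lambda>z. z)"
  by (auto simp: extend_id_def)

context marked_triple
begin

lemma monodromy_extend_mult:
  assumes "P \<subseteq> disk" "{p1, p2, p3} \<subseteq> P" "f \<in> disk_homeos P" "g \<in> disk_homeos P"
  shows "monodromy (extend_id (f \<otimes>\<^bsub>disk_homeo_group P\<^esub> g)) = monodromy (extend_id f) \<circ> monodromy (extend_id g)"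
proof -
  have "extend_id g p = p" if "p \<in> {p1, p2, p3}" for p
    using that assms disk_homeos_fixes[OF assms(4), of p] by (auto simp: extend_id_def)
  then show ?thesis
    using monodromy_compose[OF plane_homeo_extend_id[OF assms(3)] plane_homeo_extend_id[OF assms(4)]]
    by (simp add: disk_homeo_group_simps(3)[OF assms(3,4)] extend_id_compose[OF assms(4)])
qed

lemma monodromy_extend_isotopic:
  assumes P: "P \<subseteq> disk" "{p1, p2, p3} \<subseteq> P" and iso: "disk_isotopic P f g"
  shows "monodromy (extend_id f) = monodromy (extend_id g)"
proof -
  obtain h where h: "continuous_map (prod_topology (top_of_set {0..1::real}) (top_of_set disk)) (top_of_set disk) h"
    "\<And>x. h (0, x) = f x" "\<And>x. h (1, x) = g x"
    "\<And>t. t \<in> {0..1} \<Longrightarrow> (\<lambda>x. h (t, x)) \<in> disk_homeos P"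
    using iso unfolding disk_isotopic_def homotopic_with_def by blast
  have "continuous_on ({0..1} \<times> disk) h"
    using h(1) by (simp add: prod_topology_subtopology_eu)
  then have c: "continuous_on ({0..1::real} \<times> UNIV) (\<lambda>(s, z). extend_id (\<lambda>x. h (s, x)) z)"
    using h(4) by (rule continuous_on_extend_id)
  have "monodromy (extend_id (\<lambda>x. h (1, x))) = monodromy (extend_id (\<lambda>x. h (0, x)))"
  proof (rule monodromy_isotopy[OF c])
    fix s :: real assume s: "s \<in> {0..1}"
    show "plane_homeo (extend_id (\<lambda>x. h (s, x)))" by (rule plane_homeo_extend_id[OF h(4)[OF s]])
    fix p assume "p \<in> {p1, p2, p3}"
    then show "extend_id (\<lambda>x. h (s, x)) p = p"
      using P disk_homeos_fixes[OF h(4)[OF s], of p] by (auto simp: extend_id_def)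
  qed
  then show ?thesis by (simp add: h(2,3))
qed

end

section \<open>Twists of round annuli\<close>

definition ramp :: "real \<Rightarrow> real \<Rightarrow> real \<Rightarrow> real"
  where "ramp r R x = max 0 (min 1 ((R - x) / (R - r)))"

text \<open>
  For \<open>s = 1\<close> this is the Dehn twist of the annulus with centre \<open>c\<close> and radii \<open>r\<close> and \<open>R\<close>; the parameter
  \<open>s\<close> provides an isotopy to the identity that rotates the inner disk rigidly.
\<close>

definition twist :: "complex \<Rightarrow> real \<Rightarrow> real \<Rightarrow> real \<Rightarrow> complex \<Rightarrow> complex"
  where "twist c r R s z = c + (z - c) * cis (2 * pi * s * ramp r R (norm (z - c)))"

lemma norm_twist: "norm (twist c r R s z - c) = norm (z - c)"
  by (simp add: twist_def norm_mult)

lemma twist_inner: "r < R \<Longrightarrow> norm (z - c) \<le> r \<Longrightarrow> twist c r R s z = c + (z - c) * cis (2 * pi * s)"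
  by (simp add: twist_def ramp_def min_def max_def divide_simps)

lemma twist_outer: "r < R \<Longrightarrow> R \<le> norm (z - c) \<Longrightarrow> twist c r R s z = z"
  by (simp add: twist_def ramp_def min_def max_def divide_simps)

lemma twist_0: "twist c r R 0 z = z"
  by (simp add: twist_def)

lemma twist_twist: "twist c r R s (twist c r R t z) = twist c r R (s + t) z"
proof -
  have "twist c r R s (twist c r R t z) =
      c + (twist c r R t z - c) * cis (2 * pi * s * ramp r R (norm (z - c)))"
    by (subst twist_def) (simp add: norm_twist)
  also have "\<dots> = c + (z - c) * (cis (2 * pi * t * ramp r R (norm (z - c))) * cis (2 * pi * s * ramp r R (norm (z - c))))"
    by (simp add: twist_def mult.assoc)
  also have "\<dots> = twist c r R (s + t) z"
    unfolding cis_mult by (simp add: twist_def algebra_simps)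
  finally show ?thesis .
qed

lemma continuous_on_twist: "continuous_on UNIV (\<lambda>(s, z). twist c r R s z)"
proof -
  have "continuous_on UNIV (\<lambda>x. max 0 (min 1 ((R - x) / (R - r))))"
  proof (cases "R = r")
    case False
    then show ?thesis by (intro continuous_intros) auto
  qed auto
  then have ramp: "continuous_on UNIV (ramp r R)" by (simp add: ramp_def[abs_def])
  have n: "continuous_on UNIV (\<lambda>y :: real \<times> complex. norm (snd y - c))" by (intro continuous_intros)
  have "continuous_on UNIV (\<lambda>y :: real \<times> complex. ramp r R (norm (snd y - c)))"
    by (rule continuous_on_compose2[OF ramp n]) auto
  then have "continuous_on UNIV (\<lambda>y :: real \<times> complex. twist c r R (fst y) (snd y))"
    unfolding twist_def cis_conv_exp by (intro continuous_intros)
  then show ?thesis by (simp only: case_prod_unfold)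
qed

lemma plane_homeo_twist:
  assumes "r < R" "norm c + R \<le> 1" shows "plane_homeo (twist c r R s)"
  unfolding plane_homeo_def
proof (intro conjI allI impI)
  have "continuous_on UNIV (\<lambda>z. (\<lambda>(s, z). twist c r R s z) (s, z))"
    by (rule continuous_on_compose2[OF continuous_on_twist]) (auto intro: continuous_on_Pair continuous_on_const continuous_on_id)
  then show "continuous_on UNIV (twist c r R s)" by simp
  show "inj (twist c r R s)"
    by (rule inj_on_inverseI[of _ "twist c r R (- s)"]) (simp add: twist_twist twist_0)
  fix z :: complex
  show "twist c r R s z = z" if "1 \<le> norm z"
    using that assms norm_triangle_ineq2[of z c] by (intro twist_outer) auto
  show "norm (twist c r R s z) \<le> 1" if "norm z \<le> 1"
  proof (cases "R \<le> norm (z - c)")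
    case True
    then show ?thesis using that assms by (simp add: twist_outer)
  next
    case False
    have "norm (twist c r R s z) \<le> norm c + norm (twist c r R s z - c)"
      using norm_triangle_sub by blast
    then show ?thesis using False assms by (simp add: norm_twist)
  qed
qed

definition disk_twist :: "complex \<Rightarrow> real \<Rightarrow> real \<Rightarrow> complex \<Rightarrow> complex"
  where "disk_twist c r R = restrict (twist c r R 1) disk"

lemma extend_disk_twist:
  assumes "r < R" "norm c + R \<le> 1" shows "extend_id (disk_twist c r R) = twist c r R 1"
proof
  fix z
  show "extend_id (disk_twist c r R) z = twist c r R 1 z"
    using plane_homeo_twist[OF assms, of 1]
    by (auto simp: extend_id_def disk_twist_def disk_def plane_homeo_def)
qed

lemma disk_twist_homeo:
  assumes rR: "r < R" "norm c + R \<le> 1"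
    and P: "\<And>p. p \<in> P \<Longrightarrow> norm (p - c) \<le> r \<or> R \<le> norm (p - c)" and Pd: "P \<subseteq> disk"
  shows "disk_twist c r R \<in> disk_homeos P"
proof -
  have pres: "twist c r R s z \<in> disk" if "z \<in> disk" for s z
    using plane_homeo_twist[OF rR, of s] that by (auto simp: plane_homeo_def disk_def)
  have cont: "continuous_on disk (twist c r R s)" for s
    using plane_homeo_twist[OF rR, of s] by (auto simp: plane_homeo_def intro: continuous_on_subset)
  have "homeomorphic_maps (top_of_set disk) (top_of_set disk) (twist c r R 1) (twist c r R (-1))"
    unfolding homeomorphic_maps_def using pres cont by (auto simp: twist_twist twist_0)
  then have hom: "homeomorphic_map (top_of_set disk) (top_of_set disk) (twist c r R 1)"
    using homeomorphic_map_maps by blast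
  have "homeomorphic_map (top_of_set disk) (top_of_set disk) (disk_twist c r R)"
    by (rule homeomorphic_map_eq[OF hom]) (simp add: disk_twist_def)
  moreover have "disk_twist c r R \<in> Bij disk"
  proof -
    have "bij_betw (twist c r R 1) disk disk"
      by (rule bij_betw_byWitness[of _ "twist c r R (-1)"]) (auto simp: pres twist_twist twist_0)
    then have "bij_betw (disk_twist c r R) disk disk"
      by (simp add: disk_twist_def cong: bij_betw_cong)
    then show ?thesis by (simp add: Bij_def disk_twist_def)
  qed
  moreover have "disk_twist c r R x = x" if "norm x = 1" for x
    using plane_homeo_twist[OF rR, of 1] that by (auto simp: plane_homeo_def disk_twist_def disk_def)
  moreover have "disk_twist c r R p = p" if p: "p \<in> P" for p
    using P[OF p] p Pd by (auto simp: disk_twist_def twist_inner[OF rR(1)] twist_outer[OF rR(1)])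
  ultimately show ?thesis by (simp add: disk_homeos_def)
qed

text \<open>
  The disks are disjoint or one of them lies inside the inner disk of the other annulus. In each
  case the two annuli are disjoint, and a twist maps its annulus to itself and moves no other point.
\<close>

lemma disk_twist_commute:
  assumes rR: "r < R" "norm c + R \<le> 1" "r' < R'" "norm c' + R' \<le> 1"
    and sep: "R + R' \<le> norm (c - c') \<or> norm (c - c') + R' \<le> r \<or> norm (c - c') + R \<le> r'"
  shows "compose disk (disk_twist c r R) (disk_twist c' r' R') = compose disk (disk_twist c' r' R') (disk_twist c r R)"
proof
  fix z
  let ?f = "twist c r R 1" and ?g = "twist c' r' R' 1"
  have pres: "?f z \<in> disk" "?g z \<in> disk" if "z \<in> disk"
    using plane_homeo_twist[OF rR(1,2), of 1] plane_homeo_twist[OF rR(3,4), of 1] that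
    by (auto simp: plane_homeo_def disk_def)
  have out: "?f w = w" if "norm (w - c) \<le> r \<or> R \<le> norm (w - c)" for w
    using that rR(1) by (auto simp: twist_inner twist_outer)
  have out': "?g w = w" if "norm (w - c') \<le> r' \<or> R' \<le> norm (w - c')" for w
    using that rR(3) by (auto simp: twist_inner twist_outer)
  have ex: "(norm (w - c) \<le> r \<or> R \<le> norm (w - c)) \<or> (norm (w - c') \<le> r' \<or> R' \<le> norm (w - c'))" for w
    using sep norm_triangle_ineq4[of "w - c'" "w - c"] norm_triangle_ineq[of "w - c" "c - c'"]
      norm_triangle_ineq4[of "w - c'" "c - c'"]
    by (auto simp: norm_minus_commute)
  have "?f (?g z) = ?g (?f z)"
  proof (cases "norm (z - c) \<le> r \<or> R \<le> norm (z - c)")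
    case True
    have "?f (?g z) = ?g z"
    proof (cases "norm (z - c') \<le> r' \<or> R' \<le> norm (z - c')")
      case True
      then show ?thesis using out[OF \<open>norm (z - c) \<le> r \<or> _\<close>] out'[OF True] by simp
    next
      case False
      then show ?thesis using ex[of "?g z"] by (intro out) (simp add: norm_twist)
    qed
    then show ?thesis using out[OF True] by simp
  next
    case False
    then have z: "?g z = z" using ex[of z] by (intro out') simp
    have "?g (?f z) = ?f z" using False ex[of "?f z"] by (intro out') (simp add: norm_twist)
    then show ?thesis using z by simp
  qed
  then show "compose disk (disk_twist c r R) (disk_twist c' r' R') z = compose disk (disk_twist c' r' R') (disk_twist c r R) z"
    using pres by (simp add: compose_def disk_twist_def)
qed

lemma moebius_circle:
  assumes "0 < h" "h < D"
  defines "N x \<equiv> (D + h * cos x)\<^sup>2 + (h * sin x)\<^sup>2"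
  shows "N x > 0"
    and "Re (of_real (2 * h) * cis x / (of_real D + of_real h * cis x)) = 2 * h * (D * cos x + h) / N x"
    and "Im (of_real (2 * h) * cis x / (of_real D + of_real h * cis x)) = 2 * h * D * sin x / N x"
proof -
  have "h * cos x \<ge> - h" using mult_left_mono[OF cos_ge_minus_one, of h x] assms(1) by simp
  then have "D + h * cos x > 0" using assms(2) by linarith
  then show "N x > 0" by (simp add: N_def add_pos_nonneg)
  have "2 * h * a * (D + h * a) + 2 * h * b * (h * b) = 2 * h * (D * a + h * (a\<^sup>2 + b\<^sup>2))" for a b
    by (simp add: power2_eq_square algebra_simps)
  from this[of "cos x" "sin x"] have num: "2 * h * cos x * (D + h * cos x) + 2 * h * sin x * (h * sin x) = 2 * h * (D * cos x + h)"
    by simp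
  show "Re (of_real (2 * h) * cis x / (of_real D + of_real h * cis x)) = 2 * h * (D * cos x + h) / N x"
    unfolding N_def Re_divide by (simp add: num)
  show "Im (of_real (2 * h) * cis x / (of_real D + of_real h * cis x)) = 2 * h * D * sin x / N x"
    by (simp add: Im_divide N_def algebra_simps)
qed

text \<open>
  The ratio of three points during the twist that turns the points \<open>c - h\<close> and \<open>c + h\<close> about their midpoint, while the third point
  stays at \<open>c + D\<close>. If instead the resting point is \<open>c - D\<close> and comes first, the ratio is \<open>1\<close>
  minus this one. The lemmas below locate this loop relative to the two cuts: it encircles \<open>0\<close> once
  counterclockwise.
\<close>

definition collision_path :: "real \<Rightarrow> real \<Rightarrow> real \<Rightarrow> complex"
  where "collision_path h D t = of_real (2 * h) * cis (2 * pi * t) / (of_real D + of_real h * cis (2 * pi * t))"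

lemma collision_path_denominator:
  assumes "0 < h" "h < D" shows "of_real D + of_real h * cis x \<noteq> 0"
proof
  assume "of_real D + of_real h * cis x = 0"
  then have "D + h * cos x = 0" "h * sin x = 0" by (simp_all add: complex_eq_iff)
  then show False using moebius_circle(1)[OF assms, of x] by simp
qed

lemma continuous_on_collision_path:
  "0 < h \<Longrightarrow> h < D \<Longrightarrow> continuous_on S (collision_path h D)"
  unfolding collision_path_def[abs_def] using collision_path_denominator[of h D]
  by (intro continuous_on_divide continuous_on_mult continuous_on_add continuous_on_const ballI
      continuous_on_cis continuous_on_id) auto

lemma collision_path_positions:
  assumes "0 < h" "h < D"
  shows "Re (collision_path h D (1/2)) < 0"
    and "0 < Re (collision_path h D 0)" "Re (collision_path h D 0) < 1"
    and "collision_path h D 1 = collision_path h D 0"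
    and "0 < t \<Longrightarrow> t < 1/2 \<Longrightarrow> Im (collision_path h D t) > 0"
    and "1/2 < t \<Longrightarrow> t < 1 \<Longrightarrow> Im (collision_path h D t) < 0"
proof -
  note N = moebius_circle(1)[OF assms]
  have im: "Im (collision_path h D t) = 2 * h * D * sin (2 * pi * t) / ((D + h * cos (2 * pi * t))\<^sup>2 + (h * sin (2 * pi * t))\<^sup>2)" for t
    unfolding collision_path_def by (rule moebius_circle(3)[OF assms])
  have re: "Re (collision_path h D t) = 2 * h * (D * cos (2 * pi * t) + h) / ((D + h * cos (2 * pi * t))\<^sup>2 + (h * sin (2 * pi * t))\<^sup>2)" for t
    unfolding collision_path_def by (rule moebius_circle(2)[OF assms])
  have "D - h > 0" using assms by simp
  then show "Re (collision_path h D (1/2)) < 0"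
    unfolding re using assms by (simp add: divide_neg_pos mult_pos_neg)
  have "Re (collision_path h D 0) = 2 * h / (D + h)"
    unfolding re using assms by (simp add: power2_eq_square)
  then show "0 < Re (collision_path h D 0)" "Re (collision_path h D 0) < 1" using assms by simp_all
  show "collision_path h D 1 = collision_path h D 0" by (simp add: collision_path_def)
  show "Im (collision_path h D t) > 0" if "0 < t" "t < 1/2"
  proof -
    have "sin (2 * pi * t) > 0" using that by (intro sin_gt_zero) auto
    then show ?thesis unfolding im using N assms by simp
  qed
  show "Im (collision_path h D t) < 0" if "1/2 < t" "t < 1"
  proof -
    have "sin (2 * pi * t) < 0" using that by (intro sin_lt_zero) auto
    then show ?thesis unfolding im using N assms by (simp add: divide_neg_pos mult_pos_neg)
  qed
qed

lemma collision_path_cuts: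
  assumes "0 < h" "h < D"
  shows "0 \<le> t \<Longrightarrow> t \<le> 1/2 \<Longrightarrow> collision_path h D t \<in> upper_cut \<and> 1 - collision_path h D t \<in> lower_cut"
    and "1/2 \<le> t \<Longrightarrow> t \<le> 1 \<Longrightarrow> collision_path h D t \<in> lower_cut \<and> 1 - collision_path h D t \<in> upper_cut"
proof -
  note pos = collision_path_positions[OF assms]
  have real_axis: "z \<in> upper_cut \<and> 1 - z \<in> lower_cut \<and> z \<in> lower_cut \<and> 1 - z \<in> upper_cut"
    if "Re z \<noteq> 0" "Re z \<noteq> 1" for z
    using that by (simp add: upper_cut_def lower_cut_def)
  have ends: "Re (collision_path h D s) \<noteq> 0" "Re (collision_path h D s) \<noteq> 1" if "s = 0 \<or> s = 1/2 \<or> s = 1" for s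
  proof -
    have "Re (collision_path h D s) \<noteq> 0 \<and> Re (collision_path h D s) \<noteq> 1"
      using that
    proof (elim disjE)
      assume s: "s = 0"
      show ?thesis unfolding s using pos(2,3) by linarith
    next
      assume s: "s = 1/2"
      show ?thesis unfolding s using pos(1) by linarith
    next
      assume s: "s = 1"
      show ?thesis unfolding s pos(4) using pos(2,3) by linarith
    qed
    then show "Re (collision_path h D s) \<noteq> 0" "Re (collision_path h D s) \<noteq> 1" by blast+
  qed
  show "collision_path h D t \<in> upper_cut \<and> 1 - collision_path h D t \<in> lower_cut" if "0 \<le> t" "t \<le> 1/2"
  proof (cases "t = 0 \<or> t = 1/2")
    case True
    then show ?thesis using real_axis[OF ends, of t] by blast
  next
    case False
    then have "Im (collision_path h D t) > 0" using that by (intro pos(5)) auto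
    then show ?thesis by (simp add: upper_cut_def lower_cut_def)
  qed
  show "collision_path h D t \<in> lower_cut \<and> 1 - collision_path h D t \<in> upper_cut" if "1/2 \<le> t" "t \<le> 1"
  proof (cases "t = 1 \<or> t = 1/2")
    case True
    then show ?thesis using real_axis[OF ends, of t] by blast
  next
    case False
    then have "Im (collision_path h D t) < 0" using that by (intro pos(6)) auto
    then show ?thesis by (simp add: upper_cut_def lower_cut_def)
  qed
qed

context marked_triple
begin

lemma monodromy_twist:
  assumes "r < R" "norm c + R \<le> 1"
  shows "monodromy (extend_id (disk_twist c r R)) =
    transport (\<lambda>s. triple_ratio (twist c r R s p1) (twist c r R s p2) (twist c r R s p3))"
proof -
  have c: "continuous_on ({0..1} \<times> UNIV) (\<lambda>(s, z). twist c r R s z)"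
    using continuous_on_twist by (rule continuous_on_subset) simp
  have "twist c r R 0 = (\<lambda>z. z)" by (simp add: twist_0 fun_eq_iff)
  then show ?thesis
    using monodromy_family[OF c plane_homeo_twist[OF assms]] by (simp add: extend_disk_twist[OF assms])
qed

lemma monodromy_twist_first_pair:
  assumes "0 < h" "h \<le> r" "r < R" "R \<le> D" "norm c + R \<le> 1"
    and p: "p1 = c - of_real h" "p2 = c + of_real h" "p3 = c + of_real D"
  shows "monodromy (extend_id (disk_twist c r R)) = \<alpha>"
proof -
  have hD: "h < D" using assms by simp
  note pos = collision_path_positions[OF assms(1) hD]
  have eq: "triple_ratio (twist c r R s p1) (twist c r R s p2) (twist c r R s p3) = collision_path h D s" for s
    using assms(1-4) by (simp add: p twist_inner twist_outer triple_ratio_def collision_path_def)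
  have "transport (collision_path h D) x = \<alpha> x" for x
  proof (rule transport_around_0)
    show "collision_path h D t \<in> upper_cut" if "0 \<le> t" "t \<le> 1/2" for t
      using collision_path_cuts(1)[OF assms(1) hD that] by blast
    show "collision_path h D t \<in> lower_cut" if "1/2 \<le> t" "t \<le> 1" for t
      using collision_path_cuts(2)[OF assms(1) hD that] by blast
  qed (use continuous_on_collision_path[OF assms(1) hD] pos in simp_all)
  then show ?thesis using monodromy_twist[OF assms(3,5)] by (simp add: eq fun_eq_iff)
qed

lemma monodromy_twist_last_pair:
  assumes "0 < h" "h \<le> r" "r < R" "R \<le> D" "norm c + R \<le> 1"
    and p: "p1 = c - of_real D" "p2 = c - of_real h" "p3 = c + of_real h"
  shows "\<beta> \<circ> monodromy (extend_id (disk_twist c r R)) = id"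
proof -
  have hD: "h < D" using assms by simp
  note pos = collision_path_positions[OF assms(1) hD]
  have eq: "triple_ratio (twist c r R s p1) (twist c r R s p2) (twist c r R s p3) = 1 - collision_path h D s" for s
    using assms(1-4) collision_path_denominator[OF assms(1) hD, of "2 * pi * s"]
    by (simp add: p twist_inner twist_outer triple_ratio_def collision_path_def field_simps)
  have "\<beta> (transport (\<lambda>s. 1 - collision_path h D s) x) = x" for x
  proof (rule transport_around_1)
    show "1 - collision_path h D t \<in> lower_cut" if "0 \<le> t" "t \<le> 1/2" for t
      using collision_path_cuts(1)[OF assms(1) hD that] by blast
    show "1 - collision_path h D t \<in> upper_cut" if "1/2 \<le> t" "t \<le> 1" for t
      using collision_path_cuts(2)[OF assms(1) hD that] by blast
    show "continuous_on {0..1} (\<lambda>s. 1 - collision_path h D s)"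
      by (intro continuous_on_diff continuous_on_const continuous_on_collision_path[OF assms(1) hD])
  qed (use pos in simp_all)
  then show ?thesis using monodromy_twist[OF assms(3,5)] by (simp add: eq fun_eq_iff)
qed

end

section \<open>A non-solvable group of permutations\<close>

definition cyc :: "nat \<Rightarrow> nat \<Rightarrow> nat \<Rightarrow> nat \<Rightarrow> nat"
  where "cyc i j k n = (if n = i then j else if n = j then k else if n = k then i else n)"

lemma cyc_inverse: "cyc 0 2 1 \<circ> cyc 0 1 2 = id" "cyc 0 1 2 \<circ> cyc 0 2 1 = id"
  "cyc 2 4 3 \<circ> cyc 2 3 4 = id" "cyc 2 3 4 \<circ> cyc 2 4 3 = id"
  by (simp_all add: fun_eq_iff cyc_def)

lemma eq_on_five:
  fixes f g :: "nat \<Rightarrow> nat"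
  assumes "f 0 = g 0" "f 1 = g 1" "f 2 = g 2" "f 3 = g 3" "f 4 = g 4"
    and "\<And>n. n > 4 \<Longrightarrow> f n = g n"
  shows "f = g"
proof
  fix n :: nat
  have "n = 0 \<or> n = 1 \<or> n = 2 \<or> n = 3 \<or> n = 4 \<or> n > 4" by linarith
  then show "f n = g n" using assms by (elim disjE) simp_all
qed

text \<open>
  The 3-cycles \<open>A\<close> and \<open>B\<close> share one letter, so their commutator is again a 3-cycle, and in the alternating
  group on five letters all 3-cycles are conjugate. The conjugating elements are written as words in
  \<open>A\<close> and \<open>B\<close>, so that they lift to any group with elements that are sent to \<open>A\<close> and \<open>B\<close>.
\<close>

lemma cyc_commutator_conjugates:
  defines "A \<equiv> cyc 0 1 2" and "A' \<equiv> cyc 0 2 1" and "B \<equiv> cyc 2 3 4" and "B' \<equiv> cyc 2 4 3"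
  shows "(B' \<circ> A) \<circ> (A \<circ> B \<circ> A' \<circ> B') \<circ> (A' \<circ> B) = A"
    and "(A \<circ> B \<circ> A') \<circ> (A \<circ> B \<circ> A' \<circ> B') \<circ> (A \<circ> B' \<circ> A') = B"
  unfolding assms by (rule eq_on_five; simp add: cyc_def)+

text \<open>
  If \<open>x\<close> and \<open>y\<close> in some derived group of \<open>H\<close> are sent to the two 3-cycles, then their commutator is in the
  next one, and so are its conjugates by elements of \<open>H\<close>; by the preceding lemma suitable conjugates are
  sent to the same 3-cycles again.
\<close>

lemma (in group) derived_power_hits_cycles:
  fixes \<rho> :: "'a \<Rightarrow> nat \<Rightarrow> nat"
  assumes H: "subgroup H G" and ab: "a \<in> H" "b \<in> H"
    and mult: "\<And>x y. x \<in> carrier G \<Longrightarrow> y \<in> carrier G \<Longrightarrow> \<rho> (x \<otimes> y) = \<rho> x \<circ> \<rho> y" and one: "\<rho> \<one> = id"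
    and \<rho>a: "\<rho> a = cyc 0 1 2" and \<rho>b: "\<rho> b = cyc 2 3 4"
  shows "\<exists>x\<in>(derived G ^^ k) H. \<exists>y\<in>(derived G ^^ k) H. \<rho> x = cyc 0 1 2 \<and> \<rho> y = cyc 2 3 4"
proof (induction k)
  case 0
  then show ?case using ab \<rho>a \<rho>b by auto
next
  case (Suc k)
  note Hc = subgroup.mem_carrier[OF H]
  have inv_\<rho>: "\<rho> (inv x) = f'" if x: "x \<in> carrier G" and f: "\<rho> x \<circ> f' = id" for x f'
  proof -
    have "\<rho> (inv x) \<circ> \<rho> x = id" using mult[of "inv x" x] x one by simp
    then have "(\<rho> (inv x) \<circ> \<rho> x) \<circ> f' = f'" by simp
    then show ?thesis using f by (simp add: comp_assoc)
  qed
  obtain x y where xy: "x \<in> (derived G ^^ k) H" "y \<in> (derived G ^^ k) H"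
    and \<rho>xy: "\<rho> x = cyc 0 1 2" "\<rho> y = cyc 2 3 4" using Suc.IH by blast
  have xyc: "x \<in> carrier G" "y \<in> carrier G"
    using xy exp_of_derived_in_carrier[OF subgroup.subset[OF H]] by blast+
  have abc: "a \<in> carrier G" "b \<in> carrier G" using ab Hc by blast+
  define z where "z = x \<otimes> y \<otimes> inv x \<otimes> inv y"
  have z: "z \<in> (derived G ^^ Suc k) H"
    using xy by (auto simp: z_def derived_def intro!: generate.incl)
  have zc: "z \<in> carrier G" using xyc by (simp add: z_def)
  have "\<rho> (inv x) = cyc 0 2 1" "\<rho> (inv y) = cyc 2 4 3"
    by (rule inv_\<rho>[OF xyc(1)] inv_\<rho>[OF xyc(2)], simp only: \<rho>xy cyc_inverse)+
  then have \<rho>z: "\<rho> z = cyc 0 1 2 \<circ> cyc 2 3 4 \<circ> cyc 0 2 1 \<circ> cyc 2 4 3"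
    using xyc by (simp add: z_def mult \<rho>xy)
  interpret N: normal "(derived G ^^ Suc k) H" "G\<lparr>carrier := H\<rparr>"
    by (rule derived_power_normal[OF H])
  have conj: "w \<otimes> z \<otimes> inv w \<in> (derived G ^^ Suc k) H" if "w \<in> H" for w
    using N.inv_op_closed2[of w z] that z m_inv_consistent[OF H that] by simp
  have \<rho>ab': "\<rho> (inv a) = cyc 0 2 1" "\<rho> (inv b) = cyc 2 4 3"
    by (rule inv_\<rho>[OF abc(1)] inv_\<rho>[OF abc(2)], simp only: \<rho>a \<rho>b cyc_inverse)+
  define u where "u = inv b \<otimes> a"
  define v where "v = a \<otimes> b \<otimes> inv a"
  have uv: "u \<in> H" "v \<in> H"
    using ab subgroup.m_closed[OF H] subgroup.m_inv_closed[OF H] by (simp_all add: u_def v_def)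
  have "\<rho> (u \<otimes> z \<otimes> inv u) = cyc 0 1 2"
  proof -
    have "inv u = inv a \<otimes> b" using abc by (simp add: u_def inv_mult_group)
    then have "\<rho> (u \<otimes> z \<otimes> inv u) = (cyc 2 4 3 \<circ> cyc 0 1 2) \<circ> \<rho> z \<circ> (cyc 0 2 1 \<circ> cyc 2 3 4)"
      using abc zc by (simp add: u_def mult \<rho>ab' \<rho>a \<rho>b)
    then show ?thesis by (simp only: \<rho>z cyc_commutator_conjugates(1))
  qed
  moreover have "\<rho> (v \<otimes> z \<otimes> inv v) = cyc 2 3 4"
  proof -
    have "inv v = a \<otimes> inv b \<otimes> inv a" using abc by (simp add: v_def inv_mult_group m_assoc)
    then have "\<rho> (v \<otimes> z \<otimes> inv v) = (cyc 0 1 2 \<circ> cyc 2 3 4 \<circ> cyc 0 2 1) \<circ> \<rho> z \<circ> (cyc 0 1 2 \<circ> cyc 2 4 3 \<circ> cyc 0 2 1)"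
      using abc zc by (simp add: v_def mult \<rho>ab' \<rho>a \<rho>b)
    then show ?thesis by (simp only: \<rho>z cyc_commutator_conjugates(2))
  qed
  ultimately show ?case using conj[OF uv(1)] conj[OF uv(2)] by blast
qed

section \<open>Commuting twists around marked points\<close>

definition gap :: "nat \<Rightarrow> real" where "gap n = 2 / real (n + 1)"

definition position :: "nat \<Rightarrow> nat \<Rightarrow> real"
  where "position n k = gap n * real k - 1"

text \<open>
  Strictly increasing in \<open>k\<close> and at most the distance of neighbouring marked points for \<open>k \<le> n\<close>. Using
  different margins for different \<open>k\<close> keeps apart circles that enclose the same leftmost point.
\<close>

definition margin :: "nat \<Rightarrow> nat \<Rightarrow> real" where "margin n k = gap n * (real k / real (n + 1))"

text \<open>
  The outer twist number \<open>i\<close> turns about the midpoint of the marked points \<open>1\<close> and \<open>2 * i\<close>, and the radius below is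
  half their distance. Its annulus separates the marked points \<open>1, \<dots>, 2 * i\<close> from the others. The
  inner twist number \<open>i\<close> turns about the midpoint of the marked points \<open>2 * i\<close> and
  \<open>2 * i + 1\<close>, and its annulus separates these two from the others.
\<close>

definition outer_center :: "nat \<Rightarrow> nat \<Rightarrow> real"
  where "outer_center n i = gap n * real i + gap n / 2 - 1"

definition outer_radius :: "nat \<Rightarrow> nat \<Rightarrow> real"
  where "outer_radius n i = gap n * real i - gap n / 2"

definition outer_twist :: "nat \<Rightarrow> nat \<Rightarrow> complex \<Rightarrow> complex"
  where "outer_twist n i = disk_twist (of_real (outer_center n i))
    (outer_radius n i + margin n (2 * i)) (outer_radius n i + margin n (2 * i + 1))"

definition inner_center :: "nat \<Rightarrow> nat \<Rightarrow> real"
  where "inner_center n i = 2 * (gap n * real i) + gap n / 2 - 1"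

definition inner_twist :: "nat \<Rightarrow> nat \<Rightarrow> complex \<Rightarrow> complex"
  where "inner_twist n i = disk_twist (of_real (inner_center n i)) (5 / 8 * gap n) (3 / 4 * gap n)"

lemma gap_pos: "gap n > 0" by (simp add: gap_def)

lemma gap_mult_le: "k \<le> n + 1 \<Longrightarrow> gap n * real k \<le> 2"
  by (simp add: gap_def divide_simps)

lemma gap_mult_mono: "k \<le> l \<Longrightarrow> gap n * real k \<le> gap n * real l"
  using gap_pos by (intro mult_left_mono) (auto intro: less_imp_le)

lemma margin_mono: "k \<le> l \<Longrightarrow> margin n k \<le> margin n l"
  unfolding margin_def using gap_pos by (intro mult_left_mono divide_right_mono) (auto intro: less_imp_le)

lemma margin_strict_mono: "k < l \<Longrightarrow> margin n k < margin n l"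
  unfolding margin_def using gap_pos by (intro mult_strict_left_mono divide_strict_right_mono) auto

lemma margin_nonneg: "margin n k \<ge> 0"
  unfolding margin_def using less_imp_le[OF gap_pos] by simp

lemma margin_le: "k \<le> n \<Longrightarrow> margin n k \<le> gap n"
  unfolding margin_def using mult_left_mono[of "real k / real (n + 1)" 1 "gap n"] less_imp_le[OF gap_pos] by simp

lemma marked_points_eq: "marked_points n = (\<lambda>k. of_real (position n k)) ` {1..n}"
  by (simp add: marked_points_def position_def gap_def)

lemma norm_of_real_diff_eq: "norm (of_real a - of_real b :: complex) = \<bar>a - b\<bar>"
  by (metis norm_of_real of_real_diff)

lemma marked_points_subset_disk: "marked_points n \<subseteq> disk"
  using marked_points_in_interior[of n] ball_subset_cball by (auto simp: disk_def)

lemma outer_annulus: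
  assumes "1 \<le> i" "2 * i + 1 \<le> n"
  shows "outer_radius n i + margin n (2 * i) < outer_radius n i + margin n (2 * i + 1)"
    and "norm (of_real (outer_center n i) :: complex) + (outer_radius n i + margin n (2 * i + 1)) \<le> 1"
proof -
  show "outer_radius n i + margin n (2 * i) < outer_radius n i + margin n (2 * i + 1)"
    using margin_strict_mono[of "2 * i" "2 * i + 1"] by simp
  have "2 * (gap n * real i) + gap n \<le> 2"
    using gap_mult_le[of "2 * i + 1" n] assms by (simp add: algebra_simps)
  moreover have "margin n (2 * i + 1) \<le> gap n" using margin_le assms by blast
  ultimately show "norm (of_real (outer_center n i) :: complex) + (outer_radius n i + margin n (2 * i + 1)) \<le> 1"
    unfolding norm_of_real outer_center_def outer_radius_def by linarith
qed

lemma outer_points: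
  assumes "1 \<le> i" "2 * i + 1 \<le> n" "1 \<le> k"
  shows "k \<le> 2 * i \<Longrightarrow> \<bar>position n k - outer_center n i\<bar> \<le> outer_radius n i"
    and "2 * i + 1 \<le> k \<Longrightarrow> outer_radius n i + gap n \<le> \<bar>position n k - outer_center n i\<bar>"
proof -
  have 1: "gap n \<le> gap n * real k" using gap_mult_mono[of 1 k n] assms by simp
  show "\<bar>position n k - outer_center n i\<bar> \<le> outer_radius n i" if "k \<le> 2 * i"
  proof -
    have "gap n * real k \<le> 2 * (gap n * real i)" using gap_mult_mono[OF that, of n] by simp
    then show ?thesis using 1 unfolding position_def outer_center_def outer_radius_def by linarith
  qed
  show "outer_radius n i + gap n \<le> \<bar>position n k - outer_center n i\<bar>" if "2 * i + 1 \<le> k"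
  proof -
    have "2 * (gap n * real i) + gap n \<le> gap n * real k"
      using gap_mult_mono[OF that, of n] by (simp add: algebra_simps)
    then show ?thesis unfolding position_def outer_center_def outer_radius_def by linarith
  qed
qed

lemma inner_annulus:
  assumes "1 \<le> i" "2 * i + 1 \<le> n"
  shows "5 / 8 * gap n < 3 / 4 * gap n"
    and "norm (of_real (inner_center n i) :: complex) + 3 / 4 * gap n \<le> 1"
proof -
  show "5 / 8 * gap n < 3 / 4 * gap n" using gap_pos[of n] by simp
  have "2 * (gap n * real i) + 2 * gap n \<le> 2"
    using gap_mult_le[of "2 * i + 2" n] assms by (simp add: algebra_simps)
  moreover have "gap n \<le> gap n * real i" using gap_mult_mono[of 1 i n] assms by simp
  ultimately show "norm (of_real (inner_center n i) :: complex) + 3 / 4 * gap n \<le> 1"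
    unfolding norm_of_real inner_center_def using gap_pos[of n] by linarith
qed

lemma inner_points:
  assumes "k \<noteq> 2 * i" "k \<noteq> 2 * i + 1"
  shows "3 / 2 * gap n \<le> \<bar>position n k - inner_center n i\<bar>"
proof -
  have "k + 1 \<le> 2 * i \<or> 2 * i + 2 \<le> k" using assms by linarith
  then show ?thesis
  proof
    assume "k + 1 \<le> 2 * i"
    then have "gap n * real k + gap n \<le> 2 * (gap n * real i)"
      using gap_mult_mono[of "k + 1" "2 * i" n] by (simp add: algebra_simps)
    then show ?thesis unfolding position_def inner_center_def by linarith
  next
    assume "2 * i + 2 \<le> k"
    then have "2 * (gap n * real i) + 2 * gap n \<le> gap n * real k"
      using gap_mult_mono[of "2 * i + 2" k n] by (simp add: algebra_simps)
    then show ?thesis unfolding position_def inner_center_def by linarith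
  qed
qed

lemma twists_in_disk_homeos:
  assumes i: "1 \<le> i" "2 * i + 1 \<le> n"
  shows "outer_twist n i \<in> disk_homeos (marked_points n)" "inner_twist n i \<in> disk_homeos (marked_points n)"
proof -
  show "outer_twist n i \<in> disk_homeos (marked_points n)"
    unfolding outer_twist_def
  proof (rule disk_twist_homeo[OF outer_annulus[OF i] _ marked_points_subset_disk])
    fix p assume "p \<in> marked_points n"
    then obtain k where k: "1 \<le> k" "p = of_real (position n k)" by (auto simp: marked_points_eq)
    have "k \<le> 2 * i \<or> 2 * i + 1 \<le> k" by linarith
    then show "norm (p - of_real (outer_center n i)) \<le> outer_radius n i + margin n (2 * i)
      \<or> outer_radius n i + margin n (2 * i + 1) \<le> norm (p - of_real (outer_center n i))"
      using outer_points[OF i k(1)] margin_le[OF i(2)] margin_nonneg[of n "2 * i"]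
      unfolding k(2) norm_of_real_diff_eq by linarith
  qed
  show "inner_twist n i \<in> disk_homeos (marked_points n)"
    unfolding inner_twist_def
  proof (rule disk_twist_homeo[OF inner_annulus[OF i] _ marked_points_subset_disk])
    fix p assume "p \<in> marked_points n"
    then obtain k where k: "p = of_real (position n k)" by (auto simp: marked_points_eq)
    show "norm (p - of_real (inner_center n i)) \<le> 5 / 8 * gap n
      \<or> 3 / 4 * gap n \<le> norm (p - of_real (inner_center n i))"
    proof (cases "k = 2 * i \<or> k = 2 * i + 1")
      case True
      have "\<bar>position n k - inner_center n i\<bar> = gap n / 2"
        using True gap_pos[of n] by (auto simp: position_def inner_center_def algebra_simps)
      then show ?thesis using gap_pos[of n] unfolding k norm_of_real_diff_eq by linarith
    next
      case False
      then show ?thesis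
        using inner_points[of k i n] gap_pos[of n] unfolding k norm_of_real_diff_eq by auto
    qed
  qed
qed

text \<open>
  For \<open>i < j\<close> the disks of both twists numbered \<open>i\<close> lie inside the inner disk of the outer twist numbered \<open>j\<close>
  and are disjoint from the disk of the inner twist numbered \<open>j\<close>.
\<close>

lemma twists_commute:
  assumes i: "1 \<le> i" "2 * i + 1 \<le> n" and j: "1 \<le> j" "2 * j + 1 \<le> n" and ij: "i < j"
    and f: "f \<in> {outer_twist n i, inner_twist n i}" and g: "g \<in> {outer_twist n j, inner_twist n j}"
  shows "compose disk f g = compose disk g f"
proof -
  have ij': "gap n * real i + gap n \<le> gap n * real j"
    using gap_mult_mono[of "i + 1" j n] ij by (simp add: algebra_simps)
  have m: "margin n (2 * i + 1) \<le> margin n (2 * j)" "margin n (2 * i + 1) \<le> gap n" "0 \<le> margin n (2 * j)"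
    using margin_mono[of "2 * i + 1" "2 * j" n] ij margin_le[OF i(2)] margin_nonneg by simp_all
  have i1: "gap n \<le> gap n * real i" using gap_mult_mono[of 1 i n] i by simp
  note defs = norm_of_real_diff_eq outer_center_def inner_center_def outer_radius_def
  have "compose disk (outer_twist n i) (outer_twist n j) = compose disk (outer_twist n j) (outer_twist n i)"
    unfolding outer_twist_def
    by (rule disk_twist_commute[OF outer_annulus[OF i] outer_annulus[OF j]])
      (unfold defs, use ij' m gap_pos[of n] in linarith)
  moreover have "compose disk (outer_twist n i) (inner_twist n j) = compose disk (inner_twist n j) (outer_twist n i)"
    unfolding outer_twist_def inner_twist_def
    by (rule disk_twist_commute[OF outer_annulus[OF i] inner_annulus[OF j]])
      (unfold defs, use ij' m gap_pos[of n] in linarith)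
  moreover have "compose disk (inner_twist n i) (outer_twist n j) = compose disk (outer_twist n j) (inner_twist n i)"
    unfolding outer_twist_def inner_twist_def
    by (rule disk_twist_commute[OF inner_annulus[OF i] outer_annulus[OF j]])
      (unfold defs, use ij' m i1 gap_pos[of n] in linarith)
  moreover have "compose disk (inner_twist n i) (inner_twist n j) = compose disk (inner_twist n j) (inner_twist n i)"
    unfolding inner_twist_def
    by (rule disk_twist_commute[OF inner_annulus[OF i] inner_annulus[OF j]])
      (unfold defs, use ij' gap_pos[of n] in linarith)
  ultimately show ?thesis using f g by auto
qed

lemma (in group) commute_generate:
  assumes S: "S \<subseteq> carrier G" and t: "t \<in> carrier G"
    and comm: "\<And>s. s \<in> S \<Longrightarrow> s \<otimes> t = t \<otimes> s" and g: "g \<in> generate G S"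
  shows "g \<otimes> t = t \<otimes> g"
  using g
proof (induction rule: generate.induct)
  case one
  then show ?case using t by simp
next
  case (incl h)
  then show ?case by (rule comm)
next
  case (inv h)
  then have h: "h \<in> carrier G" using S by blast
  have "inv h \<otimes> t = inv h \<otimes> (t \<otimes> h) \<otimes> inv h" using h t by (simp add: m_assoc)
  also have "\<dots> = inv h \<otimes> (h \<otimes> t) \<otimes> inv h" by (simp only: comm[OF inv])
  also have "\<dots> = t \<otimes> inv h" using h t by (simp add: m_assoc[symmetric])
  finally show ?case .
next
  case (eng h k)
  then have hk: "h \<in> carrier G" "k \<in> carrier G" using generate_in_carrier[OF S] by blast+
  have "h \<otimes> k \<otimes> t = h \<otimes> (t \<otimes> k)" using hk t eng.IH(2) by (simp add: m_assoc)
  also have "\<dots> = t \<otimes> (h \<otimes> k)" using hk t eng.IH(1) by (simp add: m_assoc[symmetric])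
  finally show ?case .
qed

definition twist_subgroup :: "nat \<Rightarrow> nat \<Rightarrow> (complex \<Rightarrow> complex) set"
  where "twist_subgroup n i = generate (disk_homeo_group (marked_points n)) {outer_twist n i, inner_twist n i}"

lemma twist_subgroups_commute:
  assumes i: "1 \<le> i" "2 * i + 1 \<le> n" and j: "1 \<le> j" "2 * j + 1 \<le> n" and ij: "i \<noteq> j"
    and g: "g \<in> twist_subgroup n i" and h: "h \<in> twist_subgroup n j"
  shows "g \<otimes>\<^bsub>disk_homeo_group (marked_points n)\<^esub> h = h \<otimes>\<^bsub>disk_homeo_group (marked_points n)\<^esub> g"
proof -
  let ?G = "disk_homeo_group (marked_points n)"
  interpret group ?G by (rule group_disk_homeo_group[OF marked_points_subset_disk])
  let ?S = "\<lambda>i. {outer_twist n i, inner_twist n i}"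
  have S: "?S i \<subseteq> disk_homeos (marked_points n)" if "1 \<le> i" "2 * i + 1 \<le> n" for i
    using twists_in_disk_homeos[OF that] by simp
  have Sc: "?S i \<subseteq> carrier ?G" if "1 \<le> i" "2 * i + 1 \<le> n" for i
    unfolding disk_homeo_group_simps(1) by (rule S[OF that])
  have st: "s \<otimes>\<^bsub>?G\<^esub> t = t \<otimes>\<^bsub>?G\<^esub> s" if s: "s \<in> ?S i" and t: "t \<in> ?S j" for s t
  proof -
    have sc: "s \<in> disk_homeos (marked_points n)" and tc: "t \<in> disk_homeos (marked_points n)"
      using S[OF i] S[OF j] s t by blast+
    have "compose disk s t = compose disk t s"
      using ij twists_commute[OF i j _ s t] twists_commute[OF j i _ t s] by (metis linorder_neqE_nat)
    then show ?thesis by (simp only: disk_homeo_group_simps(3)[OF sc tc] disk_homeo_group_simps(3)[OF tc sc])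
  qed
  have hc: "h \<in> carrier ?G" using h generate_in_carrier[OF Sc[OF j]] by (simp add: twist_subgroup_def)
  have sh: "s \<otimes>\<^bsub>?G\<^esub> h = h \<otimes>\<^bsub>?G\<^esub> s" if s: "s \<in> ?S i" for s
  proof -
    have "h \<otimes>\<^bsub>?G\<^esub> s = s \<otimes>\<^bsub>?G\<^esub> h"
      by (rule commute_generate[OF Sc[OF j]]) (use s h Sc[OF i] st in \<open>auto simp: twist_subgroup_def\<close>)
    then show ?thesis by simp
  qed
  show ?thesis
    by (rule commute_generate[OF Sc[OF i] hc sh]) (use g in \<open>auto simp: twist_subgroup_def\<close>)
qed

text \<open>
  The monodromy of the marked points \<open>1\<close>, \<open>2 * i\<close> and \<open>2 * i + 1\<close> sends the two generators to two
  3-cycles that generate a non-solvable group: the outer twist turns the first pair of these points about its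
  midpoint, the inner twist the last pair.
\<close>

lemma twist_subgroup_not_solvable_modulo_isotopy:
  assumes i: "1 \<le> i" "2 * i + 1 \<le> n"
  shows "\<exists>h\<in>(derived (disk_homeo_group (marked_points n)) ^^ k) (twist_subgroup n i).
    h \<notin> disk_homeos_isotopic_id (marked_points n)"
proof -
  let ?P = "marked_points n"
  let ?G = "disk_homeo_group ?P"
  interpret group ?G by (rule group_disk_homeo_group[OF marked_points_subset_disk])
  define p1 p2 p3 :: complex where
    "p1 = of_real (position n 1)" and "p2 = of_real (position n (2 * i))" and "p3 = of_real (position n (2 * i + 1))"
  note p = p1_def p2_def p3_def
  have inj: "position n k \<noteq> position n l" if "k \<noteq> l" for k l
    using that gap_pos[of n] by (simp add: position_def)
  interpret marked_triple "cyc 0 1 2" "cyc 2 4 3" p1 p2 p3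
  proof
    show "bij (cyc 0 1 2)" by (rule o_bij[OF cyc_inverse(1,2)])
    show "bij (cyc 2 4 3)" by (rule o_bij[OF cyc_inverse(4,3)])
    show "p1 \<noteq> p2" "p1 \<noteq> p3" "p2 \<noteq> p3"
      unfolding p of_real_eq_iff using i by (intro inj; simp)+
  qed
  have sub: "{p1, p2, p3} \<subseteq> ?P" unfolding p marked_points_eq using i by (intro insert_subsetI imageI) auto
  define \<rho> where "\<rho> f = monodromy (extend_id f)" for f
  have mult: "\<rho> (f \<otimes>\<^bsub>?G\<^esub> g) = \<rho> f \<circ> \<rho> g" if "f \<in> carrier ?G" "g \<in> carrier ?G" for f g
    using monodromy_extend_mult[OF marked_points_subset_disk sub] that by (simp add: \<rho>_def disk_homeo_group_simps(1))
  have one: "\<rho> \<one>\<^bsub>?G\<^esub> = id" by (simp only: \<rho>_def disk_homeo_group_simps(2) extend_id_id monodromy_id)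
  have gi: "gap n \<le> gap n * real i" using gap_mult_mono[of 1 i n] i by simp
  have outer: "\<rho> (outer_twist n i) = cyc 0 1 2"
    unfolding \<rho>_def outer_twist_def
  proof (rule monodromy_twist_first_pair)
    show "0 < outer_radius n i" using gi gap_pos[of n] by (simp add: outer_radius_def)
    show "outer_radius n i \<le> outer_radius n i + margin n (2 * i)" using margin_nonneg by simp
    show "outer_radius n i + margin n (2 * i + 1) \<le> outer_radius n i + gap n" using margin_le[OF i(2)] by simp
    show "p1 = of_real (outer_center n i) - of_real (outer_radius n i)"
      "p2 = of_real (outer_center n i) + of_real (outer_radius n i)"
      "p3 = of_real (outer_center n i) + of_real (outer_radius n i + gap n)"
      unfolding p of_real_add[symmetric] of_real_diff[symmetric] of_real_eq_iff
      by (simp_all add: position_def outer_center_def outer_radius_def algebra_simps)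
  qed (use outer_annulus[OF i] in auto)
  have "cyc 2 4 3 \<circ> \<rho> (inner_twist n i) = id"
    unfolding \<rho>_def inner_twist_def
  proof (rule monodromy_twist_last_pair)
    show "0 < gap n / 2" "gap n / 2 \<le> 5 / 8 * gap n" using gap_pos[of n] by simp_all
    show "3 / 4 * gap n \<le> 2 * (gap n * real i) - gap n / 2" using gi gap_pos[of n] by linarith
    show "p1 = of_real (inner_center n i) - of_real (2 * (gap n * real i) - gap n / 2)"
      "p2 = of_real (inner_center n i) - of_real (gap n / 2)"
      "p3 = of_real (inner_center n i) + of_real (gap n / 2)"
      unfolding p of_real_add[symmetric] of_real_diff[symmetric] of_real_eq_iff
      by (simp_all add: position_def inner_center_def algebra_simps)
  qed (use inner_annulus[OF i] in auto)
  then have "cyc 2 3 4 \<circ> (cyc 2 4 3 \<circ> \<rho> (inner_twist n i)) = cyc 2 3 4" by simp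
  then have inner: "\<rho> (inner_twist n i) = cyc 2 3 4"
    unfolding comp_assoc[symmetric] cyc_inverse by simp
  have Sc: "{outer_twist n i, inner_twist n i} \<subseteq> carrier ?G"
    using twists_in_disk_homeos[OF i] by (simp add: disk_homeo_group_simps(1))
  have H: "subgroup (twist_subgroup n i) ?G"
    unfolding twist_subgroup_def by (rule generate_is_subgroup[OF Sc])
  have "outer_twist n i \<in> twist_subgroup n i" "inner_twist n i \<in> twist_subgroup n i"
    unfolding twist_subgroup_def by (rule generate.incl, simp)+
  from derived_power_hits_cycles[OF H this mult one outer inner, of k]
  obtain h where h: "h \<in> (derived ?G ^^ k) (twist_subgroup n i)" "\<rho> h = cyc 0 1 2" by blast
  have "h \<notin> disk_homeos_isotopic_id ?P"
  proof
    assume "h \<in> disk_homeos_isotopic_id ?P"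
    then have "disk_isotopic ?P h \<one>\<^bsub>?G\<^esub>" by (simp add: disk_homeos_isotopic_id_def)
    then have "\<rho> h = \<rho> \<one>\<^bsub>?G\<^esub>"
      unfolding \<rho>_def by (rule monodromy_extend_isotopic[OF marked_points_subset_disk sub])
    then have "cyc 0 1 2 0 = id 0" by (simp only: h(2) one)
    then show False by (simp add: cyc_def)
  qed
  then show ?thesis using h(1) by blast
qed

section \<open>Faithful representations of pure braid groups\<close>

theorem faithful_degree_ge:
  assumes m: "2 * m + 1 \<le> n" and \<phi>: "\<phi> \<in> mon (pure_braid_group n) (GL_complex d)"
  shows "2 * m \<le> d"
proof -
  let ?P = "marked_points n"
  let ?G = "disk_homeo_group ?P" and ?N = "disk_homeos_isotopic_id ?P"
  interpret N: normal ?N ?G by (rule normal_disk_homeos_isotopic_id[OF marked_points_subset_disk])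
  have PB: "pure_braid_group n = ?G Mod ?N" by (simp add: pure_braid_group_def pure_disk_mcg_def)
  have q: "(\<lambda>f. ?N #>\<^bsub>?G\<^esub> f) \<in> hom ?G (pure_braid_group n)"
    unfolding PB by (rule N.r_coset_hom_Mod)
  have hom: "\<phi> \<circ> (\<lambda>f. ?N #>\<^bsub>?G\<^esub> f) \<in> hom ?G (GL_complex d)"
    by (rule hom_compose[OF q]) (use \<phi> in \<open>simp add: mon_def\<close>)
  have ker: "f \<in> ?N" if f: "f \<in> carrier ?G" and "\<phi> (?N #>\<^bsub>?G\<^esub> f) = \<one>\<^bsub>GL_complex d\<^esub>" for f
  proof -
    have "\<phi> (?N #>\<^bsub>?G\<^esub> \<one>\<^bsub>?G\<^esub>) = \<one>\<^bsub>GL_complex d\<^esub>"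
      using hom_one[OF hom N.is_group group_GL_complex] by simp
    then have "\<phi> (?N #>\<^bsub>?G\<^esub> f) = \<phi> (?N #>\<^bsub>?G\<^esub> \<one>\<^bsub>?G\<^esub>)" using that(2) by (simp only:)
    moreover have "inj_on \<phi> (carrier (pure_braid_group n))" using \<phi> by (simp add: mon_def)
    ultimately have "?N #>\<^bsub>?G\<^esub> f = ?N #>\<^bsub>?G\<^esub> \<one>\<^bsub>?G\<^esub>"
      using inj_onD hom_in_carrier[OF q f] hom_in_carrier[OF q N.one_closed] by meson
    then have "disk_isotopic ?P f \<one>\<^bsub>?G\<^esub>"
      by (rule iffD1[OF rcoset_eq_iff_disk_isotopic[OF marked_points_subset_disk], rotated 2])
        (use f N.one_closed in \<open>simp_all only: disk_homeo_group_simps(1)\<close>)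
    then show ?thesis using f by (simp add: disk_homeos_isotopic_id_def disk_homeo_group_simps(1))
  qed
  have range: "1 \<le> i" "2 * i + 1 \<le> n" if "i \<in> {1..m}" for i using that m by auto
  have H: "subgroup (twist_subgroup n i) ?G" if "i \<in> {1..m}" for i
    unfolding twist_subgroup_def using twists_in_disk_homeos[OF range[OF that]]
    by (intro N.generate_is_subgroup) (simp add: disk_homeo_group_simps(1))
  have "2 * card {1..m} \<le> d"
  proof (rule card_commuting_nonsolvable_le_degree[OF N.is_group hom _ H])
    fix i j g h
    assume "i \<in> {1..m}" "j \<in> {1..m}" "i \<noteq> j" "g \<in> twist_subgroup n i" "h \<in> twist_subgroup n j"
    then show "g \<otimes>\<^bsub>?G\<^esub> h = h \<otimes>\<^bsub>?G\<^esub> g"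
      by (intro twist_subgroups_commute[OF range range])
  next
    fix i k assume i: "i \<in> {1..m}"
    obtain h where h: "h \<in> (derived ?G ^^ k) (twist_subgroup n i)" "h \<notin> ?N"
      using twist_subgroup_not_solvable_modulo_isotopy[OF range[OF i]] by blast
    have "h \<in> carrier ?G"
      using h(1) N.exp_of_derived_in_carrier[OF subgroup.subset[OF H[OF i]]] by blast
    then have "(\<phi> \<circ> (\<lambda>f. ?N #>\<^bsub>?G\<^esub> f)) h \<noteq> \<one>\<^bsub>GL_complex d\<^esub>" using ker h(2) by auto
    then show "\<exists>h\<in>(derived ?G ^^ k) (twist_subgroup n i). (\<phi> \<circ> (\<lambda>f. ?N #>\<^bsub>?G\<^esub> f)) h \<noteq> \<one>\<^bsub>GL_complex d\<^esub>"
      using h(1) by blast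
  qed simp
  then show ?thesis by simp
qed

theorem theorem4:
  fixes n :: nat
  assumes "n \<ge> 1"
  shows "(odd n \<longrightarrow> min_faithful_dim (pure_braid_group n) \<ge> enat (n - 1)) \<and>
         (even n \<longrightarrow> min_faithful_dim (pure_braid_group n) \<ge> enat (n - 2))"
proof -
  have ge: "enat (2 * m) \<le> min_faithful_dim (pure_braid_group n)" if "2 * m + 1 \<le> n" for m
    unfolding min_faithful_dim_def
  proof (rule Inf_greatest)
    fix x assume "x \<in> {enat d |d. mon (pure_braid_group n) (GL_complex d) \<noteq> {}}"
    then show "enat (2 * m) \<le> x" using faithful_degree_ge[OF that] by auto
  qed
  show ?thesis
  proof (intro conjI impI)
    assume "odd n"
    then obtain m where "n = 2 * m + 1" by (rule oddE)
    then show "enat (n - 1) \<le> min_faithful_dim (pure_braid_group n)" using ge[of m] by simp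
  next
    assume "even n"
    then obtain l where "n = 2 * l" by (rule evenE)
    then have "n - 2 = 2 * (l - 1)" "2 * (l - 1) + 1 \<le> n" using assms by auto
    then show "enat (n - 2) \<le> min_faithful_dim (pure_braid_group n)" using ge[of "l - 1"] by simp
  qed
qed

end
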